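(* For any $W^*$-algebra $M$ equipped with a faithful normal semifinite trace $\tau$, the following are equivalent: (1) $M$ is abelian. (2) $M$ is $*$-isomorphic to $L^\infty(X,\Sigma,\mu)$ where $(X,\Sigma,\mu)$ is a localizable measure space. (3) $M$ is $*$-isomorphic to $L^\infty(X,\Sigma,\mu)$ where $(X,\Sigma,\mu)$ is a decomposable measure space. (4) $M$ is $*$-isomorphic to $L^\infty(X,\mathscr B,\mu)$ where $(X,\mathfrak T,\mathscr B,\mu)$ is a Radon measure space. In each of the cases (2)--(4), the $*$-isomorphism $\mathcal I$ can be chosen so as to satisfy $\tau=\int_X\mathcal I(\cdot)\,d\mu$.
   Context: A $W^*$-algebra is a $C^*$-algebra with a Banach space predual. $L^\infty$ of a measure space is the $C^*$-algebra of essentially bounded complex measurable functions modulo a.e. equality. A faithful normal semifinite trace on $M$ is understood in the usual von Neumann algebra sense, as a map $\tau:M_+\to[0,\infty]$. A measure space $(X,\Sigma,\mu)$ is localizable if $\mu$ is semifinite (every set of infinite measure contains a measurable subset of strictly positive finite measure) and every increasing net of projections of $L^\infty(X,\Sigma,\mu)$ has a supremum in the lattice of projections. It is decomposable if $X$ can be partitioned into measurable sets $X_t$ of finite measure such that $\Sigma=\{E\subset X:E\cap X_t\in\Sigma\text{ for all }t\}$ and $\mu(E)=\sum_t\mu(E\cap X_t)$ for all $E\in\Sigma$. A Radon measure space is a quadruple $(X,\mathfrak T,\mathscr B,\mu)$ such that: (i) $(X,\mathscr B,\mu)$ is a complete measure space; (ii) if $E\subseteq X$ and $E\cap F\in\mathscr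 B$ for all $F\in\mathscr B$ with $\mu(F)<\infty$, then $E\in\mathscr B$; (iii) $\mathfrak T$ is a Hausdorff topology on $X$; (iv) $\mathfrak T\subset\mathscr B$; (v) for every $E\in\mathscr B$, $\mu(E)=\sup\{\mu(C):C\subseteq E,\ C\text{ compact}\}$; (vi) every $x\in X$ has an open neighborhood $U$ with $\mu(U)<\infty$. *)

theory Defs
  imports "HOL-Analysis.Analysis" "HOL-Library.Disjoint_Sets"
begin

section \<open>$C^*$-algebras and $W^*$-algebras\<close>

text \<open>The real scalar multiplication is inherited from \<^class>\<open>banach\<close>; \<open>scaleC\<close> extends it
  to the complex numbers. The zero space is an instance.\<close>

class complex_banach = banach +
  fixes scaleC :: "complex \<Rightarrow> 'a \<Rightarrow> 'a" (infixr "*\<^sub>C" 75)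
  assumes scaleC_add_right: "a *\<^sub>C (x + y) = a *\<^sub>C x + a *\<^sub>C y"
    and scaleC_add_left: "(a + b) *\<^sub>C x = a *\<^sub>C x + b *\<^sub>C x"
    and scaleC_scaleC: "a *\<^sub>C (b *\<^sub>C x) = (a * b) *\<^sub>C x"
    and scaleC_of_real: "complex_of_real r *\<^sub>C x = r *\<^sub>R x"
    and norm_scaleC: "norm (a *\<^sub>C x) = cmod a * norm x"

text \<open>No unit is assumed, and the zero algebra is allowed; \<^class>\<open>real_normed_algebra\<close> supplies
  the submultiplicativity of the norm.\<close>

class cstar_algebra = complex_banach + real_normed_algebra +
  fixes star :: "'a \<Rightarrow> 'a"
  assumes mult_scaleC_left: "(a *\<^sub>C x) * y = a *\<^sub>C (x * y)"
    and mult_scaleC_right: "x * (a *\<^sub>C y) = a *\<^sub>C (x * y)"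
    and star_add: "star (x + y) = star x + star y"
    and star_scaleC: "star (a *\<^sub>C x) = cnj a *\<^sub>C star x"
    and star_mult: "star (x * y) = star y * star x"
    and star_star: "star (star x) = x"
    and cstar_identity: "norm (star x * x) = (norm x)\<^sup>2"

definition continuous_dual :: "('p::complex_banach \<Rightarrow> complex) set" where
  "continuous_dual = {\<phi>. bounded_linear \<phi> \<and> (\<forall>c x. \<phi> (c *\<^sub>C x) = c * \<phi> x)}"

text \<open>\<open>D\<close> is an isometric linear isomorphism of the Banach space \<open>'a\<close> onto the dual of \<open>'p\<close>; for a
  $C^*$-algebra \<open>'a\<close> it exhibits \<open>'p\<close> as a predual, which makes \<open>'a\<close> a $W^*$-algebra.\<close>

definition predual_iso :: "('a::complex_banach \<Rightarrow> 'p::complex_banach \<Rightarrow> complex) \<Rightarrow> bool" where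
  "predual_iso D \<longleftrightarrow>
     bij_betw D UNIV continuous_dual \<and>
     (\<forall>x y p. D (x + y) p = D x p + D y p) \<and>
     (\<forall>c x p. D (c *\<^sub>C x) p = c * D x p) \<and>
     (\<forall>x. onorm (D x) = norm x)"

section \<open>Suprema of increasing nets\<close>

text \<open>The range of an increasing net is an upward directed set, and an upward directed set is an
  increasing net indexed by itself; the supremum of a net is that of its range.\<close>

definition upward_directed :: "('b \<Rightarrow> 'b \<Rightarrow> bool) \<Rightarrow> 'b set \<Rightarrow> bool" where
  "upward_directed le A \<longleftrightarrow> A \<noteq> {} \<and> (\<forall>x\<in>A. \<forall>y\<in>A. \<exists>z\<in>A. le x z \<and> le y z)"

definition is_supremum_in :: "('b \<Rightarrow> 'b \<Rightarrow> bool) \<Rightarrow> 'b set \<Rightarrow> 'b set \<Rightarrow> 'b \<Rightarrow> bool" where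
  "is_supremum_in le S A s \<longleftrightarrow>
     s \<in> S \<and> (\<forall>a\<in>A. le a s) \<and> (\<forall>u\<in>S. (\<forall>a\<in>A. le a u) \<longrightarrow> le s u)"

section \<open>Traces\<close>

definition selfadjoint_part :: "'a::cstar_algebra set" where
  "selfadjoint_part = {x. star x = x}"

definition positive_cone :: "'a::cstar_algebra set" where
  "positive_cone = {x. \<exists>y. x = star y * y}"

definition cstar_le :: "'a::cstar_algebra \<Rightarrow> 'a \<Rightarrow> bool" where
  "cstar_le x y \<longleftrightarrow> y - x \<in> positive_cone"

text \<open>In the following definitions \<open>\<tau>\<close> is total, but its values matter only on the positive cone.
  Note that \<open>0 * \<infinity> = 0\<close> in \<^typ>\<open>ennreal\<close>.\<close>

definition trace :: "('a::cstar_algebra \<Rightarrow> ennreal) \<Rightarrow> bool" where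
  "trace \<tau> \<longleftrightarrow>
     (\<forall>x\<in>positive_cone. \<forall>y\<in>positive_cone. \<tau> (x + y) = \<tau> x + \<tau> y) \<and>
     (\<forall>x\<in>positive_cone. \<forall>r\<ge>0. \<tau> (r *\<^sub>R x) = ennreal r * \<tau> x) \<and>
     (\<forall>x. \<tau> (star x * x) = \<tau> (x * star x))"

definition faithful :: "('a::cstar_algebra \<Rightarrow> ennreal) \<Rightarrow> bool" where
  "faithful \<tau> \<longleftrightarrow> (\<forall>x\<in>positive_cone. \<tau> x = 0 \<longrightarrow> x = 0)"

definition normal :: "('a::cstar_algebra \<Rightarrow> ennreal) \<Rightarrow> bool" where
  "normal \<tau> \<longleftrightarrow>
     (\<forall>A s. A \<subseteq> positive_cone \<and> upward_directed cstar_le A \<and>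
        is_supremum_in cstar_le selfadjoint_part A s \<longrightarrow> \<tau> s = (SUP a\<in>A. \<tau> a))"

definition semifinite_trace :: "('a::cstar_algebra \<Rightarrow> ennreal) \<Rightarrow> bool" where
  "semifinite_trace \<tau> \<longleftrightarrow>
     (\<forall>x\<in>positive_cone. x \<noteq> 0 \<longrightarrow>
        (\<exists>y\<in>positive_cone. y \<noteq> 0 \<and> cstar_le y x \<and> \<tau> y < \<infinity>))"

definition fns_trace :: "('a::cstar_algebra \<Rightarrow> ennreal) \<Rightarrow> bool" where
  "fns_trace \<tau> \<longleftrightarrow> trace \<tau> \<and> faithful \<tau> \<and> normal \<tau> \<and> semifinite_trace \<tau>"

section \<open>The algebra $L^\infty$ of a measure space\<close>

text \<open>Elements of \<open>Linf N\<close> are a.e.-equivalence classes; the operations are lifted from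
  representatives. Values outside \<open>space N\<close> are irrelevant, since both measurability and
  the a.e. quantifier only look at \<open>space N\<close>.\<close>

definition ess_bounded :: "'x measure \<Rightarrow> ('x \<Rightarrow> complex) set" where
  "ess_bounded N = {f \<in> borel_measurable N. \<exists>C. AE w in N. cmod (f w) \<le> C}"

definition ae_rel :: "'x measure \<Rightarrow> (('x \<Rightarrow> complex) \<times> ('x \<Rightarrow> complex)) set" where
  "ae_rel N = {(f, g). f \<in> ess_bounded N \<and> g \<in> ess_bounded N \<and> (AE w in N. f w = g w)}"

definition Linf :: "'x measure \<Rightarrow> ('x \<Rightarrow> complex) set set" where
  "Linf N = ess_bounded N // ae_rel N"

definition Linf_add :: "'x measure \<Rightarrow> ('x \<Rightarrow> complex) set \<Rightarrow> ('x \<Rightarrow> complex) set \<Rightarrow> ('x \<Rightarrow> complex) set" where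
  "Linf_add N F G = (\<Union>f\<in>F. \<Union>g\<in>G. ae_rel N `` {\<lambda>w. f w + g w})"

definition Linf_mult :: "'x measure \<Rightarrow> ('x \<Rightarrow> complex) set \<Rightarrow> ('x \<Rightarrow> complex) set \<Rightarrow> ('x \<Rightarrow> complex) set" where
  "Linf_mult N F G = (\<Union>f\<in>F. \<Union>g\<in>G. ae_rel N `` {\<lambda>w. f w * g w})"

definition Linf_scale :: "'x measure \<Rightarrow> complex \<Rightarrow> ('x \<Rightarrow> complex) set \<Rightarrow> ('x \<Rightarrow> complex) set" where
  "Linf_scale N c F = (\<Union>f\<in>F. ae_rel N `` {\<lambda>w. c * f w})"

definition Linf_star :: "'x measure \<Rightarrow> ('x \<Rightarrow> complex) set \<Rightarrow> ('x \<Rightarrow> complex) set" where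
  "Linf_star N F = (\<Union>f\<in>F. ae_rel N `` {\<lambda>w. cnj (f w)})"

definition Linf_projections :: "'x measure \<Rightarrow> ('x \<Rightarrow> complex) set set" where
  "Linf_projections N = {P \<in> Linf N. Linf_mult N P P = P \<and> Linf_star N P = P}"

definition Linf_proj_le :: "'x measure \<Rightarrow> ('x \<Rightarrow> complex) set \<Rightarrow> ('x \<Rightarrow> complex) set \<Rightarrow> bool" where
  "Linf_proj_le N P Q \<longleftrightarrow> Linf_mult N P Q = P"

definition star_iso_Linf :: "('a::cstar_algebra \<Rightarrow> ('x \<Rightarrow> complex) set) \<Rightarrow> 'x measure \<Rightarrow> bool" where
  "star_iso_Linf I N \<longleftrightarrow>
     bij_betw I UNIV (Linf N) \<and>
     (\<forall>x y. I (x + y) = Linf_add N (I x) (I y)) \<and>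
     (\<forall>c x. I (c *\<^sub>C x) = Linf_scale N c (I x)) \<and>
     (\<forall>x y. I (x * y) = Linf_mult N (I x) (I y)) \<and>
     (\<forall>x. I (star x) = Linf_star N (I x))"

text \<open>$\tau = \int \mathcal{I}(\cdot)\,d\mu$ on the positive cone. A $*$-isomorphism maps a positive element to
  the class of an a.e. nonnegative real function \<open>f\<close>, so \<open>ennreal (Re (f w))\<close> is \<open>f w\<close> itself
  for a.e. \<open>w\<close>.\<close>

definition trace_is_integral ::
    "('a::cstar_algebra \<Rightarrow> ennreal) \<Rightarrow> ('a \<Rightarrow> ('x \<Rightarrow> complex) set) \<Rightarrow> 'x measure \<Rightarrow> bool" where
  "trace_is_integral \<tau> I N \<longleftrightarrow>
     (\<forall>x\<in>positive_cone. \<forall>f\<in>I x. \<tau> x = (\<integral>\<^sup>+ w. ennreal (Re (f w)) \<partial>N))"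

section \<open>Classes of measure spaces\<close>

definition semifinite_measure :: "'x measure \<Rightarrow> bool" where
  "semifinite_measure N \<longleftrightarrow>
     (\<forall>E\<in>sets N. emeasure N E = \<infinity> \<longrightarrow>
        (\<exists>F\<in>sets N. F \<subseteq> E \<and> 0 < emeasure N F \<and> emeasure N F < \<infinity>))"

definition localizable :: "'x measure \<Rightarrow> bool" where
  "localizable N \<longleftrightarrow> semifinite_measure N \<and>
     (\<forall>\<P>. \<P> \<subseteq> Linf_projections N \<and> upward_directed (Linf_proj_le N) \<P> \<longrightarrow>
        (\<exists>S. is_supremum_in (Linf_proj_le N) (Linf_projections N) \<P> S))"

definition decomposable :: "'x measure \<Rightarrow> bool" where
  "decomposable N \<longleftrightarrow>
     (\<exists>\<X>. partition_on (space N) \<X> \<and>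
        (\<forall>X\<in>\<X>. X \<in> sets N \<and> emeasure N X < \<infinity>) \<and>
        sets N = {E. E \<subseteq> space N \<and> (\<forall>X\<in>\<X>. E \<inter> X \<in> sets N)} \<and>
        (\<forall>E\<in>sets N. emeasure N E = (\<Sum>\<^sub>\<infinity>X\<in>\<X>. emeasure N (E \<inter> X))))"

definition radon_measure_space :: "'x topology \<Rightarrow> 'x measure \<Rightarrow> bool" where
  "radon_measure_space T N \<longleftrightarrow>
     complete_measure N \<and>
     (\<forall>E. E \<subseteq> space N \<and> (\<forall>F\<in>sets N. emeasure N F < \<infinity> \<longrightarrow> E \<inter> F \<in> sets N) \<longrightarrow> E \<in> sets N) \<and>
     topspace T = space N \<and> Hausdorff_space T \<and>
     (\<forall>U. openin T U \<longrightarrow> U \<in> sets N) \<and>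
     (\<forall>E\<in>sets N. emeasure N E = (SUP C\<in>{C. compactin T C \<and> C \<subseteq> E}. emeasure N C)) \<and>
     (\<forall>x\<in>topspace T. \<exists>U. openin T U \<and> x \<in> U \<and> emeasure N U < \<infinity>)"

end

theory Submission
  imports Defs
begin

text \<open>Let \<open>M\<close> be abelian. An extreme point of the self-adjoint unit ball, which is weak* compact, yields
  a unit, and weak* compactness also yields suprema of bounded increasing nets; hence \<open>M\<close> has
  spectral projections. Let \<open>X\<close> consist of the characters that take the value 1 on some member of a
  maximal orthogonal family of projections of finite trace. By normality, the sets
  \<open>U q = {\<omega>. \<omega> q = 1}\<close>, with \<open>q\<close> a projection, exhaust modulo negligible sets a \<open>\<sigma>\<close>-algebra that contains
  the open sets of pointwise convergence, and \<open>U q \<mapsto> \<tau> q\<close> is a measure on it. This one measure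
  space is localizable, decomposable and Radon, and \<open>x \<mapsto> (\<omega> \<mapsto> \<omega> x)\<close> is the required isomorphism.\<close>

section \<open>Extreme points\<close>

text \<open>The predual enters only through an isometry of \<open>M\<close> onto its dual, so weak*
  arguments are run on norm balls: neither \<open>star\<close> nor the order is known beforehand to
  be compatible with that topology. Self-adjointness, \<open>a \<sqsubseteq> x\<close> and
  \<open>x \<sqsubseteq> u\<close> are therefore rewritten as membership in families of balls.
  Before a unit exists, \<open>1 - q\<close> is encoded by \<open>q\<close>, with
  \<open>q + q - q * q\<close> standing for \<open>1 - (1 - q)^2\<close>. The trace need not be
  sigma-finite, and this shapes the space. A character with value 1 on no member of the family might
  have no neighbourhood of finite measure, so it is left out. The family may be uncountable, so
  negligibility is defined piece by piece, and unions over the family or over a topological base are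
  controlled by normality on directed sets, where countable additivity would not reach. The converse
  implications rest on commutativity of the pointwise product. The claim about the trace does not
  correct a given isomorphism: it passes through (1) and takes the isomorphism on the constructed
  space.\<close>

lemma compact_fun_extreme_point:
  fixes K :: "('i \<Rightarrow> complex) set"
  assumes "compact K" "closed K" "K \<noteq> {}"
  shows "\<exists>x\<in>K. \<forall>y\<in>K. \<forall>z\<in>K. (\<forall>i. y i + z i = 2 * x i) \<longrightarrow> y = z"
proof -
  define mid where "mid x y z \<longleftrightarrow> (\<forall>i. y i + z i = 2 * x i)" for x y z :: "'i \<Rightarrow> complex"
  \<comment> \<open>Krein-Milman argument: a minimal closed face turns out to be a single point, and
    a one-point face contains a midpoint of two points of \<open>K\<close> only if both coincide
    with it.\<close>
  define face where "face F \<longleftrightarrow> F \<subseteq> K \<and> closed F \<and> F \<noteq> {} \<and>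
     (\<forall>x\<in>F. \<forall>y\<in>K. \<forall>z\<in>K. mid x y z \<longrightarrow> y \<in> F \<and> z \<in> F)" for F
  note cK = assms(2)
  \<comment> \<open>Zorn's lemma produces maximal sets, so it is applied to the complements of the
    faces; compactness of \<open>K\<close> keeps the intersection of a chain nonempty.\<close>
  have "\<exists>M\<in>uminus ` Collect face. \<forall>X\<in>uminus ` Collect face. M \<subseteq> X \<longrightarrow> X = M"
  proof (rule subset_Zorn_nonempty)
    have "face K" using assms cK by (auto simp: face_def)
    then show "uminus ` Collect face \<noteq> {}" by auto
  next
    fix C assume C: "C \<noteq> {}" "subset.chain (uminus ` Collect face) C"
    define G where "G = uminus ` C"
    have G: "G \<noteq> {}" "\<And>F. F \<in> G \<Longrightarrow> face F" "\<And>F F'. F \<in> G \<Longrightarrow> F' \<in> G \<Longrightarrow> F \<subseteq> F' \<or> F' \<subseteq> F"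
      using C unfolding G_def subset.chain_def by (auto 0 3)
    have "K \<inter> \<Inter>G \<noteq> {}"
    proof (rule compact_imp_fip[OF assms(1)])
      fix T assume "T \<in> G" then show "closed T" using G(2) by (auto simp: face_def)
    next
      fix B assume "finite B" "B \<subseteq> G"
      then have "\<exists>F\<in>G. B = {} \<or> F \<subseteq> \<Inter>B"
      proof (induction B)
        case empty then show ?case using G(1) by auto
      next
        case (insert A B)
        then obtain F where F: "F \<in> G" "B = {} \<or> F \<subseteq> \<Inter>B" by auto
        show ?case
        proof (cases "B = {}")
          case True then show ?thesis using insert by auto
        next
          case False
          then have "F \<subseteq> \<Inter>B" "A \<in> G" using F insert by auto
          with G(3)[OF this(2) F(1)] show ?thesis
          proof (elim disjE)
            assume "A \<subseteq> F" then show ?thesis using \<open>A \<in> G\<close> \<open>F \<subseteq> \<Inter>B\<close> by (intro bexI[of _ A]) auto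
          next
            assume "F \<subseteq> A" then show ?thesis using F(1) \<open>F \<subseteq> \<Inter>B\<close> by (intro bexI[of _ F]) auto
          qed
        qed
      qed
      then obtain F where F: "F \<in> G" "B = {} \<or> F \<subseteq> \<Inter>B" by auto
      have "F \<noteq> {}" "F \<subseteq> K" using G(2)[OF F(1)] by (auto simp: face_def)
      then show "K \<inter> \<Inter>B \<noteq> {}" using F by auto
    qed
    then have ne: "\<Inter>G \<noteq> {}" by auto
    obtain F0 where "F0 \<in> G" using G(1) by auto
    then have "\<Inter>G \<subseteq> K" using G(2)[of F0] by (auto simp: face_def)
    moreover have "closed (\<Inter>G)" using G(2) by (auto simp: face_def intro!: closed_Inter)
    moreover have "\<forall>x\<in>\<Inter>G. \<forall>y\<in>K. \<forall>z\<in>K. mid x y z \<longrightarrow> y \<in> \<Inter>G \<and> z \<in> \<Inter>G"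
    proof (intro ballI impI conjI InterI)
      fix x y z F assume *: "x \<in> \<Inter>G" "y \<in> K" "z \<in> K" "mid x y z" "F \<in> G"
      then have "x \<in> F" "face F" using G(2) by auto
      then show "y \<in> F" "z \<in> F" using * unfolding face_def by blast+
    qed
    ultimately have "face (\<Inter>G)" using ne unfolding face_def by blast
    moreover have "\<Union>C = - \<Inter>G" unfolding G_def by auto
    ultimately show "\<Union>C \<in> uminus ` Collect face" by auto
  qed
  then obtain F where F: "face F" and max: "\<forall>X\<in>uminus ` Collect face. - F \<subseteq> X \<longrightarrow> X = - F"
    by auto
  have min: "F' = F" if "face F'" "F' \<subseteq> F" for F'
    using max[rule_format, of "- F'"] that by auto
  have Fne: "F \<noteq> {}" and Fcl: "closed F" and FK: "F \<subseteq> K"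
    and Fmid: "\<And>x y z. \<lbrakk>x \<in> F; y \<in> K; z \<in> K; mid x y z\<rbrakk> \<Longrightarrow> y \<in> F \<and> z \<in> F"
    using F unfolding face_def by blast+
  \<comment> \<open>The points of \<open>F\<close> where \<open>Re (c * x i)\<close> is maximal form
    a smaller face, hence all of \<open>F\<close>; so these real parts are constant on a minimal
    face.\<close>
  have const: "Re (c * x i) = Re (c * y i)" if "x \<in> F" "y \<in> F" for c x y i
  proof -
    have cF: "compact F" using compact_Int_closed[OF assms(1) Fcl] FK
      by (simp add: inf.absorb2)
    have cont: "continuous_on F (\<lambda>x. Re (c * x i))"
      by (intro continuous_intros continuous_on_subset[OF continuous_on_product_coordinates]) auto
    then obtain m where m: "m \<in> F" "\<And>x. x \<in> F \<Longrightarrow> Re (c * x i) \<le> Re (c * m i)"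
      using continuous_attains_sup[OF cF Fne cont] by blast
    define F' where "F' = F \<inter> {x. Re (c * x i) = Re (c * m i)}"
    have "closed {x. Re (c * x i) = Re (c * m i)}"
      by (intro closed_Collect_eq continuous_intros continuous_on_product_coordinates)
    moreover have "y \<in> F' \<and> z \<in> F'"
      if "x \<in> F'" "y \<in> K" "z \<in> K" "mid x y z" for x y z
    proof -
      have yz: "y \<in> F" "z \<in> F" using Fmid[of x y z] that unfolding F'_def by auto
      have "c * y i + c * z i = 2 * (c * x i)" using that(4) by (simp add: mid_def algebra_simps flip: distrib_left)
      from arg_cong[OF this, of Re] have "Re (c * y i) + Re (c * z i) = 2 * Re (c * m i)"
        using that(1) unfolding F'_def by simp
      with m(2)[OF yz(1)] m(2)[OF yz(2)] yz show ?thesis unfolding F'_def by auto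
    qed
    ultimately have "face F'" using Fcl FK m(1) closed_Int[OF Fcl]
      unfolding face_def F'_def by blast
    then have "F' = F" using min unfolding F'_def by blast
    then have "x \<in> F'" "y \<in> F'" using that by auto
    then show ?thesis unfolding F'_def by simp
  qed
  obtain x where x: "x \<in> F" using Fne by blast
  show ?thesis
  proof (intro bexI ballI impI)
    show "x \<in> K" using x FK by blast
    fix y z assume yz: "y \<in> K" "z \<in> K" "\<forall>i. y i + z i = 2 * x i"
    then have "y \<in> F" "z \<in> F" using Fmid[OF x yz(1,2)] by (auto simp: mid_def)
    \<comment> \<open>Since \<open>Re (- \<i> * w) = Im w\<close>, the two multipliers read off both
      parts of a coordinate.\<close>
    then show "y = z" using const[of y z 1] const[of y z "-\<i>"]
      by (auto simp: complex_eq_iff)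
  qed
qed

section \<open>Self-adjoint elements and square roots\<close>

lemma star_scaleR: "star (r *\<^sub>R x) = r *\<^sub>R star (x::'a::cstar_algebra)"
  by (metis complex_cnj_complex_of_real scaleC_of_real star_scaleC)

lemma star_minus: "star (- x) = - star (x::'a::cstar_algebra)"
  using star_scaleR[of "-1" x] by simp

lemma star_zero [simp]: "star (0::'a::cstar_algebra) = 0"
  using star_scaleR[of 0 0] by simp

lemma star_diff: "star (x - y) = star x - star (y::'a::cstar_algebra)"
  using star_add[of x "- y"] by (simp add: star_minus)

lemmas star_simps = star_add star_diff star_minus star_scaleR star_mult star_star star_scaleC

lemma norm_star [simp]: "norm (star x) = norm (x::'a::cstar_algebra)"
proof -
  have "norm x \<le> norm (star x)" for x :: 'a
  proof (cases "x = 0")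
    case False
    have "norm x * norm x \<le> norm (star x) * norm x"
      using norm_mult_ineq[of "star x" x] by (simp add: cstar_identity power2_eq_square)
    with False show ?thesis by simp
  qed simp
  from this[of x] this[of "star x"] show ?thesis by (simp add: star_star)
qed

lemma scaleC_zero [simp]: "c *\<^sub>C (0::'a::complex_banach) = 0"
  using norm_scaleC[of c "0::'a"] by simp

lemma scaleC_minus_right: "c *\<^sub>C (- x) = - (c *\<^sub>C (x::'a::complex_banach))"
  using scaleC_add_right[of c x "- x"] by (simp add: eq_neg_iff_add_eq_0 add.commute)

lemma scaleC_diff_right: "c *\<^sub>C (x - y) = c *\<^sub>C x - c *\<^sub>C (y::'a::complex_banach)"
  using scaleC_add_right[of c x "- y"] by (simp add: scaleC_minus_right)

lemma scaleC_minus_left: "(- c) *\<^sub>C x = - (c *\<^sub>C (x::'a::complex_banach))"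
  using scaleC_scaleC[of "-1" c x] scaleC_of_real[of "-1" "c *\<^sub>C x"] by simp

lemma scaleC_one [simp]: "1 *\<^sub>C x = (x::'a::complex_banach)"
  using scaleC_of_real[of 1 x] by simp

lemma scaleC_scaleR: "c *\<^sub>C (r *\<^sub>R x) = r *\<^sub>R (c *\<^sub>C (x::'a::complex_banach))"
  by (metis mult.commute scaleC_of_real scaleC_scaleC)

lemma bounded_linear_star: "bounded_linear (star :: 'a::cstar_algebra \<Rightarrow> 'a)"
  by (rule bounded_linear_intro[where K = 1]) (auto simp: star_add star_scaleR)

definition re_part :: "'a::cstar_algebra \<Rightarrow> 'a" where
  "re_part x = (1/2) *\<^sub>R (x + star x)"

definition im_part :: "'a::cstar_algebra \<Rightarrow> 'a" where
  "im_part x = - (\<i> *\<^sub>C ((1/2) *\<^sub>R (x - star x)))"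

lemma star_re_part [simp]: "star (re_part x) = re_part x"
  by (simp add: re_part_def star_simps add.commute)

lemma star_im_part [simp]: "star (im_part x) = im_part x"
  by (simp add: im_part_def star_simps scaleC_minus_left scaleC_minus_right scaleC_scaleR scaleC_diff_right
      flip: scaleR_minus_right)

lemma re_im_decomp: "re_part x + \<i> *\<^sub>C im_part x = x"
proof -
  have "\<i> *\<^sub>C im_part x = (1/2) *\<^sub>R (x - star x)"
    by (simp add: im_part_def scaleC_minus_right scaleC_scaleC scaleC_minus_left)
  moreover have "(1/2) *\<^sub>R (x + star x) + (1/2) *\<^sub>R (x - star x) = x"
    by (simp flip: scaleR_add_right scaleR_2)
  ultimately show ?thesis by (simp add: re_part_def)
qed

lemma norm_square_cartesian:
  fixes x y :: "'a::cstar_algebra"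
  assumes "star x = x" "star y = y" "x * y = y * x"
  shows "(norm (x + \<i> *\<^sub>C y))\<^sup>2 = norm (x * x + y * y)"
proof -
  have "star (x + \<i> *\<^sub>C y) * (x + \<i> *\<^sub>C y) = x * x + y * y"
    using assms by (simp add: star_simps algebra_simps mult_scaleC_left mult_scaleC_right
        scaleC_scaleC scaleC_minus_left scaleC_diff_right scaleC_add_right)
  then show ?thesis by (metis cstar_identity)
qed

lemma norm_selfadjoint_square: "star x = x \<Longrightarrow> norm (x * x) = (norm (x::'a::cstar_algebra))\<^sup>2"
  by (metis cstar_identity)

lemma norm_re_part_le: "norm (re_part x) \<le> norm x"
proof -
  have "2 * norm (re_part x) \<le> norm x + norm (star x)"
    unfolding re_part_def using norm_triangle_ineq[of x "star x"] by simp
  then show ?thesis by simp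
qed

lemma norm_im_part_le: "norm (im_part x) \<le> norm x"
proof -
  have "2 * norm (im_part x) \<le> norm x + norm (star x)"
    unfolding im_part_def using norm_triangle_ineq4[of x "star x"] by (simp add: norm_scaleC)
  then show ?thesis by simp
qed

lemma cartesian_unique:
  assumes "star x = x" "star y = y"
  shows "re_part (x + \<i> *\<^sub>C y) = x" "im_part (x + \<i> *\<^sub>C y) = y"
  using assms by (simp_all add: re_part_def im_part_def star_simps scaleC_minus_left scaleC_scaleC
      flip: scaleR_2)

text \<open>A substitute for monotonicity of the norm before any order is available:
  \<open>x\<close> and \<open>y\<close> are the real and imaginary parts of a normal element whose
  squared norm is \<open>norm (x * x + y * y)\<close>.\<close>

lemma norm_le_sum_squares:
  fixes x y :: "'a::cstar_algebra"
  assumes "star x = x" "star y = y" "x * y = y * x"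
  shows "(norm x)\<^sup>2 \<le> norm (x * x + y * y)" "(norm y)\<^sup>2 \<le> norm (x * x + y * y)"
proof -
  have *: "(norm x)\<^sup>2 \<le> norm (x * x + y * y)" if "star x = x" "star y = y" "x * y = y * x" for x y :: 'a
    using norm_re_part_le[of "x + \<i> *\<^sub>C y"] norm_square_cartesian[OF that] cartesian_unique(1)[OF that(1,2)]
    by (metis norm_ge_zero power_mono)
  from *[OF assms] show "(norm x)\<^sup>2 \<le> norm (x * x + y * y)" .
  from *[of y x] assms show "(norm y)\<^sup>2 \<le> norm (x * x + y * y)" by (simp add: add.commute)
qed

text \<open>Reading \<open>h\<close> as \<open>1 - s\<^sup>2\<close> and \<open>r\<close> as \<open>1 - s\<close>, this is the square root of \<open>1 - h\<close>,
  stated without a unit. The iteration for \<open>r\<close> is dominated by the scalar iteration for \<open>h = 1\<close>.\<close>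

lemma sqrt_one_minus:
  fixes h :: "'a::cstar_algebra"
  assumes "norm h \<le> 1" "star h = h"
  obtains r where "star r = r" "norm r \<le> 1" "r + r - r * r = h"
proof -
  \<comment> \<open>\<open>r + r - r * r = h\<close> is the fixed point equation of
    \<open>x \<mapsto> (1/2) *\<^sub>R (h + x * x)\<close>, iterated from 0.\<close>
  define r where "r = rec_nat (0::'a) (\<lambda>_ x. (1/2) *\<^sub>R (h + x * x))"
  define \<rho> where "\<rho> = rec_nat (0::real) (\<lambda>_ x. (1/2) * (1 + x * x))"
  have r: "r 0 = 0" "\<And>n. r (Suc n) = (1/2) *\<^sub>R (h + r n * r n)"
    and \<rho>: "\<rho> 0 = 0" "\<And>n. \<rho> (Suc n) = (1/2) * (1 + \<rho> n * \<rho> n)"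
    by (simp_all add: r_def \<rho>_def)
  have \<rho>01: "0 \<le> \<rho> n \<and> \<rho> n \<le> 1" for n
  proof (induction n)
    case (Suc n)
    then have "\<rho> n * \<rho> n \<le> 1 * 1" by (intro mult_mono) auto
    with Suc show ?case by (simp add: \<rho>)
  qed (simp add: \<rho>)
  have \<rho>mono: "\<rho> n \<le> \<rho> (Suc n)" for n
    using zero_le_square[of "\<rho> n - 1"] by (simp add: \<rho> algebra_simps)
  have nr: "norm (r n) \<le> \<rho> n" for n
  proof (induction n)
    case (Suc n)
    have "norm (r n * r n) \<le> \<rho> n * \<rho> n"
      using norm_mult_ineq[of "r n" "r n"] mult_mono[OF Suc Suc] \<rho>01[of n]
      by (meson norm_ge_zero order_trans)
    with assms(1) norm_triangle_ineq[of h "r n * r n"] show ?case by (simp add: r \<rho>)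
  qed (simp add: r \<rho>)
  have dr: "norm (r (Suc n) - r n) \<le> \<rho> (Suc n) - \<rho> n" for n
  proof (induction n)
    case 0 show ?case using assms by (simp add: r \<rho>)
  next
    case (Suc n)
    have "r (Suc (Suc n)) - r (Suc n) =
        (1/2) *\<^sub>R (r (Suc n) * (r (Suc n) - r n) + (r (Suc n) - r n) * r n)"
      unfolding r(2)[of "Suc n"] r(2)[of n, symmetric]
      by (subst (3) r(2)[of n]) (simp only: scaleR_diff_right[symmetric], simp add: algebra_simps)
    also have "norm \<dots> \<le> (1/2) * (\<rho> (Suc n) * (\<rho> (Suc n) - \<rho> n) + (\<rho> (Suc n) - \<rho> n) * \<rho> n)"
    proof -
      have "norm (r (Suc n) * (r (Suc n) - r n)) \<le> \<rho> (Suc n) * (\<rho> (Suc n) - \<rho> n)"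
        by (rule order_trans[OF norm_mult_ineq mult_mono]) (use nr \<rho>01 \<rho>mono Suc in auto)
      moreover have "norm ((r (Suc n) - r n) * r n) \<le> (\<rho> (Suc n) - \<rho> n) * \<rho> n"
        by (rule order_trans[OF norm_mult_ineq mult_mono]) (use nr \<rho>01 \<rho>mono Suc in auto)
      ultimately show ?thesis
        using norm_triangle_ineq[of "r (Suc n) * (r (Suc n) - r n)" "(r (Suc n) - r n) * r n"] by simp
    qed
    also have "\<dots> = \<rho> (Suc (Suc n)) - \<rho> (Suc n)"
      by (subst (5) \<rho>(2)) (simp add: \<rho>(2)[of "Suc n"] algebra_simps \<rho>(2)[of n])
    finally show ?case .
  qed
  \<comment> \<open>The majorants of the increments telescope, so their summability is just the
    convergence of the bounded monotone sequence \<open>\<rho>\<close>.\<close>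
  have "convergent \<rho>"
    using Bseq_monoseq_convergent[of \<rho>] \<rho>01 \<rho>mono
    by (metis BseqI' abs_of_nonneg incseq_SucI monoseq_iff real_norm_def)
  then have "summable (\<lambda>n. \<rho> (Suc n) - \<rho> n)"
    using telescope_summable convergent_def by blast
  then have "summable (\<lambda>n. r (Suc n) - r n)"
    by (rule summable_comparison_test[rotated]) (use dr in auto)
  then have "(\<lambda>n. \<Sum>i<n. r (Suc i) - r i) \<longlonglongrightarrow> (\<Sum>i. r (Suc i) - r i)"
    by (rule summable_LIMSEQ)
  then obtain L where L: "r \<longlonglongrightarrow> L"
    by (simp add: sum_lessThan_telescope r(1))
  show ?thesis
  proof
    have "star (r n) = r n" for n by (induction n) (simp_all add: r star_simps assms)
    then show "star L = L"
      using bounded_linear.tendsto[OF bounded_linear_star L] L LIMSEQ_unique by auto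
    show "norm L \<le> 1"
      by (rule Lim_bounded[OF tendsto_norm[OF L], of 0]) (meson nr \<rho>01 order_trans)
    have "(\<lambda>n. (1/2) *\<^sub>R (h + r n * r n)) \<longlonglongrightarrow> (1/2) *\<^sub>R (h + L * L)"
      by (intro tendsto_intros L)
    moreover have "(\<lambda>n. (1/2) *\<^sub>R (h + r n * r n)) \<longlonglongrightarrow> L"
      using LIMSEQ_Suc[OF L] by (simp add: r)
    ultimately have "L = (1/2) *\<^sub>R (h + L * L)" using LIMSEQ_unique by blast
    then have "2 *\<^sub>R L = h + L * L" by (metis field_sum_of_halves mult.commute one_add_one real_vector.scale_one scaleR_2 scaleR_left_distrib scaleR_right_distrib scaleR_half_double)
    then show "L + L - L * L = h" by (simp add: scaleR_2)
  qed
qed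

section \<open>Weak* compactness and the unit\<close>

text \<open>Because \<open>D\<close> is an isometry onto the dual, lying in a ball becomes linearity
  plus a separate bound at each \<open>p\<close>, which is the shape that Tychonoff's theorem
  needs.\<close>

lemma predual_ball_image:
  assumes "predual_iso D" "0 \<le> r"
  shows "D ` cball c r = {f. (\<forall>p q. f (p + q) = f p + f q) \<and> (\<forall>a p. f (a *\<^sub>C p) = a * f p) \<and>
    (\<forall>p. f p \<in> cball (D c p) (r * norm p))}" (is "_ = ?R")
proof -
  have bij: "bij_betw D UNIV continuous_dual"
    and add: "\<And>x y p. D (x + y) p = D x p + D y p"
    and scale: "\<And>a x p. D (a *\<^sub>C x) p = a * D x p"
    and nrm: "\<And>x. onorm (D x) = norm x"
    using assms(1) by (auto simp: predual_iso_def)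
  have diff: "D (x - y) p = D x p - D y p" for x y p
    using add[of "x - y" y p] by simp
  have blin: "bounded_linear (D x)" and Dadd: "D x (p + q) = D x p + D x q"
    and Dscale: "D x (a *\<^sub>C p) = a * D x p" for x p q a
  proof -
    have "D x \<in> continuous_dual" using bij by (auto simp: bij_betw_def)
    then show "bounded_linear (D x)" "D x (a *\<^sub>C p) = a * D x p" by (auto simp: continuous_dual_def)
    then show "D x (p + q) = D x p + D x q" by (simp add: linear_simps)
  qed
  show ?thesis
  proof (intro equalityI subsetI)
    fix f assume "f \<in> D ` cball c r"
    then obtain x where "x \<in> cball c r" "f = D x" by blast
    then have x: "norm (x - c) \<le> r" "f = D x" by (simp_all add: dist_norm norm_minus_commute)
    have "cmod (D x p - D c p) \<le> r * norm p" for p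
      using onorm[OF blin, of "x - c" p] x(1) mult_right_mono[OF x(1), of "norm p"]
      by (simp add: diff nrm)
    then show "f \<in> ?R" using x by (auto simp: Dadd Dscale dist_norm norm_minus_commute)
  next
    fix f assume "f \<in> ?R"
    then have f: "\<And>p q. f (p + q) = f p + f q" "\<And>a p. f (a *\<^sub>C p) = a * f p"
      "\<And>p. cmod (f p - D c p) \<le> r * norm p" by (auto simp: dist_norm norm_minus_commute)
    have "cmod (f p) \<le> norm p * (r + norm c)" for p
      using f(3)[of p] onorm[OF blin, of c p] norm_triangle_ineq[of "f p - D c p" "D c p"]
      by (simp add: nrm algebra_simps)
    moreover have "f (a *\<^sub>R p) = a *\<^sub>R f p" for a p
      using f(2)[of "of_real a" p] by (simp add: scaleC_of_real scaleR_conv_of_real)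
    ultimately have "bounded_linear f"
      by (intro bounded_linear_intro[where K = "r + norm c"] f) auto
    then have "f \<in> continuous_dual" using f by (auto simp: continuous_dual_def)
    then obtain x where x: "f = D x" using bij by (auto simp: bij_betw_def)
    have "onorm (D (x - c)) \<le> r"
      by (rule onorm_bound) (use assms(2) f(3) x in \<open>auto simp: diff\<close>)
    then have "x \<in> cball c r" by (simp add: nrm dist_norm norm_minus_commute)
    with x show "f \<in> D ` cball c r" by blast
  qed
qed

text \<open>Banach-Alaoglu: a product of discs, cut by the closed conditions of linearity, in the
  product topology of the function space.\<close>

lemma predual_ball_compact_closed:
  assumes "predual_iso D" "0 \<le> r"
  shows "compact (D ` cball c r)" "closed (D ` cball c r)"
proof -
  let ?L = "{f. (\<forall>p q. f (p + q) = f p + f q) \<and> (\<forall>a p. f (a *\<^sub>C p) = a * f p)} :: ('b \<Rightarrow> complex) set"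
  let ?B = "{f. \<forall>p. f p \<in> cball (D c p) (r * norm p)}"
  have eq: "D ` cball c r = ?B \<inter> ?L" by (auto simp: predual_ball_image[OF assms])
  have L: "closed ?L"
    by (intro closed_Collect_conj closed_Collect_all closed_Collect_eq continuous_intros
        continuous_on_product_coordinates)
  have "?B = (\<Inter>p. (\<lambda>f. f p) -` cball (D c p) (r * norm p))" by auto
  also have "closed \<dots>"
    by (intro closed_INT ballI closed_vimage continuous_on_product_coordinates) auto
  finally have "closed ?B" .
  with L show "closed (D ` cball c r)" unfolding eq by (rule closed_Int[rotated])
  have "?B = PiE UNIV (\<lambda>p. cball (D c p) (r * norm p))" by (auto simp: PiE_def)
  then have "compact ?B"
    using compactin_PiE[of "\<lambda>_. euclidean" UNIV "\<lambda>p. cball (D c p) (r * norm p)"]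
    by (simp add: euclidean_product_topology)
  with L show "compact (D ` cball c r)" unfolding eq by (rule compact_Int_closed[rotated])
qed

text \<open>Weak* compactness stated without the topology, in terms of centres and radii alone; this
  is the form in which it serves nets.\<close>

lemma closed_balls_fip:
  fixes D :: "'a::complex_banach \<Rightarrow> 'p::complex_banach \<Rightarrow> complex" and c :: "'i \<Rightarrow> 'a"
  assumes "predual_iso D" "\<And>i. i \<in> I \<Longrightarrow> 0 \<le> r i" "I \<noteq> {}"
    and fip: "\<And>J. finite J \<Longrightarrow> J \<subseteq> I \<Longrightarrow> J \<noteq> {} \<Longrightarrow> (\<Inter>i\<in>J. cball (c i) (r i)) \<noteq> {}"
  shows "(\<Inter>i\<in>I. cball (c i) (r i)) \<noteq> {}"
proof -
  have inj: "inj D" using assms(1) by (auto simp: predual_iso_def bij_betw_def)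
  obtain i0 where i0: "i0 \<in> I" using assms(3) by auto
  have "D ` cball (c i0) (r i0) \<inter> (\<Inter>i\<in>I. D ` cball (c i) (r i)) \<noteq> {}"
  proof (rule compact_imp_fip_image)
    show "compact (D ` cball (c i0) (r i0))"
      using predual_ball_compact_closed assms i0 by blast
    show "closed (D ` cball (c i) (r i))" if "i \<in> I" for i
      using predual_ball_compact_closed assms that by blast
    fix J assume "finite J" "J \<subseteq> I"
    then have "(\<Inter>i\<in>insert i0 J. cball (c i) (r i)) \<noteq> {}" by (intro fip) (use i0 in auto)
    then obtain x where "x \<in> (\<Inter>i\<in>insert i0 J. cball (c i) (r i))" by blast
    then have "D x \<in> D ` cball (c i0) (r i0) \<inter> (\<Inter>i\<in>J. D ` cball (c i) (r i))" by auto
    then show "D ` cball (c i0) (r i0) \<inter> (\<Inter>i\<in>J. D ` cball (c i) (r i)) \<noteq> {}" by blast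
  qed
  then obtain f where f: "f \<in> (\<Inter>i\<in>I. D ` cball (c i) (r i))" by blast
  then obtain x where x: "f = D x" using i0 by blast
  have "x \<in> cball (c i) (r i)" if "i \<in> I" for i
  proof -
    from f that obtain y where "y \<in> cball (c i) (r i)" "f = D y" by auto
    with x inj show ?thesis by (auto dest: injD)
  qed
  then show ?thesis by blast
qed

locale abelian_cstar =
  fixes ty :: "'a::cstar_algebra itself"
  assumes comm: "\<And>x y :: 'a. x * y = y * x"
begin

lemma lcomm: "x * (y * z) = y * (x * (z::'a))"
  by (metis comm mult.assoc)

lemmas ac = mult.assoc comm lcomm

text \<open>The hypothesis reads \<open>k^2 + (1 - q)^2 = 1\<close>. Multiplying by
  \<open>k^2\<close> removes the missing unit: with \<open>y = (1 - q) k\<close> one gets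
  \<open>k^4 + y^2 = k^2\<close>, hence \<open>norm k ^ 4 \<le> norm k ^ 2\<close>.\<close>

lemma contraction:
  fixes k q :: 'a
  assumes "star k = k" "star q = q" "k * k = q + q - q * q"
  shows "norm k \<le> 1"
proof -
  let ?y = "k - q * k"
  have "(norm (k * k))\<^sup>2 \<le> norm (k * k * (k * k) + ?y * ?y)"
    by (rule norm_le_sum_squares) (simp_all add: star_simps assms(1,2) comm)
  also have "k * k * (k * k) + ?y * ?y = k * k"
  proof -
    have "?y * ?y = k * k - (q + q - q * q) * (k * k)"
      by (simp add: algebra_simps ac)
    then show ?thesis using assms(3) by simp
  qed
  finally have "(norm k ^ 2)\<^sup>2 \<le> norm k ^ 2" by (simp only: norm_selfadjoint_square[OF assms(1)])
  then have "norm k ^ 2 \<le> 1" if "norm k \<noteq> 0"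
    using that by (simp add: power2_eq_square)
  then show ?thesis
    by (cases "norm k = 0") (use power2_le_imp_le[of "norm k" 1] in auto)
qed

text \<open>The self-adjoint part of the unit ball is an intersection of balls, hence compact for the
  weak* topology.\<close>

lemma selfadjoint_ball_eq:
  "{x::'a. star x = x \<and> norm x \<le> 1} =
     cball 0 1 \<inter> (\<Inter>(t, y)\<in>{(t::real, y). star y = y \<and> norm y \<le> 1}.
       cball (- (\<i> *\<^sub>C (t *\<^sub>R y))) (sqrt (1 + t\<^sup>2)))" (is "?L = ?R")
proof (intro equalityI subsetI)
  fix x :: 'a assume "x \<in> ?L"
  then have x: "star x = x" "norm x \<le> 1" by auto
  have "norm (x + \<i> *\<^sub>C (t *\<^sub>R y)) \<le> sqrt (1 + t\<^sup>2)" if "star y = y" "norm y \<le> 1" for t y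
  proof (rule real_le_rsqrt)
    have "(norm (x + \<i> *\<^sub>C (t *\<^sub>R y)))\<^sup>2 = norm (x * x + t\<^sup>2 *\<^sub>R (y * y))"
      by (subst norm_square_cartesian) (use x that in \<open>auto simp: star_simps comm power2_eq_square\<close>)
    also have "\<dots> \<le> norm x ^ 2 + t\<^sup>2 * norm y ^ 2"
      using norm_triangle_ineq[of "x * x" "t\<^sup>2 *\<^sub>R (y * y)"] x that
      by (simp add: norm_selfadjoint_square)
    also have "\<dots> \<le> 1 + t\<^sup>2 * 1"
      using x(2) that(2) by (intro add_mono mult_left_mono power_le_one) auto
    finally show "(norm (x + \<i> *\<^sub>C (t *\<^sub>R y)))\<^sup>2 \<le> 1 + t\<^sup>2" by simp
  qed
  then show "x \<in> ?R" using x(2) by (auto simp: dist_norm norm_minus_commute)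
next
  fix x assume R: "x \<in> ?R"
  define a b where "a = re_part x" and "b = im_part x"
  have sa: "star a = a" "star b = b" and x: "x = a + \<i> *\<^sub>C b"
    by (simp_all add: a_def b_def re_im_decomp)
  have "b = 0"
  proof (rule ccontr)
    assume "b \<noteq> 0"
    \<comment> \<open>With this \<open>t\<close> the imaginary part of
      \<open>x + \<i> *\<^sub>C (t *\<^sub>R y)\<close> has norm \<open>norm b + t\<close>, and
      squaring the bound \<open>sqrt (1 + t^2)\<close> leaves
      \<open>(norm b)^2 + 2 \<le> 1\<close>.\<close>
    define t where "t = 1 / norm b"
    have t: "t > 0" "t * norm b = 1" using \<open>b \<noteq> 0\<close> by (auto simp: t_def)
    define y where "y = t *\<^sub>R b"
    have y: "star y = y" "norm y = 1" using t by (auto simp: y_def star_simps sa)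
    have R2: "norm (x + \<i> *\<^sub>C (t *\<^sub>R y)) \<le> sqrt (1 + t\<^sup>2)"
      using R y by (auto simp: dist_norm) (metis add.commute norm_minus_cancel minus_diff_eq uminus_add_conv_diff diff_minus_eq_add order_refl)
    have "x + \<i> *\<^sub>C (t *\<^sub>R y) = a + \<i> *\<^sub>C ((1 + t * t) *\<^sub>R b)"
      by (simp add: x y_def scaleC_add_right algebra_simps)
    then have "im_part (x + \<i> *\<^sub>C (t *\<^sub>R y)) = (1 + t * t) *\<^sub>R b"
      using cartesian_unique(2)[of a "(1 + t * t) *\<^sub>R b"] by (simp add: sa star_simps)
    then have "norm ((1 + t * t) *\<^sub>R b) \<le> sqrt (1 + t\<^sup>2)"
      using norm_im_part_le[of "x + \<i> *\<^sub>C (t *\<^sub>R y)"] R2 by simp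
    moreover have "norm ((1 + t * t) *\<^sub>R b) = norm b + t"
    proof -
      have "norm ((1 + t * t) *\<^sub>R b) = (1 + t * t) * norm b" by simp
      also have "\<dots> = norm b + t * (t * norm b)" by (simp add: algebra_simps)
      finally show ?thesis using t by simp
    qed
    ultimately have "(norm b + t)\<^sup>2 \<le> 1 + t\<^sup>2"
      using t by (metis add_nonneg_nonneg norm_ge_zero order_less_imp_le real_sqrt_ge_0_iff sqrt_le_D real_le_rsqrt real_sqrt_pow2_iff power_mono zero_le_one zero_le_power2)
    moreover have "0 < 1 + norm b * norm b" by (intro add_pos_nonneg) auto
    ultimately show False using t by (simp add: power2_eq_square algebra_simps)
  qed
  then have "star x = x" using sa x by simp
  with R show "x \<in> ?L" by auto
qed

lemma selfadjoint_ball_extreme_point: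
  fixes D :: "'a \<Rightarrow> 'p::complex_banach \<Rightarrow> complex"
  assumes "predual_iso D"
  shows "\<exists>u::'a. star u = u \<and> norm u \<le> 1 \<and>
    (\<forall>v w. star v = v \<longrightarrow> norm v \<le> 1 \<longrightarrow> star w = w \<longrightarrow> norm w \<le> 1 \<longrightarrow> v + w = 2 *\<^sub>R u \<longrightarrow> v = w)"
proof -
  let ?S = "{x::'a. star x = x \<and> norm x \<le> 1}"
  have inj: "inj D" using assms by (auto simp: predual_iso_def bij_betw_def)
  have eq: "D ` ?S = D ` cball 0 1 \<inter> (\<Inter>(t, y)\<in>{(t::real, y). star y = y \<and> norm y \<le> 1}.
       D ` cball (- (\<i> *\<^sub>C (t *\<^sub>R y))) (sqrt (1 + t\<^sup>2)))"
    unfolding selfadjoint_ball_eq using inj by (auto dest!: injD[OF inj] simp: inj_image_mem_iff)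
  have "closed (\<Inter>(t, y)\<in>{(t::real, y). star y = y \<and> norm y \<le> 1}.
       D ` cball (- (\<i> *\<^sub>C (t *\<^sub>R y))) (sqrt (1 + t\<^sup>2)))"
    by (intro closed_INT ballI) (auto intro!: predual_ball_compact_closed[OF assms])
  then have "compact (D ` ?S)" "closed (D ` ?S)"
    unfolding eq using predual_ball_compact_closed[OF assms, of 1 0]
    by (auto intro: compact_Int_closed closed_Int)
  moreover have "D ` ?S \<noteq> {}" by (auto intro: exI[of _ 0])
  ultimately have K: "compact (D ` ?S)" "closed (D ` ?S)" "D ` ?S \<noteq> {}" by auto
  obtain f where "f \<in> D ` ?S" and ext: "\<forall>g\<in>D ` ?S. \<forall>h\<in>D ` ?S. (\<forall>p. g p + h p = 2 * f p) \<longrightarrow> g = h"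
    using compact_fun_extreme_point[OF K] by (elim bexE)
  then obtain u where u: "star u = u" "norm u \<le> 1" "f = D u" by auto
  have "v = w" if vw: "star v = v" "norm v \<le> 1" "star w = w" "norm w \<le> 1" "v + w = 2 *\<^sub>R u" for v w
  proof -
    have "D v p + D w p = 2 * f p" for p
      using assms arg_cong[OF vw(5), of "\<lambda>x. D x p"]
      by (metis (no_types, lifting) u(3) of_real_numeral predual_iso_def scaleC_of_real)
    then have "D v = D w" using vw ext by blast
    then show "v = w" using inj by (auto dest: injD)
  qed
  with u show ?thesis by blast
qed

text \<open>Since \<open>1 - q = (1 - h) (1 - r)\<close>, this is multiplicativity of
  \<open>x \<mapsto> (1 - x)^2\<close>, written without the unit.\<close>

lemma quasi_product:
  fixes h r :: 'a
  defines "q \<equiv> h + r - h * r"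
  shows "q + q - q * q = (h + h - h * h) + (r + r - r * r) - (h + h - h * h) * (r + r - r * r)"
  unfolding q_def by (simp add: algebra_simps ac)

text \<open>The square \<open>h\<close> of the extreme point \<open>u\<close> is the unit.
  Extremality gives \<open>u * h = u\<close>, so \<open>h\<close> is a projection; for a
  self-adjoint contraction \<open>z\<close>, the part \<open>y\<close> of \<open>z\<close> outside
  \<open>h\<close> can be added to and subtracted from \<open>u\<close> without leaving the ball, so
  \<open>y = 0\<close>.\<close>

lemma unit_exists:
  fixes D :: "'a \<Rightarrow> 'p::complex_banach \<Rightarrow> complex"
  assumes "predual_iso D"
  obtains e :: 'a where "\<And>x. e * x = x"
proof -
  obtain u :: 'a where u: "star u = u" "norm u \<le> 1"
    and ext: "\<And>v w. \<lbrakk>star v = v; norm v \<le> 1; star w = w; norm w \<le> 1; v + w = 2 *\<^sub>R u\<rbrakk> \<Longrightarrow> v = w"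
    using selfadjoint_ball_extreme_point[OF assms] by blast
  define h where "h = u * u"
  have h: "star h = h" "norm h \<le> 1"
    using u norm_selfadjoint_square[OF u(1)] by (auto simp: h_def star_simps power_le_one)
  have uh: "u * h = u"
  \<comment> \<open>\<open>u\<close> is the midpoint of \<open>u (1 + h) / 2\<close> and \<open>u (3 - h) / 2\<close>; the latter is a contraction since
     \<open>1 - t (3 - t)\<^sup>2 / 4 = (1 - t)\<^sup>2 (1 - t / 4)\<close>.\<close>
  proof -
    define w v where "w = (1/2) *\<^sub>R (u + u * h)" and "v = (1/2) *\<^sub>R (3 *\<^sub>R u - u * h)"
    have sa: "star w = w" "star v = v" by (simp_all add: w_def v_def star_simps u h comm)
    have "norm (u * h) \<le> 1 * 1"
      by (rule order_trans[OF norm_mult_ineq mult_mono]) (use u h in auto)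
    then have w: "norm w \<le> 1"
      using norm_triangle_ineq[of u "u * h"] u by (simp add: w_def)
    obtain r where r: "star r = r" "r + r - r * r = (1/4) *\<^sub>R h"
    proof (rule sqrt_one_minus)
      show "norm ((1/4) *\<^sub>R h) \<le> 1" "star ((1/4) *\<^sub>R h) = (1/4) *\<^sub>R h"
        using h by (simp_all add: star_scaleR)
    qed
    \<comment> \<open>Here \<open>1 - q = (1 - h) (1 - r)\<close> and
      \<open>(1 - r)^2 = 1 - h / 4\<close>, so \<open>(1 - q)^2\<close> is the product in the scalar
      identity above and equals \<open>1 - v^2\<close>.\<close>
    define q where "q = h + r - h * r"
    have v: "norm v \<le> 1"
    proof (rule contraction)
      show "star q = q" by (simp add: q_def star_simps h r comm)
      have "v * v = (9/4) *\<^sub>R h - (3/2) *\<^sub>R (h * h) + (1/4) *\<^sub>R (h * h * h)"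
      proof -
        have "v * v = (1/4) *\<^sub>R ((3 *\<^sub>R u - u * h) * (3 *\<^sub>R u - u * h))"
          by (simp add: v_def)
        also have "(3 *\<^sub>R u - u * h) * (3 *\<^sub>R u - u * h) = 9 *\<^sub>R h - 3 *\<^sub>R (h * h) - 3 *\<^sub>R (h * h) + h * h * h"
          unfolding h_def by (simp add: algebra_simps ac)
        also have "\<dots> = 9 *\<^sub>R h - 6 *\<^sub>R (h * h) + h * h * h"
          by (simp add: diff_diff_eq flip: scaleR_left_distrib)
        finally show ?thesis by (simp add: scaleR_add_right scaleR_diff_right)
      qed
      moreover have "q + q - q * q = (9/4) *\<^sub>R h - (3/2) *\<^sub>R (h * h) + (1/4) *\<^sub>R (h * h * h)"
      proof -
        have a: "(9/4) *\<^sub>R h = h + h + (1/4) *\<^sub>R h" "(3/2) *\<^sub>R (h * h) = h * h + (1/4) *\<^sub>R (h * h) + (1/4) *\<^sub>R (h * h)"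
          using scaleR_left_distrib[of 2 "1/4" h] scaleR_left_distrib[of 1 "1/2" "h * h"]
            scaleR_left_distrib[of "1/4" "1/4" "h * h"] by (simp_all add: scaleR_2)
        show ?thesis unfolding q_def quasi_product r a by (simp add: algebra_simps)
      qed
      ultimately show "v * v = q + q - q * q" by simp
    qed (rule sa)
    have "v + w = (1/2) *\<^sub>R (3 *\<^sub>R u + u)" by (simp add: v_def w_def scaleR_add_right scaleR_diff_right)
    also have "3 *\<^sub>R u + u = 4 *\<^sub>R u" using scaleR_left_distrib[of 3 1 u] by simp
    finally have "v = w" using ext sa v w by simp
    then have "2 *\<^sub>R v = 2 *\<^sub>R w" by simp
    then have "3 *\<^sub>R u - u * h = u + u * h" by (simp add: v_def w_def)
    then have "3 *\<^sub>R u - u = u * h + u * h" by (simp add: algebra_simps)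
    moreover have "3 *\<^sub>R u - u = 2 *\<^sub>R u" using scaleR_left_diff_distrib[of 3 1 u] by simp
    ultimately show "u * h = u" by (simp flip: scaleR_2)
  qed
  have hh: "h * h = h" using uh by (simp add: h_def mult.assoc)
  have zh: "h * z = z" if z: "star z = z" "norm z \<le> 1" for z
  proof -
    define y where "y = z - h * z"
    have "star y = y" by (simp add: y_def star_simps z h comm)
    moreover have "u * y = 0"
    proof -
      have "u * y = u * z - (u * h) * z" by (simp add: y_def algebra_simps)
      then show ?thesis by (simp add: uh)
    qed
    moreover have "y * y = z * z - h * (z * z)"
    proof -
      have "y * y = z * z - (h * (z * z) + h * (z * z) - (h * h) * (z * z))"
        by (simp add: y_def algebra_simps ac)
      then show ?thesis by (simp add: hh)
    qed
    ultimately have y: "star y = y" "u * y = 0" "y * u = 0" "y * y = z * z - h * (z * z)"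
      by (simp_all add: comm)
    have "norm (z * z) \<le> 1" "star (z * z) = z * z"
      using z by (auto simp: norm_selfadjoint_square star_simps power_le_one)
    then obtain r where r: "star r = r" "r + r - r * r = z * z"
      by (rule sqrt_one_minus)
    \<comment> \<open>Now \<open>(1 - r)^2 = 1 - z^2\<close> and \<open>h\<close> is idempotent, so
      \<open>(1 - q)^2 = (1 - h) (1 - z^2) = 1 - h - y^2\<close>. As \<open>u * y = 0\<close>, both
      \<open>u + y\<close> and \<open>u - y\<close> have square \<open>h + y^2\<close>.\<close>
    define q where "q = h + r - h * r"
    have q: "star q = q" by (simp add: q_def star_simps h r comm)
    have qq: "q + q - q * q = h + y * y"
      unfolding q_def quasi_product r using hh y by (simp add: algebra_simps)
    have n: "norm (u + y) \<le> 1" "norm (u - y) \<le> 1"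
      by (rule contraction[OF _ q]; simp add: qq star_simps u y algebra_simps h_def)+
    have "u + y = u - y"
      by (rule ext) (simp_all add: star_simps u y scaleR_2 n)
    then have "2 *\<^sub>R y = 0" by (simp add: scaleR_2 algebra_simps)
    then show ?thesis by (simp add: y_def)
  qed
  have zh': "h * z = z" if "star z = z" for z
  proof (cases "z = 0")
    case False
    then have "h * ((1 / norm z) *\<^sub>R z) = (1 / norm z) *\<^sub>R z"
      by (intro zh) (auto simp: star_simps that)
    with False show ?thesis by simp
  qed simp
  have "h * x = x" for x
  proof -
    have "h * (re_part x + \<i> *\<^sub>C im_part x) = re_part x + \<i> *\<^sub>C im_part x"
      using zh'[of "re_part x"] zh'[of "im_part x"] by (simp add: distrib_left mult_scaleC_right)
    then show ?thesis by (simp add: re_im_decomp)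
  qed
  then show ?thesis by (rule that)
qed

end

section \<open>The positive cone\<close>

locale unital_abelian_cstar = abelian_cstar ty for ty :: "'a::cstar_algebra itself" +
  fixes e :: 'a
  assumes unit_left [simp]: "e * x = x"
begin

notation cstar_le (infix "\<sqsubseteq>" 50)

lemma unit_right [simp]: "x * e = x"
  by (metis comm unit_left)

lemma star_unit [simp]: "star e = e"
  by (metis star_mult star_star unit_right)

text \<open>Only an inequality, because in the zero algebra the unit has norm 0.\<close>

lemma norm_unit_le: "norm e \<le> 1"
  using cstar_identity[of e] by (cases "norm e = 0") (auto simp: power2_eq_square)

text \<open>Rescaling by \<open>K\<close> reduces this to the square root of \<open>1 - h\<close>.
  With \<open>near_unit_of_square\<close> it turns being a square into a norm inequality; the last
  bound says that the root satisfies the same kind of inequality and is itself a square.\<close>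

lemma square_if_near_unit:
  assumes "star a = a" "norm (K *\<^sub>R e - a) \<le> K"
  obtains s where "star s = s" "s * s = a" "norm (sqrt K *\<^sub>R e - s) \<le> sqrt K"
proof (cases "K = 0")
  case True
  with assms that[of 0] show ?thesis by simp
next
  case False
  then have K: "K > 0" using assms(2) norm_ge_zero order_trans by (metis order_le_less)
  define h where "h = e - (1 / K) *\<^sub>R a"
  have "K *\<^sub>R h = K *\<^sub>R e - a" using K by (simp add: h_def scaleR_diff_right)
  then have "K * norm h \<le> K * 1" using assms(2) K by (metis abs_of_pos mult.right_neutral norm_scaleR)
  then have "norm h \<le> 1" using K by simp
  moreover have "star h = h" by (simp add: h_def star_simps assms)
  ultimately obtain r where r: "star r = r" "norm r \<le> 1" "r + r - r * r = h"
    by (rule sqrt_one_minus)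
  show ?thesis
  proof
    let ?s = "sqrt K *\<^sub>R (e - r)"
    show "star ?s = ?s" by (simp add: star_simps r)
    have "?s * ?s = K *\<^sub>R ((e - r) * (e - r))" using K by simp
    also have "(e - r) * (e - r) = e - (r + r - r * r)" by (simp add: algebra_simps)
    also have "K *\<^sub>R (e - (r + r - r * r)) = a" using K by (simp add: r h_def)
    finally show "?s * ?s = a" .
    show "norm (sqrt K *\<^sub>R e - ?s) \<le> sqrt K"
      using r(2) K by (simp add: scaleR_diff_right mult_left_le)
  qed
qed

text \<open>With \<open>h = (1 / K) *\<^sub>R (s * s)\<close> and \<open>(e - r)^2 = e - h\<close>,
  the squares of \<open>e - r\<close> and of \<open>s / sqrt K\<close> add up to \<open>e\<close>,
  so \<open>norm (e - h) = norm (e - r) ^ 2 \<le> norm e \<le> 1\<close>.\<close>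

lemma near_unit_of_square:
  assumes "star s = s" "norm (s * s) \<le> K"
  shows "norm (K *\<^sub>R e - s * s) \<le> K"
proof (cases "K = 0")
  case True
  then show ?thesis using assms by simp
next
  case False
  then have K: "K > 0" using assms(2) norm_ge_zero order_trans by (metis order_le_less)
  define h where "h = (1 / K) *\<^sub>R (s * s)"
  have "norm h \<le> 1" "star h = h" using K assms by (simp_all add: h_def star_simps)
  then obtain r where r: "star r = r" "norm r \<le> 1" "r + r - r * r = h"
    by (rule sqrt_one_minus)
  have sq: "(e - r) * (e - r) = e - h"
    unfolding r(3)[symmetric] by (simp add: algebra_simps)
  have hs: "h = ((1 / sqrt K) *\<^sub>R s) * ((1 / sqrt K) *\<^sub>R s)" using K by (simp add: h_def)
  have "norm (e - h) = norm (e - r) ^ 2"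
    using norm_selfadjoint_square[of "e - r"] by (simp add: sq star_simps r)
  also have "\<dots> \<le> norm ((e - r) * (e - r) + ((1 / sqrt K) *\<^sub>R s) * ((1 / sqrt K) *\<^sub>R s))"
    by (rule norm_le_sum_squares) (simp_all add: star_simps r assms comm[of s])
  also have "\<dots> \<le> 1" unfolding hs[symmetric] sq using norm_unit_le by simp
  finally have "K * norm (e - h) \<le> K" using K by simp
  moreover have "K *\<^sub>R e - s * s = K *\<^sub>R (e - h)" using K by (simp add: h_def scaleR_diff_right)
  ultimately show ?thesis using K by simp
qed

text \<open>The norm inequality characterizing squares is stable under sums by the triangle
  inequality: the radii add up.\<close>

lemma square_add:
  fixes s t :: 'a
  assumes "star s = s" "star t = t"
  shows "\<exists>w. star w = w \<and> s * s + t * t = w * w"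
proof -
  let ?K = "norm (s * s)" and ?L = "norm (t * t)"
  have "norm ((?K + ?L) *\<^sub>R e - (s * s + t * t)) \<le> ?K + ?L"
  proof -
    have eq: "(?K + ?L) *\<^sub>R e - (s * s + t * t) = (?K *\<^sub>R e - s * s) + (?L *\<^sub>R e - t * t)"
      by (simp add: algebra_simps)
    show ?thesis unfolding eq
      using norm_triangle_ineq[of "?K *\<^sub>R e - s * s" "?L *\<^sub>R e - t * t"]
        near_unit_of_square[OF assms(1), of ?K] near_unit_of_square[OF assms(2), of ?L] by linarith
  qed
  moreover have "star (s * s + t * t) = s * s + t * t" by (simp add: star_simps assms)
  ultimately obtain w where "star w = w" "w * w = s * s + t * t"
    using square_if_near_unit[of "s * s + t * t" "?K + ?L"] by blast
  then show ?thesis by auto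
qed

lemma positive_cone_iff_square: "(x::'a) \<in> positive_cone \<longleftrightarrow> (\<exists>s. star s = s \<and> x = s * s)"
proof
  assume "x \<in> positive_cone"
  then obtain y where y: "x = star y * y" by (auto simp: positive_cone_def)
  define a b where "a = re_part y" and "b = im_part y"
  have ab: "star a = a" "star b = b" and y': "y = a + \<i> *\<^sub>C b"
    by (simp_all add: a_def b_def re_im_decomp)
  have "x = a * a + b * b"
    unfolding y y' by (simp add: ab star_simps algebra_simps mult_scaleC_left mult_scaleC_right
        scaleC_scaleC scaleC_minus_left scaleC_diff_right scaleC_add_right comm[of b a])
  then show "\<exists>s. star s = s \<and> x = s * s" using square_add[OF ab] by simp
next
  assume "\<exists>s. star s = s \<and> x = s * s"
  then obtain s where "star s = s" "x = s * s" by auto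
  then have "x = star s * s" by simp
  then show "x \<in> positive_cone" unfolding positive_cone_def by blast
qed

lemma positive_selfadjoint: "(x::'a) \<in> positive_cone \<Longrightarrow> star x = x"
  unfolding positive_cone_iff_square by (metis star_mult)

lemma positiveI: "star x = x \<Longrightarrow> norm (K *\<^sub>R e - x) \<le> K \<Longrightarrow> x \<in> positive_cone"
  unfolding positive_cone_iff_square using square_if_near_unit[of x K] by blast

lemma positive_iff: "x \<in> positive_cone \<longleftrightarrow> star x = x \<and> norm (norm x *\<^sub>R e - x) \<le> norm x"
proof
  assume "x \<in> positive_cone"
  then show "star x = x \<and> norm (norm x *\<^sub>R e - x) \<le> norm x"
    using near_unit_of_square[of _ "norm x"] positive_selfadjoint unfolding positive_cone_iff_square by blast
next
  assume "star x = x \<and> norm (norm x *\<^sub>R e - x) \<le> norm x"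
  then show "x \<in> positive_cone" using positiveI by blast
qed

lemma positiveD: "x \<in> positive_cone \<Longrightarrow> norm x \<le> K \<Longrightarrow> norm (K *\<^sub>R e - x) \<le> K"
  unfolding positive_cone_iff_square using near_unit_of_square by auto

lemma positive_square [intro]: "star s = (s::'a) \<Longrightarrow> s * s \<in> positive_cone"
  unfolding positive_cone_iff_square by auto

lemma positive_add [intro]: "(x::'a) \<in> positive_cone \<Longrightarrow> y \<in> positive_cone \<Longrightarrow> x + y \<in> positive_cone"
  unfolding positive_cone_iff_square using square_add by blast

lemma positive_zero [simp]: "(0::'a) \<in> positive_cone"
  using positive_square[of 0] by simp

lemma positive_unit [simp]: "e \<in> positive_cone"
  using positive_square[of e] by simp

lemma positive_scaleR [intro]: "0 \<le> r \<Longrightarrow> (x::'a) \<in> positive_cone \<Longrightarrow> r *\<^sub>R x \<in> positive_cone"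
proof -
  assume r: "0 \<le> r" and "x \<in> positive_cone"
  then obtain s where s: "star s = s" "x = s * s" unfolding positive_cone_iff_square by blast
  have "(sqrt r *\<^sub>R s) * (sqrt r *\<^sub>R s) \<in> positive_cone" by (rule positive_square) (simp add: s star_simps)
  then show ?thesis using r by (simp add: s)
qed

lemma positive_mult [intro]: "(x::'a) \<in> positive_cone \<Longrightarrow> y \<in> positive_cone \<Longrightarrow> x * y \<in> positive_cone"
proof -
  assume "x \<in> positive_cone" "y \<in> positive_cone"
  then obtain s t where s: "star s = s" "x = s * s" "star t = t" "y = t * t"
    unfolding positive_cone_iff_square by blast
  have "(s * t) * (s * t) \<in> positive_cone" by (rule positive_square) (simp add: s star_simps comm[of t s])
  moreover have "x * y = (s * t) * (s * t)" by (simp add: s ac)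
  ultimately show ?thesis by simp
qed

lemma positive_sum [intro]: "(\<And>i. i \<in> I \<Longrightarrow> f i \<in> (positive_cone :: 'a set)) \<Longrightarrow> sum f I \<in> positive_cone"
  by (induction I rule: infinite_finite_induct) auto

lemma closed_positive_cone: "closed (positive_cone :: 'a set)"
proof -
  have "closed {x::'a. star x = x \<and> norm (norm x *\<^sub>R e - x) \<le> norm x}"
    by (intro closed_Collect_conj closed_Collect_eq closed_Collect_le continuous_intros
        bounded_linear.continuous_on[OF bounded_linear_star])
  moreover have "positive_cone = {x::'a. star x = x \<and> norm (norm x *\<^sub>R e - x) \<le> norm x}"
    by (intro set_eqI) (simp add: positive_iff)
  ultimately show ?thesis by simp
qed

lemma positive_antisym: "(x::'a) \<in> positive_cone \<Longrightarrow> - x \<in> positive_cone \<Longrightarrow> x = 0"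
proof -
  assume "x \<in> positive_cone" "- x \<in> positive_cone"
  then obtain s t where s: "star s = s" "x = s * s" "star t = t" "- x = t * t"
    unfolding positive_cone_iff_square by blast
  have "(norm s)\<^sup>2 \<le> norm (s * s + t * t)" by (rule norm_le_sum_squares) (simp_all add: s comm[of s t])
  then have "s = 0" by (simp add: s(2,4)[symmetric])
  then show ?thesis using s by simp
qed

lemma positive_sqrt:
  assumes "(x::'a) \<in> positive_cone"
  obtains s where "s \<in> positive_cone" "s * s = x"
proof -
  obtain s where s: "star s = s" "s * s = x" "norm (sqrt (norm x) *\<^sub>R e - s) \<le> sqrt (norm x)"
    using assms square_if_near_unit[of x "norm x"] unfolding positive_iff[of x] by blast
  then show ?thesis using positiveI[of s] that[of s] by simp
qed

text \<open>For the converse, the product of the two positive elements is some \<open>t * t\<close>,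
  so \<open>x * x + t * t = K^2 *\<^sub>R e\<close> and \<open>norm_le_sum_squares\<close> bounds
  \<open>norm x\<close>.\<close>

lemma norm_le_iff:
  assumes "star x = x" "0 \<le> K"
  shows "norm x \<le> K \<longleftrightarrow> K *\<^sub>R e - x \<in> positive_cone \<and> K *\<^sub>R e + x \<in> positive_cone"
proof
  assume "norm x \<le> K"
  then show "K *\<^sub>R e - x \<in> positive_cone \<and> K *\<^sub>R e + x \<in> positive_cone"
    using positiveI[of "K *\<^sub>R e - x" K] positiveI[of "K *\<^sub>R e + x" K] assms by (simp add: star_simps)
next
  assume "K *\<^sub>R e - x \<in> positive_cone \<and> K *\<^sub>R e + x \<in> positive_cone"
  then have "(K *\<^sub>R e - x) * (K *\<^sub>R e + x) \<in> positive_cone" by blast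
  then obtain t where t: "star t = t" "(K *\<^sub>R e - x) * (K *\<^sub>R e + x) = t * t"
    unfolding positive_cone_iff_square by blast
  have "(norm x)\<^sup>2 \<le> norm (x * x + t * t)"
    by (rule norm_le_sum_squares) (simp_all add: t assms comm[of x t])
  also have "x * x + t * t = K\<^sup>2 *\<^sub>R e" unfolding t(2)[symmetric] by (simp add: algebra_simps power2_eq_square)
  also have "norm \<dots> \<le> K\<^sup>2" using norm_unit_le by (simp add: mult_left_le)
  finally show "norm x \<le> K" using assms(2) by (simp add: power2_le_iff_abs_le)
qed

lemma square_eq_0: "star x = (x::'a) \<Longrightarrow> x * x = 0 \<Longrightarrow> x = 0"
  using norm_selfadjoint_square[of x] by simp

lemma star_mult_self_eq_0: "star x * x = (0::'a) \<Longrightarrow> x = 0"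
  using cstar_identity[of x] by simp

lemma cstar_le_refl [simp]: "(x::'a) \<sqsubseteq> x" by (simp add: cstar_le_def)

lemma cstar_le_trans [trans]: "(x::'a) \<sqsubseteq> y \<Longrightarrow> y \<sqsubseteq> z \<Longrightarrow> x \<sqsubseteq> z"
  unfolding cstar_le_def using positive_add[of "y - x" "z - y"] by simp

lemma cstar_le_antisym: "(x::'a) \<sqsubseteq> y \<Longrightarrow> y \<sqsubseteq> x \<Longrightarrow> x = y"
  unfolding cstar_le_def using positive_antisym[of "y - x"] by simp

lemma cstar_le_mult: "(x::'a) \<sqsubseteq> y \<Longrightarrow> c \<in> positive_cone \<Longrightarrow> x * c \<sqsubseteq> y * c"
  unfolding cstar_le_def using positive_mult[of "y - x" c] by (simp add: algebra_simps)

lemma cstar_le_scaleR: "(x::'a) \<sqsubseteq> y \<Longrightarrow> 0 \<le> r \<Longrightarrow> r *\<^sub>R x \<sqsubseteq> r *\<^sub>R y"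
  unfolding cstar_le_def using positive_scaleR[of r "y - x"] by (simp add: algebra_simps)

lemma positive_le_norm: "x \<in> positive_cone \<Longrightarrow> x \<sqsubseteq> norm x *\<^sub>R e"
  unfolding cstar_le_def using norm_le_iff[of x "norm x"] positive_selfadjoint by auto

lemma positive_norm_le: "x \<in> positive_cone \<Longrightarrow> x \<sqsubseteq> K *\<^sub>R e \<Longrightarrow> 0 \<le> K \<Longrightarrow> norm x \<le> K"
  unfolding cstar_le_def using norm_le_iff[of x K] positive_selfadjoint[of x]
    positive_add[of "K *\<^sub>R e" x] positive_scaleR[of K e] by simp

end

section \<open>Suprema and spectral projections\<close>

locale abelian_wstar = unital_abelian_cstar ty e
  for ty :: "'a::cstar_algebra itself" and e :: 'a +
  fixes D :: "'a \<Rightarrow> 'p::complex_banach \<Rightarrow> complex"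
  assumes predual: "predual_iso D"
begin

abbreviation directed :: "'a set \<Rightarrow> bool" where
  "directed \<equiv> upward_directed cstar_le"

abbreviation is_sup :: "'a set \<Rightarrow> 'a \<Rightarrow> bool" where
  "is_sup \<equiv> is_supremum_in cstar_le selfadjoint_part"

text \<open>Finitely many of the eventual conditions hold at a common late element of the net, so
  the balls have the finite intersection property; a common point plays the role of a cluster
  point.\<close>

lemma closed_balls_directed:
  assumes A: "directed (A::'a set)" and "I \<noteq> {}" "\<And>i. i \<in> I \<Longrightarrow> 0 \<le> r i"
    and ev: "\<And>i. i \<in> I \<Longrightarrow> \<exists>a0\<in>A. \<forall>a\<in>A. a0 \<sqsubseteq> a \<longrightarrow> a \<in> cball (c i) (r i)"
  shows "(\<Inter>i\<in>I. cball (c i) (r i)) \<noteq> {}"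
proof (rule closed_balls_fip[OF predual])
  fix J assume "finite J" "J \<subseteq> I" "J \<noteq> {}"
  from this(1,2) have "\<exists>a0\<in>A. \<forall>a\<in>A. a0 \<sqsubseteq> a \<longrightarrow> (\<forall>i\<in>J. a \<in> cball (c i) (r i))"
  proof (induction J)
    case empty
    then show ?case using A by (auto simp: upward_directed_def)
  next
    case (insert j J)
    then obtain a0 where a0: "a0 \<in> A" "\<forall>a\<in>A. a0 \<sqsubseteq> a \<longrightarrow> (\<forall>i\<in>J. a \<in> cball (c i) (r i))" by auto
    obtain a1 where a1: "a1 \<in> A" "\<forall>a\<in>A. a1 \<sqsubseteq> a \<longrightarrow> a \<in> cball (c j) (r j)" using ev[of j] insert by auto
    obtain a2 where a2: "a2 \<in> A" "a0 \<sqsubseteq> a2" "a1 \<sqsubseteq> a2" using A a0(1) a1(1) unfolding upward_directed_def by blast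
    have "\<forall>i\<in>insert j J. a \<in> cball (c i) (r i)" if "a \<in> A" "a2 \<sqsubseteq> a" for a
      using a0(2) a1(2) that cstar_le_trans[OF a2(2) that(2)] cstar_le_trans[OF a2(3) that(2)] by blast
    then show ?case using a2(1) by blast
  qed
  then obtain a0 where "a0 \<in> A" "\<forall>i\<in>J. a0 \<in> cball (c i) (r i)" by (meson cstar_le_refl)
  then have "a0 \<in> (\<Inter>i\<in>J. cball (c i) (r i))" by blast
  then show "(\<Inter>i\<in>J. cball (c i) (r i)) \<noteq> {}" by blast
qed (use assms in auto)

text \<open>The order relations with fixed elements are, within the unit ball, membership in balls, so a
  weak* cluster point of the net is its supremum.\<close>

lemma directed_supremum:
  assumes A: "directed A" and pos: "\<And>a. a \<in> A \<Longrightarrow> a \<in> positive_cone" and le: "\<And>a. a \<in> A \<Longrightarrow> a \<sqsubseteq> e"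
  obtains s where "is_sup A s"
proof -
  have sa: "star a = a" if "a \<in> A" for a using pos[OF that] by (rule positive_selfadjoint)
  have n1: "norm a \<le> 1" if "a \<in> A" for a
    using positive_norm_le[of a 1] pos le that by simp
  define U where "U = {u. star u = u \<and> (\<forall>a\<in>A. a \<sqsubseteq> u)}"
  \<comment> \<open>Pairs of centre and radius. The first two families cut out the self-adjoint unit
    ball, the third says \<open>a \<sqsubseteq> x\<close> and the fourth
    \<open>x \<sqsubseteq> u\<close>. The radii 2 and \<open>norm u + 1\<close> bound the norms of
    \<open>x - a\<close> and \<open>u - x\<close> on the unit ball, as \<open>positiveD\<close>
    requires.\<close>
  define I where "I = {(0, 1)} \<union> (\<lambda>(t::real, y). (- (\<i> *\<^sub>C (t *\<^sub>R y)), sqrt (1 + t\<^sup>2))) ` {(t, y). star y = y \<and> norm y \<le> 1}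
     \<union> (\<lambda>a. (2 *\<^sub>R e + a, 2)) ` A \<union> (\<lambda>u. (u - (norm u + 1) *\<^sub>R e, norm u + 1)) ` U"
  have "(\<Inter>i\<in>I. cball (fst i) (snd i)) \<noteq> {}"
  proof (rule closed_balls_directed[OF A])
    fix i assume "i \<in> I"
    then show "0 \<le> snd i" by (auto simp: I_def)
    consider "i = (0, 1)" | t y where "star y = y" "norm y \<le> 1" "i = (- (\<i> *\<^sub>C (t *\<^sub>R y)), sqrt (1 + t\<^sup>2))"
      | b where "b \<in> A" "i = (2 *\<^sub>R e + b, 2)" | u where "u \<in> U" "i = (u - (norm u + 1) *\<^sub>R e, norm u + 1)"
      using \<open>i \<in> I\<close> unfolding I_def by auto
    then show "\<exists>a0\<in>A. \<forall>a\<in>A. a0 \<sqsubseteq> a \<longrightarrow> a \<in> cball (fst i) (snd i)"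
    proof cases
      case 1
      then show ?thesis using A n1 by (auto simp: upward_directed_def)
    next
      case 2
      have "a \<in> cball (fst i) (snd i)" if "a \<in> A" for a
      proof -
        have "a \<in> {x. star x = x \<and> norm x \<le> 1}" using sa n1 that by simp
        then show ?thesis unfolding selfadjoint_ball_eq using 2 by auto
      qed
      then show ?thesis using A by (auto simp: upward_directed_def)
    next
      case 3
      have "a \<in> cball (fst i) (snd i)" if "a \<in> A" "b \<sqsubseteq> a" for a
      proof -
        have "norm (a - b) \<le> 2" using norm_triangle_ineq4[of a b] n1[OF that(1)] n1[OF 3(1)] by simp
        then have "norm (2 *\<^sub>R e - (a - b)) \<le> 2" using that(2) by (intro positiveD) (auto simp: cstar_le_def)
        then show ?thesis using 3 by (simp add: dist_norm algebra_simps)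
      qed
      then show ?thesis using 3 by blast
    next
      case 4
      have "a \<in> cball (fst i) (snd i)" if "a \<in> A" for a
      proof -
        have "norm (u - a) \<le> norm u + 1" using norm_triangle_ineq4[of u a] n1[OF that] by simp
        then have "norm ((norm u + 1) *\<^sub>R e - (u - a)) \<le> norm u + 1" using 4 that
          by (intro positiveD) (auto simp: cstar_le_def U_def)
        moreover have "u - (norm u + 1) *\<^sub>R e - a = - ((norm u + 1) *\<^sub>R e - (u - a))" by simp
        ultimately have "norm (u - (norm u + 1) *\<^sub>R e - a) \<le> norm u + 1"
          by (simp only: norm_minus_cancel)
        then show ?thesis using 4 by (simp add: dist_norm)
      qed
      then show ?thesis using A by (auto simp: upward_directed_def)
    qed
  qed (auto simp: I_def)
  then obtain s where s: "\<And>i. i \<in> I \<Longrightarrow> s \<in> cball (fst i) (snd i)" by blast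
  have "s \<in> cball (- (\<i> *\<^sub>C (t *\<^sub>R y))) (sqrt (1 + t\<^sup>2))" if "star y = y" "norm y \<le> 1" for t y
  proof -
    have "(- (\<i> *\<^sub>C (t *\<^sub>R y)), sqrt (1 + t\<^sup>2)) \<in> I"
      unfolding I_def using that by (intro UnI1 UnI2 image_eqI[of _ _ "(t, y)"]) auto
    from s[OF this] show ?thesis by simp
  qed
  moreover have "s \<in> cball 0 1" using s[of "(0, 1)"] by (simp add: I_def)
  ultimately have "s \<in> {x. star x = x \<and> norm x \<le> 1}"
    unfolding selfadjoint_ball_eq by blast
  then have ss: "star s = s" "norm s \<le> 1" by auto
  have "a \<sqsubseteq> s" if "a \<in> A" for a
  proof -
    have "norm (2 *\<^sub>R e - (s - a)) \<le> 2"
      using s[of "(2 *\<^sub>R e + a, 2)"] that by (simp add: I_def dist_norm algebra_simps)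
    then show ?thesis unfolding cstar_le_def
      by (intro positiveI[of _ 2]) (auto simp: star_simps ss sa that)
  qed
  moreover have "s \<sqsubseteq> u" if "u \<in> selfadjoint_part" "\<forall>a\<in>A. a \<sqsubseteq> u" for u
  proof -
    have u: "u \<in> U" using that by (auto simp: U_def selfadjoint_part_def)
    then have "norm (u - (norm u + 1) *\<^sub>R e - s) \<le> norm u + 1"
      using s[of "(u - (norm u + 1) *\<^sub>R e, norm u + 1)"] by (simp add: I_def dist_norm)
    moreover have "(norm u + 1) *\<^sub>R e - (u - s) = - (u - (norm u + 1) *\<^sub>R e - s)" by simp
    ultimately have "norm ((norm u + 1) *\<^sub>R e - (u - s)) \<le> norm u + 1"
      by (simp only: norm_minus_cancel)
    then show ?thesis unfolding cstar_le_def
      using u by (intro positiveI[of _ "norm u + 1"]) (auto simp: star_simps ss U_def)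
  qed
  ultimately have "is_sup A s"
    using ss by (auto simp: is_supremum_in_def selfadjoint_part_def)
  then show ?thesis by (rule that)
qed

definition proj :: "'a \<Rightarrow> bool" where
  "proj p \<longleftrightarrow> star p = p \<and> p * p = p"

lemma projD: "proj p \<Longrightarrow> star p = p" "proj p \<Longrightarrow> p * p = p" "proj p \<Longrightarrow> p * (p * x) = p * x"
  by (auto simp: proj_def simp flip: mult.assoc)

lemma proj_positive [intro, simp]: "proj p \<Longrightarrow> p \<in> positive_cone"
  using positive_square[of p] by (simp add: proj_def)

lemma proj_zero [simp]: "proj 0" and proj_unit [simp]: "proj e"
  by (simp_all add: proj_def)

lemma proj_mult [intro]: "proj p \<Longrightarrow> proj q \<Longrightarrow> proj (p * q)"
  unfolding proj_def by (metis comm lcomm mult.assoc star_mult)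

lemma proj_diff [intro]: "proj p \<Longrightarrow> proj q \<Longrightarrow> p * q = q \<Longrightarrow> proj (p - q)"
  unfolding proj_def by (simp add: star_simps algebra_simps comm[of q p])

lemma proj_compl [intro]: "proj p \<Longrightarrow> proj (e - p)"
  by (rule proj_diff) auto

lemma proj_add [intro]: "proj p \<Longrightarrow> proj q \<Longrightarrow> p * q = 0 \<Longrightarrow> proj (p + q)"
  unfolding proj_def by (simp add: star_simps algebra_simps comm[of q p])

lemma proj_le_iff:
  assumes "proj p" "proj q" shows "p \<sqsubseteq> q \<longleftrightarrow> p * q = p"
proof
  assume le: "p \<sqsubseteq> q"
  have "(q - p) * p \<in> positive_cone" "p * (e - q) \<in> positive_cone"
    using le assms by (auto simp: cstar_le_def)
  moreover have "(q - p) * p = - (p * (e - q))" using assms by (simp add: algebra_simps comm[of q p] proj_def)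
  ultimately have "p * (e - q) = 0" using positive_antisym[of "p * (e - q)"] by simp
  then show "p * q = p" by (simp add: right_diff_distrib)
next
  assume "p * q = p"
  then show "p \<sqsubseteq> q" using proj_positive[OF proj_diff[of q p]] assms by (simp add: cstar_le_def comm[of q p])
qed

lemma proj_le_unit: "proj p \<Longrightarrow> p \<sqsubseteq> e"
  by (simp add: proj_le_iff)

text \<open>The complement of the joint support projection of \<open>B\<close>.\<close>

definition annihilator :: "'a set \<Rightarrow> 'a" where
  "annihilator B = (SOME n. proj n \<and> (\<forall>b\<in>B. n * b = 0) \<and>
     (\<forall>c\<in>positive_cone. (\<forall>b\<in>B. c * b = 0) \<longrightarrow> c * n = c))"

text \<open>The elements of \<open>[0, 1]\<close> annihilating \<open>B\<close> are directed by \<open>c + d - c d\<close>, and their supremum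
  is again one of them, hence idempotent.\<close>

lemma annihilator:
  "proj (annihilator B)" "\<And>b. b \<in> B \<Longrightarrow> annihilator B * b = 0"
  "\<And>c. c \<in> positive_cone \<Longrightarrow> (\<And>b. b \<in> B \<Longrightarrow> c * b = 0) \<Longrightarrow> c * annihilator B = c"
proof -
  define C where "C = {c \<in> positive_cone. c \<sqsubseteq> e \<and> (\<forall>b\<in>B. c * b = 0)}"
  have join: "c + d - c * d \<in> C \<and> c \<sqsubseteq> c + d - c * d \<and> d \<sqsubseteq> c + d - c * d"
    if "c \<in> C" "d \<in> C" for c d
  proof -
    have P: "c \<in> positive_cone" "d \<in> positive_cone" "e - c \<in> positive_cone" "e - d \<in> positive_cone"
      using that by (auto simp: C_def cstar_le_def)
    have "c + d * (e - c) \<in> positive_cone" "d * (e - c) \<in> positive_cone" "c * (e - d) \<in> positive_cone"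
      "(e - c) * (e - d) \<in> positive_cone" using P by blast+
    moreover have "(c + d - c * d) * b = 0" if "b \<in> B" for b
      using \<open>c \<in> C\<close> \<open>d \<in> C\<close> that by (simp add: C_def algebra_simps)
    ultimately show ?thesis by (auto simp: C_def cstar_le_def algebra_simps comm[of d c])
  qed
  have "0 \<in> C" by (auto simp: C_def cstar_le_def)
  then have "directed C" unfolding upward_directed_def using join by blast
  then obtain s where s: "is_sup C s"
    by (rule directed_supremum) (auto simp: C_def)
  have sa: "star s = s" and ub: "\<And>c. c \<in> C \<Longrightarrow> c \<sqsubseteq> s"
    and lub: "\<And>u. star u = u \<Longrightarrow> (\<And>c. c \<in> C \<Longrightarrow> c \<sqsubseteq> u) \<Longrightarrow> s \<sqsubseteq> u"
    using s by (auto simp: is_supremum_in_def selfadjoint_part_def)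
  have spos: "s \<in> positive_cone" using ub[OF \<open>0 \<in> C\<close>] by (simp add: cstar_le_def)
  have se: "s \<sqsubseteq> e" by (rule lub) (auto simp: C_def)
  have sb: "s * b = 0" if "b \<in> B" for b
  proof (cases "b = 0")
    case False
    define d where "d = (1 / (norm b)\<^sup>2) *\<^sub>R (star b * b)"
    have dpos: "d \<in> positive_cone" unfolding d_def
      by (intro positive_scaleR) (auto simp: positive_cone_def)
    have "norm d = 1" using False by (simp add: d_def cstar_identity)
    then have de: "e - d \<in> positive_cone" using positive_le_norm[OF dpos] by (simp add: cstar_le_def)
    \<comment> \<open>Members of \<open>C\<close> are fixed by \<open>e - d\<close>, so
      \<open>s * (e - d)\<close> is another upper bound of \<open>C\<close>; comparison with the
      least one forces \<open>s * d = 0\<close>.\<close>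
    have "s \<sqsubseteq> s * (e - d)"
    proof (rule lub)
      show "star (s * (e - d)) = s * (e - d)"
        using sa positive_selfadjoint[OF dpos] by (simp add: star_simps comm)
      fix c assume c: "c \<in> C"
      then have "c * d = 0" using that by (simp add: C_def d_def lcomm[of c "star b"])
      then show "c \<sqsubseteq> s * (e - d)"
        using cstar_le_mult[OF ub[OF c] de] by (simp add: right_diff_distrib)
    qed
    then have "- (s * d) \<in> positive_cone" by (simp add: cstar_le_def right_diff_distrib)
    then have "s * d = 0" using positive_antisym spos dpos by blast
    then have "s * (star b * b) = 0" using False by (simp add: d_def)
    then have "star (s * b) * (s * b) = 0" by (simp add: star_simps sa ac)
    then show ?thesis by (rule star_mult_self_eq_0)
  qed simp
  have sC: "s \<in> C" using spos se sb by (auto simp: C_def)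
  have "s + s - s * s \<sqsubseteq> s" using join[OF sC sC] ub by blast
  then have "- (s * (e - s)) \<in> positive_cone" by (simp add: cstar_le_def algebra_simps)
  moreover have "s * (e - s) \<in> positive_cone" using spos se by (auto simp: cstar_le_def)
  ultimately have "s * (e - s) = 0" using positive_antisym by blast
  then have ss: "s * s = s" by (simp add: right_diff_distrib)
  have "c * s = c" if c: "c \<in> positive_cone" "\<forall>b\<in>B. c * b = 0" for c
  proof (cases "c = 0")
    case False
    have "(1 / norm c) *\<^sub>R c \<in> C"
      using cstar_le_scaleR[OF positive_le_norm[OF c(1)], of "1 / norm c"] c False
      by (auto simp: C_def)
    from cstar_le_mult[OF ub[OF this], of "e - s"] have "- ((1 / norm c) *\<^sub>R (c * (e - s))) \<in> positive_cone"
      using se ss by (simp add: cstar_le_def right_diff_distrib scaleR_diff_right)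
    moreover have "(1 / norm c) *\<^sub>R (c * (e - s)) \<in> positive_cone"
      using c(1) se by (intro positive_scaleR positive_mult) (auto simp: cstar_le_def)
    ultimately have "(1 / norm c) *\<^sub>R (c * (e - s)) = 0" using positive_antisym by blast
    then show ?thesis using False by (simp add: right_diff_distrib)
  qed simp
  then have "\<exists>n. proj n \<and> (\<forall>b\<in>B. n * b = 0) \<and> (\<forall>c\<in>positive_cone. (\<forall>b\<in>B. c * b = 0) \<longrightarrow> c * n = c)"
    using sa ss sb by (intro exI[of _ s]) (auto simp: proj_def)
  from someI_ex[OF this, folded annihilator_def]
  show "proj (annihilator B)" "\<And>b. b \<in> B \<Longrightarrow> annihilator B * b = 0"
    "\<And>c. c \<in> positive_cone \<Longrightarrow> (\<And>b. b \<in> B \<Longrightarrow> c * b = 0) \<Longrightarrow> c * annihilator B = c"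
    by auto
qed

text \<open>Let \<open>y = x - t e\<close> and let \<open>s\<close> be its absolute value. The
  projection \<open>q\<close> kills \<open>s - y\<close>, twice the negative part, so
  \<open>y * q = s * q\<close> is positive; it carries \<open>s + y\<close> because
  \<open>(s + y) * (s - y) = 0\<close>, so off \<open>q\<close> the element \<open>y\<close> equals
  \<open>- s\<close>.\<close>

lemma spectral_projection:
  assumes "star x = x"
  obtains q where "proj q" "t *\<^sub>R q \<sqsubseteq> x * q" "x * (e - q) \<sqsubseteq> t *\<^sub>R (e - q)"
proof -
  define y where "y = x - t *\<^sub>R e"
  have y: "star y = y" by (simp add: y_def star_simps assms)
  obtain s where s: "s \<in> positive_cone" "s * s = y * y" using positive_sqrt positive_square[OF y] by blast
  have ss: "star s = s" using s(1) by (rule positive_selfadjoint)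
  define q where "q = annihilator {s - y}"
  have q: "proj q" and "q * (s - y) = 0"
    using annihilator(1)[of "{s - y}"] annihilator(2)[of "s - y" "{s - y}"] by (auto simp: q_def)
  then have qy: "q * y = q * s" by (simp add: right_diff_distrib)
  have "(s + y) * (s + y) * q = (s + y) * (s + y)"
    unfolding q_def
  proof (rule annihilator)
    show "(s + y) * (s + y) \<in> positive_cone" by (rule positive_square) (simp add: star_simps y ss)
    have "(s + y) * (s - y) = 0" using s(2) by (simp add: algebra_simps comm[of y s])
    then show "(s + y) * (s + y) * b = 0" if "b \<in> {s - y}" for b using that by (simp add: mult.assoc)
  qed
  then have "((s + y) * (e - q)) * ((s + y) * (e - q)) = 0"
    using q by (simp add: algebra_simps ac projD)
  then have "(s + y) * (e - q) = 0"
    by (rule square_eq_0[rotated]) (simp add: star_simps y ss projD[OF q] comm)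
  then have "s * (e - q) = - (y * (e - q))" by (simp add: distrib_right eq_neg_iff_add_eq_0)
  moreover have "s * (e - q) \<in> positive_cone" "q * s \<in> positive_cone" using s q by auto
  ultimately have "- (y * (e - q)) \<in> positive_cone" "q * y \<in> positive_cone" using qy by simp_all
  then show ?thesis
    by (intro that[OF q]) (simp_all add: cstar_le_def y_def algebra_simps comm[of q x])
qed

text \<open>Each member satisfies \<open>p * s = p\<close>, so \<open>s * s\<close> is also an upper
  bound; minimality of \<open>s\<close> together with \<open>s * s \<sqsubseteq> s\<close> gives
  idempotence.\<close>

lemma directed_supremum_proj:
  assumes A: "directed A" and pr: "\<And>p. p \<in> A \<Longrightarrow> proj p"
  obtains s where "proj s" "is_sup A s"
proof -
  obtain s where s: "is_sup A s"
    using directed_supremum[OF A] pr proj_le_unit by blast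
  have sa: "star s = s" and ub: "\<And>c. c \<in> A \<Longrightarrow> c \<sqsubseteq> s"
    and lub: "\<And>u. star u = u \<Longrightarrow> (\<And>c. c \<in> A \<Longrightarrow> c \<sqsubseteq> u) \<Longrightarrow> s \<sqsubseteq> u"
    using s by (auto simp: is_supremum_in_def selfadjoint_part_def)
  obtain a0 where a0: "a0 \<in> A" using A by (auto simp: upward_directed_def)
  have spos: "s \<in> positive_cone"
    using ub[OF a0] proj_positive[OF pr[OF a0]] positive_add[of a0 "s - a0"] by (simp add: cstar_le_def)
  have se: "e - s \<in> positive_cone" using lub[of e] pr proj_le_unit by (simp add: cstar_le_def)
  have ps: "p * s = p" if "p \<in> A" for p
  proof -
    have p: "proj p" using pr that by blast
    have "(s - p) * p \<in> positive_cone" "p * (e - s) \<in> positive_cone"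
      using ub[OF that] p se by (auto simp: cstar_le_def)
    moreover have "(s - p) * p = - (p * (e - s))" using p by (simp add: algebra_simps comm[of s p] projD)
    ultimately have "p * (e - s) = 0" using positive_antisym[of "p * (e - s)"] by simp
    then show ?thesis by (simp add: right_diff_distrib)
  qed
  have "s \<sqsubseteq> s * s"
  proof (rule lub)
    fix p assume p: "p \<in> A"
    have "(s - p) * s \<in> positive_cone" using ub[OF p] spos by (auto simp: cstar_le_def)
    then show "p \<sqsubseteq> s * s" using ps[OF p] by (simp add: cstar_le_def left_diff_distrib)
  qed (simp add: star_simps sa)
  moreover have "s * s \<sqsubseteq> s"
    using positive_mult[OF spos se] by (simp add: cstar_le_def right_diff_distrib)
  ultimately have "s * s = s" by (rule cstar_le_antisym[OF _ _, symmetric])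
  with sa s show ?thesis by (intro that) (auto simp: proj_def)
qed

end

section \<open>Characters\<close>

lemma re_part_add: "re_part (x + y) = re_part x + re_part y"
  by (simp add: re_part_def star_simps algebra_simps)

lemma im_part_add: "im_part (x + y) = im_part x + im_part y"
  by (simp add: im_part_def star_simps algebra_simps scaleC_add_right scaleC_diff_right)

lemma re_part_selfadjoint: "star x = x \<Longrightarrow> re_part x = x"
  by (simp add: re_part_def flip: scaleR_2)

lemma im_part_selfadjoint: "star x = x \<Longrightarrow> im_part x = 0"
  by (simp add: im_part_def)

lemma
  shows re_part_scaleC: "re_part (c *\<^sub>C x) = Re c *\<^sub>R re_part x - Im c *\<^sub>R im_part x"
    and im_part_scaleC: "im_part (c *\<^sub>C x) = Im c *\<^sub>R re_part x + Re c *\<^sub>R im_part x"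
proof -
  let ?a = "Re c *\<^sub>R re_part x - Im c *\<^sub>R im_part x" and ?b = "Im c *\<^sub>R re_part x + Re c *\<^sub>R im_part x"
  let ?x = "re_part x" and ?y = "im_part x"
  have i: "(\<i> * of_real r) *\<^sub>C z = \<i> *\<^sub>C (r *\<^sub>R z)" for r z
    by (metis scaleC_of_real scaleC_scaleC)
  have "c *\<^sub>C x = (of_real (Re c) + \<i> * of_real (Im c)) *\<^sub>C (?x + \<i> *\<^sub>C ?y)"
    by (simp only: re_im_decomp flip: complex_eq)
  also have "\<dots> = Re c *\<^sub>R ?x + \<i> *\<^sub>C (Im c *\<^sub>R ?x) + (\<i> *\<^sub>C (Re c *\<^sub>R ?y) + \<i> *\<^sub>C (\<i> *\<^sub>C (Im c *\<^sub>R ?y)))"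
    by (simp add: scaleC_add_left scaleC_add_right scaleC_of_real scaleC_scaleR i)
  also have "\<dots> = ?a + \<i> *\<^sub>C ?b"
    by (simp add: scaleC_add_right scaleC_scaleC scaleC_minus_left)
  finally have "c *\<^sub>C x = ?a + \<i> *\<^sub>C ?b" .
  moreover have "star ?a = ?a" "star ?b = ?b" by (simp_all add: star_simps)
  ultimately show "re_part (c *\<^sub>C x) = ?a" "im_part (c *\<^sub>C x) = ?b"
    using cartesian_unique[of ?a ?b] by simp_all
qed

definition nonneg_complex :: "complex \<Rightarrow> bool" where
  "nonneg_complex z \<longleftrightarrow> Im z = 0 \<and> 0 \<le> Re z"

lemma nonneg_complex_add: "nonneg_complex a \<Longrightarrow> nonneg_complex b \<Longrightarrow> nonneg_complex (a + b)"
  and nonneg_complex_mult: "nonneg_complex a \<Longrightarrow> nonneg_complex b \<Longrightarrow> nonneg_complex (a * b)"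
  by (auto simp: nonneg_complex_def)

definition complex_linear :: "('a::complex_banach \<Rightarrow> complex) \<Rightarrow> bool" where
  "complex_linear f \<longleftrightarrow> (\<forall>x y. f (x + y) = f x + f y) \<and> (\<forall>c x. f (c *\<^sub>C x) = c * f x)"

lemma complex_linearD:
  assumes "complex_linear f"
  shows "f (x + y) = f x + f y" "f (c *\<^sub>C x) = c * f x" "f (r *\<^sub>R x) = of_real r * f x"
    "f 0 = 0" "f (- x) = - f x" "f (x - y) = f x - f y"
proof -
  show add: "f (x + y) = f x + f y" and sc: "f (c *\<^sub>C x) = c * f x" for x y c
    using assms by (auto simp: complex_linear_def)
  show r: "f (r *\<^sub>R x) = of_real r * f x" for r x using sc[of "of_real r" x] by (simp add: scaleC_of_real)
  show "f 0 = 0" using r[of 0 0] by simp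
  show m: "f (- x) = - f x" for x using r[of "-1" x] by simp
  show "f (x - y) = f x - f y" using add[of x "- y"] m[of y] by simp
qed

text \<open>The zero functional satisfies these conditions; it is excluded later by asking for the
  value 1 at a projection.\<close>

definition character :: "('a::cstar_algebra \<Rightarrow> complex) \<Rightarrow> bool" where
  "character \<omega> \<longleftrightarrow> complex_linear \<omega> \<and> (\<forall>x y. \<omega> (x * y) = \<omega> x * \<omega> y) \<and> (\<forall>x. \<omega> (star x) = cnj (\<omega> x))"

lemma characterD:
  assumes "character \<omega>"
  shows "\<omega> (x + y) = \<omega> x + \<omega> y" "\<omega> (c *\<^sub>C x) = c * \<omega> x" "\<omega> (r *\<^sub>R x) = of_real r * \<omega> x"
    "\<omega> 0 = 0" "\<omega> (- x) = - \<omega> x" "\<omega> (x - y) = \<omega> x - \<omega> y"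
    "\<omega> (x * y) = \<omega> x * \<omega> y" "\<omega> (star x) = cnj (\<omega> x)"
  using assms complex_linearD[of \<omega>] by (auto simp: character_def)

lemma character_sum: "character \<omega> \<Longrightarrow> \<omega> (sum f I) = (\<Sum>i\<in>I. \<omega> (f i))"
  by (induction I rule: infinite_finite_induct) (auto simp: characterD)

context unital_abelian_cstar
begin

text \<open>The values on a self-adjoint \<open>x\<close> are read off the explicit decomposition of
  \<open>x\<close> as \<open>x + norm x *\<^sub>R e\<close> minus \<open>norm x *\<^sub>R e\<close>.
  Additivity on the cone makes the result the same for every decomposition, and linearity follows by
  choosing convenient ones.\<close>

lemma positive_functional_extension:
  fixes T :: "'a \<Rightarrow> real"
  assumes add: "\<And>a b. a \<in> positive_cone \<Longrightarrow> b \<in> positive_cone \<Longrightarrow> T (a + b) = T a + T b"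
    and scale: "\<And>r a. 0 \<le> r \<Longrightarrow> a \<in> positive_cone \<Longrightarrow> T (r *\<^sub>R a) = r * T a"
  obtains f where "complex_linear f" "\<And>a. a \<in> positive_cone \<Longrightarrow> f a = of_real (T a)"
proof -
  define F where "F x = T (x + norm x *\<^sub>R e) - T (norm x *\<^sub>R e)" for x
  have pos: "x + norm x *\<^sub>R e \<in> positive_cone" "norm x *\<^sub>R e \<in> positive_cone" if "star x = x" for x
    using norm_le_iff[OF that, of "norm x"] by (auto simp: add.commute)
  have F: "F (a - b) = T a - T b" if "a \<in> positive_cone" "b \<in> positive_cone" for a b
  proof -
    have sa: "star (a - b) = a - b" using that by (simp add: star_simps positive_selfadjoint)
    have "T (a - b + norm (a - b) *\<^sub>R e) + T b = T (a + norm (a - b) *\<^sub>R e)"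
      using add[OF pos(1)[OF sa] that(2)] by (simp add: algebra_simps)
    also have "\<dots> = T a + T (norm (a - b) *\<^sub>R e)"
      using add[OF that(1) pos(2)[OF sa]] by simp
    finally show ?thesis by (simp add: F_def)
  qed
  have dec: "\<exists>a\<in>positive_cone. \<exists>b\<in>positive_cone. x = a - b" if "star x = x" for x :: 'a
    using pos[OF that] by (intro bexI[of _ "x + norm x *\<^sub>R e"] bexI[of _ "norm x *\<^sub>R e"]) auto
  have Fadd: "F (x + y) = F x + F y" if xy: "star x = x" "star y = y" for x y
  proof -
    obtain a b c d where *: "a \<in> positive_cone" "b \<in> positive_cone" "x = a - b"
      "c \<in> positive_cone" "d \<in> positive_cone" "y = c - d" using dec[OF xy(1)] dec[OF xy(2)] by blast
    have "F (x + y) = F ((a + c) - (b + d))" by (simp add: * algebra_simps)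
    also have "\<dots> = T (a + c) - T (b + d)" by (rule F) (use * in blast)+
    finally show ?thesis using * by (simp add: add F)
  qed
  have Fminus: "F (- x) = - F x" if x: "star x = x" for x
  proof -
    obtain a b where *: "a \<in> positive_cone" "b \<in> positive_cone" "x = a - b" using dec[OF x] by blast
    have "F (- x) = F (b - a)" by (simp add: *)
    then show ?thesis using * by (simp add: F)
  qed
  have Fnn: "F (r *\<^sub>R x) = r * F x" if x: "star x = x" and "0 \<le> r" for r x
  proof -
    obtain a b where *: "a \<in> positive_cone" "b \<in> positive_cone" "x = a - b" using dec[OF x] by blast
    have "F (r *\<^sub>R x) = F (r *\<^sub>R a - r *\<^sub>R b)" by (simp add: * scaleR_diff_right)
    also have "\<dots> = T (r *\<^sub>R a) - T (r *\<^sub>R b)" by (rule F) (use * that in blast)+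
    also have "\<dots> = r * (T a - T b)" using *(1,2) \<open>0 \<le> r\<close> by (simp add: scale right_diff_distrib)
    also have "T a - T b = F x" using * F by simp
    finally show ?thesis .
  qed
  have Fscale: "F (r *\<^sub>R x) = r * F x" if x: "star x = x" for r x
    using Fnn[OF x, of r] Fnn[OF x, of "- r"] Fminus[of "r *\<^sub>R x"] by (cases "0 \<le> r") (auto simp: star_simps x)
  define f where "f x = Complex (F (re_part x)) (F (im_part x))" for x
  show ?thesis
  proof
    show "complex_linear f"
      unfolding complex_linear_def
    proof (intro conjI allI)
      show "f (x + y) = f x + f y" for x y
        by (simp add: f_def re_part_add im_part_add Fadd complex_eq_iff)
      show "f (c *\<^sub>C x) = c * f x" for c x
      proof -
        have "F (Re c *\<^sub>R re_part x - Im c *\<^sub>R im_part x) = Re c * F (re_part x) - Im c * F (im_part x)"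
          using Fadd[of "Re c *\<^sub>R re_part x" "- (Im c *\<^sub>R im_part x)"] Fminus[of "Im c *\<^sub>R im_part x"]
          by (simp add: Fscale star_simps)
        then show ?thesis
          by (simp add: f_def re_part_scaleC im_part_scaleC complex_eq_iff Fadd Fscale star_simps)
      qed
    qed
    have "F 0 = 0" using Fscale[of 0 0] by simp
    then show "f a = of_real (T a)" if "a \<in> positive_cone" for a
      using F[OF that positive_zero] F[OF positive_zero positive_zero] that
      by (simp add: f_def re_part_selfadjoint im_part_selfadjoint positive_selfadjoint complex_eq_iff)
        (use Fscale[of 0 0] scale[of 0 0] in simp)
  qed
qed

lemma character_positive:
  fixes x :: 'a
  assumes "character \<omega>" "x \<in> positive_cone"
  shows "nonneg_complex (\<omega> x)"
proof -
  obtain s where s: "star s = s" "x = s * s" using assms(2) positive_cone_iff_square by blast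
  have "\<omega> s = cnj (\<omega> s)" using characterD(8)[OF assms(1), of s] s by simp
  then have "Im (\<omega> s) = 0" by (simp add: complex_eq_iff)
  then show ?thesis by (simp add: s characterD[OF assms(1)] nonneg_complex_def)
qed

lemma character_norm_le:
  fixes x :: 'a
  assumes \<omega>: "character \<omega>"
  shows "cmod (\<omega> x) \<le> norm x"
proof -
  have e: "cmod (\<omega> e) \<le> 1"
    using arg_cong[OF characterD(7)[OF \<omega>, of e e], of cmod] by (cases "cmod (\<omega> e) = 0") (auto simp: norm_mult)
  have "star x * x \<in> positive_cone" by (auto simp: positive_cone_def)
  then have "nonneg_complex (\<omega> (norm (star x * x) *\<^sub>R e - star x * x))" "nonneg_complex (\<omega> (star x * x))"
    using positive_le_norm by (auto simp: cstar_le_def intro!: character_positive[OF \<omega>])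
  then have "cmod (\<omega> (star x * x)) \<le> norm (star x * x) * Re (\<omega> e)"
    by (simp add: characterD(3,6)[OF \<omega>] nonneg_complex_def cmod_eq_Re)
  also have "\<dots> \<le> norm (star x * x) * 1"
    using complex_Re_le_cmod[of "\<omega> e"] e by (intro mult_left_mono) auto
  finally have "(cmod (\<omega> x))\<^sup>2 \<le> (norm x)\<^sup>2"
    by (simp add: characterD[OF \<omega>] norm_mult power2_eq_square cstar_identity)
  then show ?thesis by (rule power2_le_imp_le) simp
qed

end

lemma closed_complex_linear: "closed {f::'a::complex_banach \<Rightarrow> complex. complex_linear f}"
  unfolding complex_linear_def
  by (intro closed_Collect_conj closed_Collect_all closed_Collect_eq continuous_intros
        continuous_on_product_coordinates)

lemma closed_character: "closed {\<omega>::'a::cstar_algebra \<Rightarrow> complex. character \<omega>}"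
  unfolding character_def
  by (intro closed_Collect_conj closed_complex_linear closed_Collect_all closed_Collect_eq continuous_intros
        continuous_on_product_coordinates)

lemma compact_fun_box:
  assumes "closed K" "\<And>f i. f \<in> K \<Longrightarrow> cmod (f i) \<le> b i"
  shows "compact (K :: ('i \<Rightarrow> complex) set)"
proof -
  have "compact (PiE UNIV (\<lambda>i. cball 0 (b i) :: complex set))"
    using compactin_PiE[of "\<lambda>_. euclidean" UNIV "\<lambda>i. cball 0 (b i) :: complex set"]
    by (simp add: euclidean_product_topology)
  from compact_Int_closed[OF this assms(1)] show ?thesis
    using assms(2) by (simp add: PiE_def Int_absorb1 subset_iff)
qed

section \<open>Projections of finite trace and the existence of characters\<close>

locale traced_abelian_wstar = abelian_wstar ty e D
  for ty :: "'a::cstar_algebra itself" and e :: 'a and D :: "'a \<Rightarrow> 'p::complex_banach \<Rightarrow> complex" +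
  fixes \<tau> :: "'a \<Rightarrow> ennreal"
  assumes fns: "fns_trace \<tau>"
begin

lemma trace_add: "x \<in> positive_cone \<Longrightarrow> y \<in> positive_cone \<Longrightarrow> \<tau> (x + y) = \<tau> x + \<tau> y"
  and trace_scaleR: "x \<in> positive_cone \<Longrightarrow> 0 \<le> r \<Longrightarrow> \<tau> (r *\<^sub>R x) = ennreal r * \<tau> x"
  and trace_eq_0D: "x \<in> positive_cone \<Longrightarrow> \<tau> x = 0 \<Longrightarrow> x = 0"
  and trace_normal: "\<lbrakk>A \<subseteq> positive_cone; directed A;
     is_sup A s\<rbrakk> \<Longrightarrow> \<tau> s = (SUP a\<in>A. \<tau> a)"
  using fns by (auto simp: fns_trace_def trace_def faithful_def normal_def)

lemma trace_zero [simp]: "\<tau> 0 = 0"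
  using trace_scaleR[of 0 0] by simp

lemma trace_mono: "x \<in> positive_cone \<Longrightarrow> x \<sqsubseteq> y \<Longrightarrow> \<tau> x \<le> \<tau> y"
  using trace_add[of x "y - x"] by (simp add: cstar_le_def)

lemma trace_sum:
  "(\<And>i. i \<in> I \<Longrightarrow> f i \<in> positive_cone) \<Longrightarrow> \<tau> (sum f I) = (\<Sum>i\<in>I. \<tau> (f i))"
  by (induction I rule: infinite_finite_induct) (auto simp: trace_add positive_sum)

lemma trace_proj_mono: "proj p \<Longrightarrow> proj q \<Longrightarrow> p * q = p \<Longrightarrow> \<tau> p \<le> \<tau> q"
  by (rule trace_mono) (auto simp: proj_le_iff)

text \<open>Semifiniteness gives only a positive \<open>y\<close> below \<open>q0\<close>. Cut
  \<open>y\<close> at a level \<open>t\<close> strictly between 0 and \<open>norm y\<close>: below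
  the norm the spectral projection is nonzero, and for positive \<open>t\<close> the relation
  \<open>t *\<^sub>R q \<sqsubseteq> y * q \<sqsubseteq> y\<close> makes its trace finite.\<close>

lemma finite_subprojection:
  assumes q0: "proj q0" "q0 \<noteq> 0"
  obtains p where "proj p" "p \<noteq> 0" "p * q0 = p" "\<tau> p < \<infinity>"
proof -
  obtain y where y: "y \<in> positive_cone" "y \<noteq> 0" "y \<sqsubseteq> q0" "\<tau> y < \<infinity>"
    using fns q0 by (auto simp: fns_trace_def semifinite_trace_def) 
  define t where "t = norm y / 2"
  have t: "t > 0" "t < norm y" using y(2) by (auto simp: t_def)
  obtain q where q: "proj q" "t *\<^sub>R q \<sqsubseteq> y * q" "y * (e - q) \<sqsubseteq> t *\<^sub>R (e - q)"
    using spectral_projection positive_selfadjoint[OF y(1)] by blast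
  show ?thesis
  proof
    show "proj q" by fact
    show "q \<noteq> 0"
    proof
      assume "q = 0"
      then have "norm y \<le> t" using q(3) t by (intro positive_norm_le y) auto
      with t show False by simp
    qed
    have "y * (e - q0) \<in> positive_cone" using y(1) q0 by (intro positive_mult) auto
    moreover have "- (y * (e - q0)) \<in> positive_cone"
      using cstar_le_mult[OF y(3), of "e - q0"] q0 by (auto simp: cstar_le_def right_diff_distrib projD)
    ultimately have yq: "y * (e - q0) = 0" by (rule positive_antisym)
    have "- (t *\<^sub>R (q * (e - q0))) \<in> positive_cone"
      using cstar_le_mult[OF q(2), of "e - q0"] yq q0
      by (auto simp: cstar_le_def mult.assoc lcomm[of y q])
    moreover have "t *\<^sub>R (q * (e - q0)) \<in> positive_cone"
      using t q q0 by (intro positive_scaleR positive_mult) auto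
    ultimately have "t *\<^sub>R (q * (e - q0)) = 0" using positive_antisym by blast
    then show "q * q0 = q" using t by (simp add: right_diff_distrib)
    have "ennreal t * \<tau> q = \<tau> (t *\<^sub>R q)" using trace_scaleR q t by simp
    also have "\<dots> \<le> \<tau> (y * q)" using q t by (intro trace_mono positive_scaleR) auto
    also have "\<dots> \<le> \<tau> y"
    proof (rule trace_mono)
      show "y * q \<in> positive_cone" using y q by auto
      have "y * (e - q) \<in> positive_cone" using y q by (intro positive_mult) auto
      then show "y * q \<sqsubseteq> y" by (simp add: cstar_le_def right_diff_distrib)
    qed
    finally have "ennreal t * \<tau> q < \<infinity>" using y(4) by (rule order_le_less_trans)
    then show "\<tau> q < \<infinity>" using t by (auto simp: ennreal_mult_less_top top.not_eq_extremum[symmetric] ennreal_mult_eq_top_iff)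
  qed
qed

text \<open>Extreme points among the states supported on \<open>q\<close> are multiplicative; the trace provides
  a first such state.\<close>

lemma character_exists_finite:
  assumes q: "proj q" "q \<noteq> 0" "\<tau> q < \<infinity>"
  obtains \<omega> where "character \<omega>" "\<omega> q = 1"
proof -
  define K where "K = {f::'a \<Rightarrow> complex. complex_linear f \<and>
     (\<forall>x\<in>positive_cone. Im (f x) = 0 \<and> 0 \<le> Re (f x)) \<and> f e = 1 \<and> f q = 1}"
  have bound_sa: "cmod (f x) \<le> norm x" if f: "f \<in> K" and x: "star x = x" for f x
  proof -
    have "norm x *\<^sub>R e - x \<in> positive_cone" "norm x *\<^sub>R e + x \<in> positive_cone"
      using norm_le_iff[OF x, of "norm x"] by auto
    then have "Im (f (norm x *\<^sub>R e - x)) = 0" "0 \<le> Re (f (norm x *\<^sub>R e - x))" "0 \<le> Re (f (norm x *\<^sub>R e + x))"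
      using f by (auto simp: K_def)
    then show ?thesis using f by (simp add: K_def complex_linearD cmod_eq_Re)
  qed
  have bound: "cmod (f x) \<le> 2 * norm x" if f: "f \<in> K" for f x
  proof -
    have "f x = f (re_part x) + \<i> * f (im_part x)"
      using f arg_cong[OF re_im_decomp[of x], of f] by (simp add: K_def complex_linearD)
    then have "cmod (f x) \<le> cmod (f (re_part x)) + cmod (f (im_part x))"
      using norm_triangle_ineq[of "f (re_part x)" "\<i> * f (im_part x)"] by (simp add: norm_mult)
    also have "\<dots> \<le> norm x + norm x"
      by (intro add_mono order_trans[OF bound_sa[OF f]] norm_re_part_le norm_im_part_le) auto
    finally show ?thesis by simp
  qed
  have clK: "closed K"
  proof -
    have "K = {f. complex_linear f} \<inter> {f. \<forall>x\<in>positive_cone. Im (f x) = 0 \<and> 0 \<le> Re (f x)} \<inter> {f. f e = 1} \<inter> {f. f q = 1}"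
      by (auto simp: K_def)
    moreover have "{f::'a\<Rightarrow>complex. \<forall>x\<in>positive_cone. Im (f x) = 0 \<and> 0 \<le> Re (f x)} =
       (\<Inter>x\<in>positive_cone. {f. Im (f x) = 0 \<and> 0 \<le> Re (f x)})" by auto
    moreover have "closed {f::'a\<Rightarrow>complex. Im (f x) = 0 \<and> 0 \<le> Re (f x)}" for x
      by (intro closed_Collect_conj closed_Collect_eq closed_Collect_le continuous_intros
          continuous_on_product_coordinates)
    ultimately show ?thesis
      by (auto intro!: closed_Int closed_complex_linear closed_INT closed_Collect_eq continuous_intros
          continuous_on_product_coordinates)
  qed
  have "K \<noteq> {}"
  proof -
    define c where "c = enn2real (\<tau> q)"
    have c: "c > 0" using q trace_eq_0D[of q] unfolding c_def
      by (auto simp: enn2real_positive_iff zero_less_iff_neq_zero)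
    \<comment> \<open>The trace compressed to \<open>q\<close> and normalized, so that both
      \<open>e\<close> and \<open>q\<close> get the value 1.\<close>
    define T where "T a = enn2real (\<tau> (a * q)) / c" for a
    have fin: "\<tau> (a * q) < \<infinity>" if "a \<in> positive_cone" for a
    proof -
      have "a * q \<sqsubseteq> norm a *\<^sub>R q" using cstar_le_mult[OF positive_le_norm[OF that], of q] q by simp
      then have "\<tau> (a * q) \<le> ennreal (norm a) * \<tau> q"
        using trace_mono[of "a * q" "norm a *\<^sub>R q"] that q by (simp add: trace_scaleR positive_mult)
      also have "\<dots> < \<infinity>" using q(3) by (simp add: ennreal_mult_less_top)
      finally show ?thesis .
    qed
    obtain f where f: "complex_linear f" "\<And>a. a \<in> positive_cone \<Longrightarrow> f a = of_real (T a)"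
    proof (rule positive_functional_extension[of T])
      show "T (a + b) = T a + T b" if "a \<in> positive_cone" "b \<in> positive_cone" for a b
        using that q fin by (simp add: T_def distrib_right trace_add positive_mult enn2real_plus add_divide_distrib)
      show "T (r *\<^sub>R a) = r * T a" if "0 \<le> r" "a \<in> positive_cone" for r a
        using that q by (simp add: T_def trace_scaleR positive_mult enn2real_mult)
    qed blast
    have "f \<in> K" unfolding K_def using f q c by (auto simp: T_def projD c_def)
    then show ?thesis by blast
  qed
  moreover have "compact K"
    by (rule compact_fun_box[where b = "\<lambda>x. 2 * norm x"]) (rule clK, rule bound)
  ultimately obtain \<omega> where \<omega>: "\<omega> \<in> K"
    and "\<forall>g\<in>K. \<forall>h\<in>K. (\<forall>x. g x + h x = 2 * \<omega> x) \<longrightarrow> g = h"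
    using bexE[OF compact_fun_extreme_point[OF \<open>compact K\<close> clK \<open>K \<noteq> {}\<close>]] by blast
  then have ext: "\<And>g h. \<lbrakk>g \<in> K; h \<in> K; \<forall>x. g x + h x = 2 * \<omega> x\<rbrakk> \<Longrightarrow> g = h" by blast
  have lin: "complex_linear \<omega>" and pos: "\<And>x. x \<in> positive_cone \<Longrightarrow> nonneg_complex (\<omega> x)"
    and \<omega>e: "\<omega> e = 1" "\<omega> q = 1"
    using \<omega> by (auto simp: K_def nonneg_complex_def)
  note lins = complex_linearD[OF lin]
  have mult_unit: "\<omega> (a * x) = \<omega> a * \<omega> x" if a: "a \<in> positive_cone" "a \<sqsubseteq> e" for a x
  proof -
    \<comment> \<open>The defect of multiplicativity. Since \<open>\<omega> + g\<close> is
      \<open>\<omega> (a * x)\<close> plus \<open>(1 - \<omega> a) * \<omega> x\<close>, and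
      \<open>\<omega> - g\<close> has the same form with \<open>e - a\<close>, both are states in
      \<open>K\<close> with midpoint \<open>\<omega>\<close>; extremality gives
      \<open>g = 0\<close>.\<close>
    define g where "g x = \<omega> (a * x) - \<omega> a * \<omega> x" for x
    have ae: "e - a \<in> positive_cone" using a by (simp add: cstar_le_def)
    have a01: "nonneg_complex (\<omega> a)" "nonneg_complex (1 - \<omega> a)"
      using pos[OF a(1)] pos[OF ae] by (auto simp: lins \<omega>e)
    have glin: "g (x + y) = g x + g y" "g (c *\<^sub>C x) = c * g x" for x y c
      by (simp_all add: g_def lins mult_scaleC_right algebra_simps)
    have "g e = 0" by (simp add: g_def \<omega>e)
    \<comment> \<open>Since \<open>\<omega> (e - q) = 0\<close>, the nonnegative numbers
      \<open>\<omega> (a * (e - q))\<close> and \<open>\<omega> ((e - a) * (e - q))\<close> add up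
      to 0.\<close>
    have "g q = 0"
    proof -
      have "nonneg_complex (\<omega> (a * (e - q)))" "nonneg_complex (\<omega> ((e - a) * (e - q)))"
        using a(1) ae q by (auto intro!: pos positive_mult)
      then have "\<omega> (a * (e - q)) = 0"
        by (simp add: left_diff_distrib lins \<omega>e nonneg_complex_def complex_eq_iff)
      then show ?thesis by (simp add: g_def \<omega>e right_diff_distrib lins)
    qed
    have pm: "nonneg_complex (\<omega> x + g x)" "nonneg_complex (\<omega> x - g x)" if "x \<in> positive_cone" for x
    proof -
      have "\<omega> x + g x = \<omega> (a * x) + (1 - \<omega> a) * \<omega> x" by (simp add: g_def algebra_simps)
      then show "nonneg_complex (\<omega> x + g x)"
        using that a a01 pos by (metis nonneg_complex_add nonneg_complex_mult positive_mult)
      have "\<omega> x - g x = \<omega> ((e - a) * x) + \<omega> a * \<omega> x" by (simp add: g_def algebra_simps lins)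
      then show "nonneg_complex (\<omega> x - g x)"
        using that ae a01 pos by (metis nonneg_complex_add nonneg_complex_mult positive_mult)
    qed
    have "(\<lambda>x. \<omega> x + g x) \<in> K" "(\<lambda>x. \<omega> x - g x) \<in> K"
      unfolding K_def complex_linear_def using pm \<open>g e = 0\<close> \<open>g q = 0\<close>
      by (auto simp: glin lins \<omega>e nonneg_complex_def algebra_simps)
    then have "(\<lambda>x. \<omega> x + g x) = (\<lambda>x. \<omega> x - g x)" by (rule ext) simp
    then have "\<omega> x + g x = \<omega> x - g x" by (rule fun_cong)
    then show ?thesis by (simp add: g_def)
  qed
  have mult_pos: "\<omega> (a * x) = \<omega> a * \<omega> x" if a: "a \<in> positive_cone" for a x
  proof (cases "a = 0")
    case False
    have "\<omega> (((1 / norm a) *\<^sub>R a) * x) = \<omega> ((1 / norm a) *\<^sub>R a) * \<omega> x"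
      using cstar_le_scaleR[OF positive_le_norm[OF a], of "1 / norm a"] False a
      by (intro mult_unit positive_scaleR) auto
    then show ?thesis using False by (simp add: lins)
  qed (simp add: lins)
  have dec: "x = (x + norm x *\<^sub>R e) - norm x *\<^sub>R e" "x + norm x *\<^sub>R e \<in> positive_cone"
    "norm x *\<^sub>R e \<in> positive_cone" if "star x = x" for x
    using norm_le_iff[OF that, of "norm x"] by (auto simp: add.commute)
  have mult_sa: "\<omega> (a * x) = \<omega> a * \<omega> x" if a: "star a = a" for a x
  proof -
    obtain b c where bc: "b \<in> positive_cone" "c \<in> positive_cone" "a = b - c"
      using dec[OF a] by blast
    have "\<omega> (a * x) = \<omega> (b * x) - \<omega> (c * x)" by (simp add: bc(3) left_diff_distrib lins)
    also have "\<dots> = (\<omega> b - \<omega> c) * \<omega> x" by (simp add: mult_pos bc(1,2) left_diff_distrib)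
    also have "\<omega> b - \<omega> c = \<omega> a" by (simp add: bc(3) lins)
    finally show ?thesis .
  qed
  have real_sa: "Im (\<omega> a) = 0" if a: "star a = a" for a
    using pos[OF dec(2)[OF a]] pos[OF dec(3)[OF a]] by (simp add: nonneg_complex_def lins \<omega>e)
  have "\<omega> (x * y) = \<omega> x * \<omega> y" for x y
  proof -
    have "\<omega> ((re_part x + \<i> *\<^sub>C im_part x) * y) = \<omega> (re_part x + \<i> *\<^sub>C im_part x) * \<omega> y"
      by (simp add: distrib_right mult_scaleC_left lins mult_sa)
    then show ?thesis by (simp add: re_im_decomp)
  qed
  moreover have "\<omega> (star x) = cnj (\<omega> x)" for x
  proof -
    have "\<omega> (star (re_part x + \<i> *\<^sub>C im_part x)) = cnj (\<omega> (re_part x + \<i> *\<^sub>C im_part x))"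
      using real_sa[of "re_part x"] real_sa[of "im_part x"] by (simp add: star_simps lins complex_eq_iff)
    then show ?thesis by (simp add: re_im_decomp)
  qed
  ultimately have "character \<omega>" using lin by (auto simp: character_def)
  with \<omega>e show ?thesis by (intro that)
qed

section \<open>Sets of characters attached to projections, and joins of projections\<close>

definition U :: "'a \<Rightarrow> ('a \<Rightarrow> complex) set" where
  "U p = {\<omega>. character \<omega> \<and> \<omega> p = 1}"

lemma U_character: "\<omega> \<in> U p \<Longrightarrow> character \<omega>"
  by (simp add: U_def)

lemma U_mono: "p * q = p \<Longrightarrow> U p \<subseteq> U q"
  unfolding U_def using characterD(7) by (metis (mono_tags, lifting) mem_Collect_eq mult_1 subsetI)

lemma character_proj_cases: "character \<omega> \<Longrightarrow> proj p \<Longrightarrow> \<omega> p = 0 \<or> \<omega> p = 1"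
  using characterD(7)[of \<omega> p p] by (simp add: projD)

lemma U_mult: "proj p \<Longrightarrow> proj q \<Longrightarrow> U (p * q) = U p \<inter> U q"
  by (auto simp: U_def characterD)
    (metis character_proj_cases mult_zero_left mult_zero_right zero_neq_one)+

lemma U_zero [simp]: "U 0 = {}"
  by (auto simp: U_def characterD)

lemma U_nonempty:
  assumes "proj q" "q \<noteq> 0" shows "U q \<noteq> {}"
proof -
  obtain p where p: "proj p" "p \<noteq> 0" "p * q = p" "\<tau> p < \<infinity>"
    using finite_subprojection assms by blast
  then obtain \<omega> where "character \<omega>" "\<omega> p = 1" using character_exists_finite by blast
  then have "\<omega> \<in> U p" by (simp add: U_def)
  then show ?thesis using U_mono[OF p(3)] by blast
qed

lemma compact_U: "compact (U p)" and closed_U: "closed (U p)"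
proof -
  have "closed {\<omega>::'a \<Rightarrow> complex. \<omega> p = 1}"
    by (intro closed_Collect_eq continuous_intros continuous_on_product_coordinates)
  moreover have "U p = {\<omega>. character \<omega>} \<inter> {\<omega>. \<omega> p = 1}" by (auto simp: U_def)
  ultimately show "closed (U p)" using closed_Int[OF closed_character] by metis
  then show "compact (U p)"
    by (rule compact_fun_box[where b = norm]) (auto simp: U_def character_norm_le)
qed


lemma upward_directed_mult:
  assumes "directed A" "(c::'a) \<in> positive_cone"
  shows "directed ((\<lambda>a. a * c) ` A)"
  using assms(1) cstar_le_mult[OF _ assms(2)] unfolding upward_directed_def by (simp add: ball_simps bex_simps) blast

text \<open>An upper bound \<open>u\<close> of the compressed net is glued to \<open>s\<close> off
  \<open>p\<close>: \<open>u * p + s * (e - p)\<close> bounds the original net, and multiplying by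
  \<open>p\<close> compares \<open>s * p\<close> with \<open>u * p\<close>.\<close>

lemma supremum_mult_proj:
  assumes A: "directed A" "\<And>a. a \<in> A \<Longrightarrow> proj a"
    and s: "is_sup A s" and p: "proj p"
  shows "is_sup ((\<lambda>a. a * p) ` A) (s * p)"
proof -
  have sa: "star s = s" and ub: "\<And>c. c \<in> A \<Longrightarrow> c \<sqsubseteq> s"
    and lub: "\<And>u. star u = u \<Longrightarrow> (\<And>c. c \<in> A \<Longrightarrow> c \<sqsubseteq> u) \<Longrightarrow> s \<sqsubseteq> u"
    using s by (auto simp: is_supremum_in_def selfadjoint_part_def)
  have "s * p \<sqsubseteq> u" if u: "star u = u" "\<And>a. a \<in> A \<Longrightarrow> a * p \<sqsubseteq> u" for u
  proof -
    obtain a0 where "a0 \<in> A" using A by (auto simp: upward_directed_def)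
    have "s \<sqsubseteq> u * p + s * (e - p)"
    proof (rule lub)
      show "star (u * p + s * (e - p)) = u * p + s * (e - p)"
        using u(1) sa p by (simp add: star_simps projD comm)
      fix a assume a: "a \<in> A"
      have "(u - a * p) * p \<in> positive_cone" "(s - a) * (e - p) \<in> positive_cone"
        using u(2)[OF a] ub[OF a] p by (auto simp: cstar_le_def)
      from positive_add[OF this] show "a \<sqsubseteq> u * p + s * (e - p)"
        using p by (simp add: cstar_le_def algebra_simps projD)
    qed
    from cstar_le_mult[OF this, of p] have "s * p \<sqsubseteq> u * p"
      using p by (simp add: algebra_simps projD)
    moreover have "u * p \<sqsubseteq> u"
    proof -
      have "a0 * p \<in> positive_cone" using A(2) \<open>a0 \<in> A\<close> p by auto
      then have "u \<in> positive_cone" using positive_add[of "a0 * p" "u - a0 * p"] u(2)[OF \<open>a0 \<in> A\<close>]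
        by (simp add: cstar_le_def)
      then have "u * (e - p) \<in> positive_cone" using p by (intro positive_mult) auto
      then show ?thesis by (simp add: cstar_le_def right_diff_distrib)
    qed
    ultimately show ?thesis by (rule cstar_le_trans)
  qed
  then show ?thesis
    using ub cstar_le_mult[OF _ proj_positive[OF p]] sa p
    by (auto simp: is_supremum_in_def selfadjoint_part_def star_simps projD comm[of p s])
qed

text \<open>Normality says nothing about differences when the trace is infinite. After compression
  to a \<open>p\<close> of finite trace, subtraction is legitimate and the remainder
  \<open>\<tau> ((s - a) * p)\<close> can be made small.\<close>

lemma trace_supremum_approx:
  assumes A: "directed A" "\<And>a. a \<in> A \<Longrightarrow> proj a"
    and s: "is_sup A s" "proj s"
    and p: "proj p" "\<tau> p < \<infinity>" and \<epsilon>: "0 < \<epsilon>"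
  obtains a where "a \<in> A" "\<tau> ((s - a) * p) < \<epsilon>"
proof -
  have ub: "\<And>c. c \<in> A \<Longrightarrow> c * s = c"
    using s A(2) by (auto simp: is_supremum_in_def proj_le_iff)
  have fin: "\<tau> (q * p) < \<infinity>" if "proj q" for q
  proof -
    have "\<tau> (q * p) \<le> \<tau> p"
      by (rule trace_proj_mono) (use that p in \<open>auto simp: mult.assoc projD\<close>)
    then show ?thesis using p(2) by (rule order_le_less_trans)
  qed
  have "\<tau> (s * p) = (SUP a\<in>(\<lambda>a. a * p) ` A. \<tau> a)"
  proof (rule trace_normal)
    show "(\<lambda>a. a * p) ` A \<subseteq> positive_cone" using A(2) p by auto
    show "directed ((\<lambda>a. a * p) ` A)" using upward_directed_mult A p by auto
    show "is_sup ((\<lambda>a. a * p) ` A) (s * p)"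
      by (rule supremum_mult_proj) (use assms in auto)
  qed
  then have eq: "\<tau> (s * p) = (SUP a\<in>A. \<tau> (a * p))" by (simp add: image_image)
  obtain r where r: "0 < r" "ennreal r < \<epsilon>"
  proof -
    obtain \<delta> where "0 < \<delta>" "\<delta> < \<epsilon>" using dense[OF \<epsilon>] by blast
    then show ?thesis by (cases \<delta>) (auto intro: that)
  qed
  have "A \<noteq> {}" "\<tau> (s * p) \<noteq> \<infinity>" using A(1) fin[OF s(2)] by (auto simp: upward_directed_def)
  then obtain a where a: "a \<in> A" "\<tau> (s * p) < \<tau> (a * p) + ennreal r"
    using SUP_approx_ennreal[OF r(1) _ eq] by blast
  have pr: "proj (s - a)" using s A(2)[OF a(1)] ub[OF a(1)] by (intro proj_diff) (auto simp: comm[of s a])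
  have "\<tau> (s * p) = \<tau> (a * p) + \<tau> ((s - a) * p)"
    using A(2)[OF a(1)] pr p by (subst trace_add[symmetric]) (auto simp flip: distrib_right)
  then have "\<tau> (a * p) + \<tau> ((s - a) * p) < \<tau> (a * p) + ennreal r" using a(2) by simp
  then have "\<tau> ((s - a) * p) < ennreal r" using ennreal_add_left_cancel_less by blast
  then have "\<tau> ((s - a) * p) < \<epsilon>" using r(2) by (rule order_less_trans)
  with a(1) show ?thesis by (rule that)
qed

text \<open>\<open>j n\<close> is the join of \<open>q 0, \<dots>, q n\<close>, and \<open>s\<close> is the join of the whole sequence.\<close>

definition exhausts :: "(nat \<Rightarrow> 'a) \<Rightarrow> (nat \<Rightarrow> 'a) \<Rightarrow> 'a \<Rightarrow> bool" where
  "exhausts q j s \<longleftrightarrow> proj s \<and> (\<forall>n. proj (j n) \<and> q n * s = q n \<and> j n * s = j n \<and> U (j n) = (\<Union>i\<le>n. U (q i)) \<and>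
     (\<forall>b. (\<forall>i\<le>n. q i * b = 0) \<longrightarrow> j n * b = 0) \<and> \<tau> (j (Suc n)) \<le> \<tau> (j n) + \<tau> (q (Suc n)) \<and>
     (j n * q (Suc n) = 0 \<longrightarrow> \<tau> (j (Suc n)) = \<tau> (j n) + \<tau> (q (Suc n)))) \<and>
     j 0 = q 0 \<and> \<tau> s = (SUP n. \<tau> (j n)) \<and>
     (\<forall>p \<epsilon>. proj p \<longrightarrow> \<tau> p < \<infinity> \<longrightarrow> 0 < \<epsilon> \<longrightarrow> (\<exists>n. \<tau> ((s - j n) * p) < \<epsilon>))"

lemma exhaustsD:
  assumes "exhausts q j s"
  shows "proj s" "proj (j n)" "q n * s = q n" "j n * s = j n" "U (j n) = (\<Union>i\<le>n. U (q i))"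
    "(\<And>i. i \<le> n \<Longrightarrow> q i * b = 0) \<Longrightarrow> j n * b = 0"
    "\<tau> (j (Suc n)) \<le> \<tau> (j n) + \<tau> (q (Suc n))"
    "j n * q (Suc n) = 0 \<Longrightarrow> \<tau> (j (Suc n)) = \<tau> (j n) + \<tau> (q (Suc n))"
    "j 0 = q 0" "\<tau> s = (SUP n. \<tau> (j n))"
    "\<lbrakk>proj p; \<tau> p < \<infinity>; 0 < \<epsilon>\<rbrakk> \<Longrightarrow> \<exists>n. \<tau> ((s - j n) * p) < \<epsilon>"
  using assms unfolding exhausts_def by (simp_all)

lemma proj_sequence_supremum:
  assumes q: "\<And>n. proj (q n)"
  obtains j s where "exhausts q j s"
proof -
  \<comment> \<open>Each step adds only the part of \<open>q (Suc n)\<close> orthogonal to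
    \<open>j n\<close>, so the trace of the join splits into the traces of the two summands.\<close>
  define j where "j = rec_nat (q 0) (\<lambda>n a. a + q (Suc n) * (e - a))"
  have j: "j 0 = q 0" "\<And>n. j (Suc n) = j n + q (Suc n) * (e - j n)"
    by (simp_all add: j_def)
  have pj: "proj (j n)" for n
  proof (induction n)
    case (Suc n)
    then show ?case unfolding j
      by (intro proj_add proj_mult proj_compl q) (simp_all add: right_diff_distrib lcomm[of "j n"] projD comm[of "j n" "q (Suc n)"])
  qed (simp add: j q)
  have jj: "j n * j (Suc n) = j n" "q (Suc n) * j (Suc n) = q (Suc n)" for n
    by (simp_all add: j algebra_simps lcomm[of "j n"] projD pj q comm[of "j n" "q (Suc n)"])
  have le: "j m \<sqsubseteq> j n" if "m \<le> n" for m n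
    using that
  proof (induction rule: dec_induct)
    case (step k)
    have "j k \<sqsubseteq> j (Suc k)" by (simp add: proj_le_iff pj jj)
    with step show ?case by (blast intro: cstar_le_trans)
  qed simp
  have qj: "q n * j n = q n" for n
    by (cases n) (simp_all add: j(1) jj projD q)
  have dir: "directed (range j)"
    unfolding upward_directed_def
  proof (intro conjI ballI)
    fix x y assume "x \<in> range j" "y \<in> range j"
    then obtain m n where "x = j m" "y = j n" by auto
    then show "\<exists>z\<in>range j. x \<sqsubseteq> z \<and> y \<sqsubseteq> z"
      by (intro bexI[of _ "j (max m n)"]) (auto intro: le)
  qed auto
  obtain s where s: "proj s" "is_sup (range j) s"
    using directed_supremum_proj[OF dir] pj by blast
  have js: "j n * s = j n" for n
    using s pj by (auto simp: is_supremum_in_def proj_le_iff)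
  have "exhausts q j s"
    unfolding exhausts_def
  proof (intro conjI allI impI)
    show "q n * s = q n" for n by (metis js mult.assoc qj)
    show "U (j n) = (\<Union>i\<le>n. U (q i))" for n
    proof (induction n)
      case (Suc n)
      have "U (j (Suc n)) = U (j n) \<union> U (q (Suc n))"
      proof (intro equalityI Un_least)
        show "U (j n) \<subseteq> U (j (Suc n))" "U (q (Suc n)) \<subseteq> U (j (Suc n))" by (rule U_mono, rule jj)+
        show "U (j (Suc n)) \<subseteq> U (j n) \<union> U (q (Suc n))"
        proof
          fix \<omega> assume \<omega>: "\<omega> \<in> U (j (Suc n))"
          then have c: "character \<omega>" by (rule U_character)
          show "\<omega> \<in> U (j n) \<union> U (q (Suc n))"
            using \<omega> character_proj_cases[OF c pj[of n]] character_proj_cases[OF c q[of "Suc n"]]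
            by (auto simp: U_def j characterD[OF c])
        qed
      qed
      with Suc show ?case by (simp add: atMost_Suc Un_commute)
    qed (simp add: j)
    show jb: "j n * b = 0" if "\<forall>i\<le>n. q i * b = 0" for n b
      using that
    proof (induction n)
      case (Suc n)
      then have "j n * b = 0" "q (Suc n) * b = 0" by auto
      then show ?case by (simp add: j distrib_right mult.assoc lcomm[of "q (Suc n)" "e - j n" b])
    qed (simp add: j)
    have tj: "\<tau> (j (Suc n)) = \<tau> (j n) + \<tau> (q (Suc n) * (e - j n))" for n
      unfolding j(2) using pj q by (intro trace_add positive_mult) auto
    show "\<tau> (j (Suc n)) \<le> \<tau> (j n) + \<tau> (q (Suc n))" for n
    proof -
      have "(q (Suc n) * (e - j n)) * q (Suc n) = q (Suc n) * (e - j n)"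
        by (metis comm mult.assoc projD(2) q)
      then have "\<tau> (q (Suc n) * (e - j n)) \<le> \<tau> (q (Suc n))"
        by (intro trace_proj_mono proj_mult proj_compl pj q)
      then show ?thesis unfolding tj by (rule add_left_mono)
    qed
    show "\<tau> (j (Suc n)) = \<tau> (j n) + \<tau> (q (Suc n))" if "j n * q (Suc n) = 0" for n
      unfolding tj using that by (simp add: right_diff_distrib comm[of "q (Suc n)"])
    show "\<tau> s = (SUP n. \<tau> (j n))"
      using trace_normal[OF _ dir s(2)] pj by (auto simp: image_image image_subset_iff)
    show "\<exists>n. \<tau> ((s - j n) * p) < \<epsilon>" if "proj p" "\<tau> p < \<infinity>" "0 < \<epsilon>" for p \<epsilon>
      using trace_supremum_approx[OF dir _ s(2,1) that] pj by blast
  qed (use pj s js j in auto)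
  then show ?thesis by (rule that)
qed

section \<open>A maximal orthogonal family of projections of finite trace\<close>

definition FF :: "'a set" where
  "FF = (SOME F. (\<forall>p\<in>F. proj p \<and> p \<noteq> 0 \<and> \<tau> p < \<infinity>) \<and> (\<forall>p\<in>F. \<forall>q\<in>F. p \<noteq> q \<longrightarrow> p * q = 0) \<and>
     (\<forall>q. proj q \<and> q \<noteq> 0 \<longrightarrow> (\<exists>p\<in>F. p * q \<noteq> 0)))"

text \<open>A nonzero projection orthogonal to a maximal family would contain, by
  \<open>finite_subprojection\<close>, a nonzero one of finite trace that enlarges the
  family.\<close>

lemma FF:
  "p \<in> FF \<Longrightarrow> proj p" "p \<in> FF \<Longrightarrow> p \<noteq> 0" "p \<in> FF \<Longrightarrow> \<tau> p < \<infinity>"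
  "p \<in> FF \<Longrightarrow> q \<in> FF \<Longrightarrow> p \<noteq> q \<Longrightarrow> p * q = 0"
  "proj q \<Longrightarrow> q \<noteq> 0 \<Longrightarrow> \<exists>p\<in>FF. p * q \<noteq> 0"
proof -
  define \<F> where "\<F> = {F. (\<forall>p\<in>F. proj p \<and> p \<noteq> 0 \<and> \<tau> p < \<infinity>) \<and> (\<forall>p\<in>F. \<forall>q\<in>F. p \<noteq> q \<longrightarrow> p * q = 0)}"
  have "\<exists>M\<in>\<F>. \<forall>X\<in>\<F>. M \<subseteq> X \<longrightarrow> X = M"
  proof (rule subset_Zorn_nonempty)
    show "\<F> \<noteq> {}" by (auto simp: \<F>_def intro!: exI[of _ "{}"])
    fix C assume C: "C \<noteq> {}" "subset.chain \<F> C"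
    then have sub: "\<And>F. F \<in> C \<Longrightarrow> F \<in> \<F>" and ch: "\<And>F G. F \<in> C \<Longrightarrow> G \<in> C \<Longrightarrow> F \<subseteq> G \<or> G \<subseteq> F"
      by (auto simp: subset.chain_def)
    have "p * q = 0" if "p \<in> \<Union>C" "q \<in> \<Union>C" "p \<noteq> q" for p q
    proof -
      obtain F G where FG: "F \<in> C" "G \<in> C" "p \<in> F" "q \<in> G" using \<open>p \<in> \<Union>C\<close> \<open>q \<in> \<Union>C\<close> by blast
      then obtain H where "H \<in> C" "p \<in> H" "q \<in> H" using ch[of F G] by blast
      then show ?thesis using sub[of H] \<open>p \<noteq> q\<close> by (auto simp: \<F>_def)
    qed
    then show "\<Union>C \<in> \<F>" using sub by (fastforce simp: \<F>_def)
  qed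
  then obtain F where F: "F \<in> \<F>" "\<And>X. X \<in> \<F> \<Longrightarrow> F \<subseteq> X \<Longrightarrow> X = F" by blast
  have "\<exists>p\<in>F. p * q \<noteq> 0" if q: "proj q" "q \<noteq> 0" for q
  proof (rule ccontr)
    assume "\<not> ?thesis"
    then have orth: "p * q = 0" if "p \<in> F" for p using that by blast
    obtain r where r: "proj r" "r \<noteq> 0" "r * q = r" "\<tau> r < \<infinity>" using finite_subprojection[OF q] by blast
    have pr: "p * r = 0" if "p \<in> F" for p
    proof -
      have "p * r = r * (p * q)" using r(3) by (metis comm lcomm)
      then show ?thesis using orth[OF that] by simp
    qed
    have "r \<notin> F" using pr[of r] r by (auto simp: projD)
    moreover have "r * p = 0" if "p \<in> F" for p using pr[OF that] comm[of r p] by simp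
    then have "insert r F \<in> \<F>" using F(1) r pr by (auto simp: \<F>_def)
    ultimately show False using F(2)[of "insert r F"] by blast
  qed
  with F(1) have "\<exists>F. (\<forall>p\<in>F. proj p \<and> p \<noteq> 0 \<and> \<tau> p < \<infinity>) \<and> (\<forall>p\<in>F. \<forall>q\<in>F. p \<noteq> q \<longrightarrow> p * q = 0) \<and>
     (\<forall>q. proj q \<and> q \<noteq> 0 \<longrightarrow> (\<exists>p\<in>F. p * q \<noteq> 0))" by (auto simp: \<F>_def)
  from someI_ex[OF this, folded FF_def]
  show "p \<in> FF \<Longrightarrow> proj p" "p \<in> FF \<Longrightarrow> p \<noteq> 0" "p \<in> FF \<Longrightarrow> \<tau> p < \<infinity>"
    "p \<in> FF \<Longrightarrow> q \<in> FF \<Longrightarrow> p \<noteq> q \<Longrightarrow> p * q = 0"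
    "proj q \<Longrightarrow> q \<noteq> 0 \<Longrightarrow> \<exists>p\<in>FF. p * q \<noteq> 0" by blast+
qed

end

section \<open>The measure space of characters\<close>

context traced_abelian_wstar
begin

definition X :: "('a \<Rightarrow> complex) set" where
  "X = (\<Union>p\<in>FF. U p)"

lemma X_character: "\<omega> \<in> X \<Longrightarrow> character \<omega>"
  by (auto simp: X_def U_def)

lemma X_unit: "\<omega> \<in> X \<Longrightarrow> \<omega> e = 1"
  unfolding X_def U_def using characterD(7)[of \<omega> _ e] by force

lemma U_FF_subset: "p \<in> FF \<Longrightarrow> U p \<subseteq> X"
  by (auto simp: X_def)

lemma X_compl: "\<omega> \<in> X \<Longrightarrow> proj p \<Longrightarrow> \<omega> \<in> U (e - p) \<longleftrightarrow> \<omega> \<notin> U p"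
  using character_proj_cases[OF X_character, of \<omega> p]
  by (auto simp: U_def X_character characterD[OF X_character] X_unit)

section \<open>Null sets for the outer measure induced by
  \<open>U q \<mapsto> \<tau> q\<close>\<close>

definition coverable :: "('a \<Rightarrow> complex) set \<Rightarrow> bool" where
  "coverable E \<longleftrightarrow> (\<forall>\<epsilon>>0. \<exists>q. proj q \<and> E \<subseteq> U q \<and> \<tau> q < \<epsilon>)"

lemma coverableD: "coverable E \<Longrightarrow> 0 < \<epsilon> \<Longrightarrow> \<exists>q. proj q \<and> E \<subseteq> U q \<and> \<tau> q < \<epsilon>"
  by (auto simp: coverable_def)

lemma coverable_subset: "coverable E \<Longrightarrow> F \<subseteq> E \<Longrightarrow> coverable F"
  unfolding coverable_def by (meson order_trans)

lemma coverable_empty [simp]: "coverable {}"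
  by (auto simp: coverable_def intro!: exI[of _ 0])

lemma coverable_UN:
  assumes "\<And>n::nat. coverable (E n)"
  shows "coverable (\<Union>n. E n)"
  unfolding coverable_def
proof (intro allI impI)
  fix \<epsilon> :: ennreal assume "0 < \<epsilon>"
  \<comment> \<open>The geometric budget yields only \<open>\<tau> s \<le> \<delta>\<close>, so room
    is left below \<open>\<epsilon>\<close> to obtain a strict inequality.\<close>
  then obtain \<delta> where \<delta>: "0 < \<delta>" "\<delta> < \<epsilon>" using dense by blast
  have "\<exists>q. proj q \<and> E n \<subseteq> U q \<and> \<tau> q < \<delta> * ennreal ((1/2) ^ Suc n)" for n
  proof (rule coverableD[OF assms])
    show "0 < \<delta> * ennreal ((1/2) ^ Suc n)"
      using \<delta> by (simp add: ennreal_zero_less_mult_iff)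
  qed
  then obtain q where q: "\<And>n. proj (q n)" "\<And>n. E n \<subseteq> U (q n)" "\<And>n. \<tau> (q n) < \<delta> * ennreal ((1/2) ^ Suc n)"
    by metis
  obtain j s where js: "exhausts q j s"
    using proj_sequence_supremum q(1) by blast
  have "\<tau> (j n) \<le> (\<Sum>i\<le>n. \<tau> (q i))" for n
  proof (induction n)
    case (Suc n)
    have "\<tau> (j (Suc n)) \<le> \<tau> (j n) + \<tau> (q (Suc n))" by (rule exhaustsD[OF js])
    also have "\<dots> \<le> (\<Sum>i\<le>n. \<tau> (q i)) + \<tau> (q (Suc n))" by (intro add_right_mono Suc)
    finally show ?case by simp
  qed (simp add: exhaustsD(9)[OF js])
  also have "(\<Sum>i\<le>n. \<tau> (q i)) \<le> (\<Sum>i\<le>n. \<delta> * ennreal ((1/2) ^ Suc i))" for n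
    using q(3) by (intro sum_mono) (auto intro: less_imp_le)
  also have "(\<Sum>i\<le>n. \<delta> * ennreal ((1/2) ^ Suc i)) \<le> (\<Sum>i. \<delta> * ennreal ((1/2) ^ Suc i))" for n
    by (intro sum_le_suminf) auto
  also have "(\<Sum>i. \<delta> * ennreal ((1/2) ^ Suc i)) = \<delta>"
    by (subst ennreal_suminf_cmult, subst suminf_ennreal_eq[OF zero_le_power power_half_series]) auto
  finally have "\<tau> s \<le> \<delta>" unfolding exhaustsD(10)[OF js] by (rule SUP_least)
  then have "\<tau> s < \<epsilon>" using \<delta> by simp
  moreover have "(\<Union>n. E n) \<subseteq> U s" using q(2) U_mono[OF exhaustsD(3)[OF js]] by blast
  ultimately show "\<exists>q. proj q \<and> (\<Union>n. E n) \<subseteq> U q \<and> \<tau> q < \<epsilon>" using exhaustsD(1)[OF js] by blast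
qed

text \<open>Tested on each \<open>U p\<close> separately: covering \<open>X\<close> may take
  uncountably many pieces, and a set that is null on all of them need not be coverable as a whole.
  Inner regularity demands that such sets be null, since a compact set meets only finitely many
  pieces.\<close>

definition negligible_set :: "('a \<Rightarrow> complex) set \<Rightarrow> bool" where
  "negligible_set E \<longleftrightarrow> E \<subseteq> X \<and> (\<forall>p\<in>FF. coverable (E \<inter> U p))"

lemma negligible_set_subset: "negligible_set E \<Longrightarrow> F \<subseteq> E \<Longrightarrow> negligible_set F"
  unfolding negligible_set_def by (meson Int_mono coverable_subset order_refl order_trans)

lemma negligible_set_empty [simp]: "negligible_set {}"
  by (simp add: negligible_set_def)

lemma negligible_set_UN: "(\<And>n::nat. negligible_set (E n)) \<Longrightarrow> negligible_set (\<Union>n. E n)"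
  unfolding negligible_set_def by (auto simp: UN_extend_simps(4) simp del: UN_simps intro!: coverable_UN)

lemma negligible_set_Un: "negligible_set E \<Longrightarrow> negligible_set F \<Longrightarrow> negligible_set (E \<union> F)"
  using negligible_set_UN[of "\<lambda>n. if n = 0 then E else F"]
  by (rule negligible_set_subset) (auto split: if_splits)

lemma FF_mult_eq_0:
  assumes "proj q" "\<And>p. p \<in> FF \<Longrightarrow> p * q = 0" shows "q = 0"
  using FF(5)[OF assms(1)] assms(2) by blast

text \<open>If \<open>p * (e - q)\<close> were nonzero it would meet some member of
  \<open>FF\<close>, and a character in \<open>U\<close> of the product would lie in
  \<open>U p \<inter> X\<close> but not in \<open>U q\<close>.\<close>

lemma U_subset_imp_le:
  assumes "proj p" "proj q" "U p \<inter> X \<subseteq> U q" shows "p * q = p"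
proof -
  have r: "proj (p * (e - q))" using assms by auto
  have "p * (e - q) = 0"
  proof (rule FF_mult_eq_0[OF r], rule ccontr)
    fix f assume f: "f \<in> FF" "f * (p * (e - q)) \<noteq> 0"
    then obtain \<omega> where \<omega>: "\<omega> \<in> U (f * (p * (e - q)))" using U_nonempty r FF(1) by blast
    then have "\<omega> \<in> U f" "\<omega> \<in> U p" "\<omega> \<in> U (e - q)"
      using U_mult f(1) FF(1) assms r by auto
    moreover have "\<omega> \<in> X" using f(1) \<open>\<omega> \<in> U f\<close> by (auto simp: X_def)
    ultimately show False using X_compl assms by blast
  qed
  then show ?thesis by (simp add: right_diff_distrib)
qed

text \<open>A covering of \<open>U q\<close> on a piece becomes, by \<open>U_subset_imp_le\<close>,
  an inequality \<open>\<tau> (p * q) \<le> \<tau> r\<close> with \<open>\<tau> r\<close>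
  arbitrarily small, and the trace is faithful. Uniqueness of the projection attached to a set
  depends on this.\<close>

lemma negligible_U_imp_0:
  assumes "proj q" "negligible_set (U q \<inter> X)" shows "q = 0"
proof (rule FF_mult_eq_0[OF assms(1)])
  fix p assume p: "p \<in> FF"
  have pq: "proj (p * q)" using p FF(1) assms(1) by auto
  have "\<tau> (p * q) < \<epsilon>" if "0 < \<epsilon>" for \<epsilon>
  proof -
    have "coverable (U q \<inter> X \<inter> U p)" using assms(2) p by (auto simp: negligible_set_def)
    from coverableD[OF this that] obtain r where r: "proj r" "U q \<inter> X \<inter> U p \<subseteq> U r" "\<tau> r < \<epsilon>" by blast
    have "p * q * r = p * q"
      using r(2) U_mult[OF FF(1)[OF p] assms(1)] by (intro U_subset_imp_le pq r) auto
    then have "\<tau> (p * q) \<le> \<tau> r" by (intro trace_proj_mono pq r)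
    then show ?thesis using r(3) by (rule order_le_less_trans)
  qed
  then have "\<tau> (p * q) = 0" by (metis not_gr_zero order_less_irrefl)
  then show "p * q = 0" using trace_eq_0D pq by auto
qed

section \<open>The sigma-algebra of sets represented by projections, and its measure\<close>

definition represents :: "'a \<Rightarrow> ('a \<Rightarrow> complex) set \<Rightarrow> bool" where
  "represents q E \<longleftrightarrow> proj q \<and> E \<subseteq> X \<and> negligible_set ((E - U q) \<union> (U q \<inter> X - E))"

lemma represents_U: "proj q \<Longrightarrow> represents q (U q \<inter> X)"
  by (simp add: represents_def Diff_eq_empty_iff[THEN iffD2])

lemma represents_compl: "represents q E \<Longrightarrow> represents (e - q) (X - E)"
  unfolding represents_def using X_compl
  by (auto elim!: negligible_set_subset)

lemma represents_disjoint:
  assumes "represents q E" "represents r F" "E \<inter> F = {}" shows "q * r = 0"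
proof (rule negligible_U_imp_0)
  have q: "proj q" "proj r" using assms by (auto simp: represents_def)
  then show "proj (q * r)" by auto
  have "negligible_set (((E - U q) \<union> (U q \<inter> X - E)) \<union> ((F - U r) \<union> (U r \<inter> X - F)))"
    by (rule negligible_set_Un) (use assms in \<open>simp_all add: represents_def\<close>)
  then show "negligible_set (U (q * r) \<inter> X)"
    by (rule negligible_set_subset) (use assms(3) U_mult[OF q] in auto)
qed

lemma represents_unique:
  assumes "represents q E" "represents r E" shows "q = r"
proof -
  have le: "q * r = q" if "represents q E" "represents r E" for q r
  proof -
    have "q * (e - r) = 0"
      by (rule represents_disjoint[OF that(1) represents_compl[OF that(2)]]) auto
    then show ?thesis by (simp add: right_diff_distrib)
  qed
  show ?thesis using le[OF assms] le[OF assms(2,1)] by (metis comm)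
qed

text \<open>The union of the sets \<open>U (q n)\<close> may be smaller than \<open>U s\<close>.
  Inside \<open>U p\<close> the defect lies in \<open>U ((s - j n) * p)\<close> for every
  \<open>n\<close>, whose trace can be made small by normality, so the defect is negligible.\<close>

lemma represents_UN:
  fixes E :: "nat \<Rightarrow> _"
  assumes rep: "\<And>n. represents (q n) (E n)"
  obtains s where "represents s (\<Union>n. E n)" "disjoint_family E \<Longrightarrow> \<tau> s = (\<Sum>n. \<tau> (q n))"
proof -
  have q: "proj (q n)" for n using rep by (auto simp: represents_def)
  obtain j s where ex: "exhausts q j s"
    using proj_sequence_supremum q by blast
  note pj = exhaustsD(2)[OF ex] and s = exhaustsD(1,3)[OF ex] and Uj = exhaustsD(5)[OF ex]
    and orth = exhaustsD(6)[OF ex] and j0 = exhaustsD(9)[OF ex] and jS = exhaustsD(8)[OF ex]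
    and \<tau>s = exhaustsD(10)[OF ex] and js = exhaustsD(4)[OF ex] and approx = exhaustsD(11)[OF ex]
  have psj: "proj (s - j n)" for n using s pj js[of n] by (intro proj_diff) (auto simp: comm[of s "j n"])
  have "negligible_set (U s \<inter> X - (\<Union>n. U (q n)))"
    unfolding negligible_set_def coverable_def
  proof (intro conjI ballI allI impI)
    fix p and \<epsilon> :: ennreal assume p: "p \<in> FF" and \<epsilon>: "0 < \<epsilon>"
    then obtain n where n: "\<tau> ((s - j n) * p) < \<epsilon>" using approx FF by blast
    have "(U s \<inter> X - (\<Union>n. U (q n))) \<inter> U p \<subseteq> U ((s - j n) * p)"
    proof
      fix \<omega> assume \<omega>: "\<omega> \<in> (U s \<inter> X - (\<Union>n. U (q n))) \<inter> U p"
      then have c: "character \<omega>" by (auto intro: U_character)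
      have "\<omega> (j n) = 0" using \<omega> character_proj_cases[OF c pj[of n]] Uj[of n] c by (auto simp: U_def)
      then show "\<omega> \<in> U ((s - j n) * p)" using \<omega> by (auto simp: U_def characterD)
    qed
    then show "\<exists>r. proj r \<and> (U s \<inter> X - (\<Union>n. U (q n))) \<inter> U p \<subseteq> U r \<and> \<tau> r < \<epsilon>"
      using n psj FF(1)[OF p] by blast
  qed auto
  moreover have "negligible_set (\<Union>n. (E n - U (q n)) \<union> (U (q n) \<inter> X - E n))"
    using rep by (intro negligible_set_UN) (auto simp: represents_def)
  ultimately have "negligible_set ((U s \<inter> X - (\<Union>n. U (q n))) \<union> (\<Union>n. (E n - U (q n)) \<union> (U (q n) \<inter> X - E n)))"
    by (rule negligible_set_Un)
  then have "negligible_set (((\<Union>n. E n) - U s) \<union> (U s \<inter> X - (\<Union>n. E n)))"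
  proof (rule negligible_set_subset)
    show "((\<Union>n. E n) - U s) \<union> (U s \<inter> X - (\<Union>n. E n)) \<subseteq>
      (U s \<inter> X - (\<Union>n. U (q n))) \<union> (\<Union>n. (E n - U (q n)) \<union> (U (q n) \<inter> X - E n))"
      using U_mono[OF s(2)] by blast
  qed
  then have "represents s (\<Union>n. E n)" using s rep by (auto simp: represents_def)
  moreover have "\<tau> s = (\<Sum>n. \<tau> (q n))" if "disjoint_family E"
  proof -
    have "q i * q k = 0" if "i \<noteq> k" for i k
      using rep \<open>disjoint_family E\<close> that by (intro represents_disjoint[of _ "E i" _ "E k"]) (auto simp: disjoint_family_on_def)
    then have "\<tau> (j n) = (\<Sum>i\<le>n. \<tau> (q i))" for n
    proof (induction n)
      case (Suc n)
      have "j n * q (Suc n) = 0" by (rule orth) (use Suc in auto)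
      with jS Suc show ?case by simp
    qed (simp add: j0)
    then have "\<tau> s = (SUP n. \<Sum>i\<le>n. \<tau> (q i))" by (simp add: \<tau>s)
    moreover have "(\<lambda>n. \<Sum>i\<le>n. \<tau> (q i)) \<longlonglongrightarrow> (SUP n. \<Sum>i\<le>n. \<tau> (q i))"
      by (intro LIMSEQ_SUP incseq_SucI) simp
    moreover have "(\<lambda>n. \<Sum>i\<le>n. \<tau> (q i)) \<longlonglongrightarrow> (\<Sum>n. \<tau> (q n))"
      by (rule summable_LIMSEQ') simp
    ultimately show ?thesis using LIMSEQ_unique by metis
  qed
  ultimately show ?thesis by (rule that)
qed

definition \<Sigma> :: "('a \<Rightarrow> complex) set set" where
  "\<Sigma> = {E. \<exists>q. represents q E}"

definition rep :: "('a \<Rightarrow> complex) set \<Rightarrow> 'a" where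
  "rep E = (THE q. represents q E)"

lemma rep_eqI: "represents q E \<Longrightarrow> rep E = q"
  unfolding rep_def using represents_unique by blast

lemma represents_rep: "E \<in> \<Sigma> \<Longrightarrow> represents (rep E) E"
  using rep_eqI by (auto simp: \<Sigma>_def)

lemma represents_empty: "represents 0 {}"
  by (simp add: represents_def)

lemma sigma_algebra_\<Sigma>: "sigma_algebra X \<Sigma>"
proof (subst sigma_algebra_iff2, intro conjI ballI allI impI)
  show "\<Sigma> \<subseteq> Pow X" by (auto simp: \<Sigma>_def represents_def)
  show "{} \<in> \<Sigma>" using represents_empty by (auto simp: \<Sigma>_def)
  show "X - E \<in> \<Sigma>" if "E \<in> \<Sigma>" for E using that represents_compl by (auto simp: \<Sigma>_def)
  fix A :: "nat \<Rightarrow> _" assume "range A \<subseteq> \<Sigma>"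
  then have "represents (rep (A n)) (A n)" for n using represents_rep by blast
  then show "(\<Union>i. A i) \<in> \<Sigma>" using represents_UN[of "\<lambda>n. rep (A n)" A] by (auto simp: \<Sigma>_def)
qed

definition N :: "('a \<Rightarrow> complex) measure" where
  "N = measure_of X \<Sigma> (\<lambda>E. \<tau> (rep E))"

lemma space_N [simp]: "space N = X" and sets_N: "sets N = \<Sigma>"
  using sigma_algebra.space_measure_of_eq[OF sigma_algebra_\<Sigma>]
    sigma_algebra.sets_measure_of_eq[OF sigma_algebra_\<Sigma>] by (auto simp: N_def)

lemma emeasure_N:
  assumes "E \<in> sets N" shows "emeasure N E = \<tau> (rep E)"
proof (rule emeasure_measure_of[OF N_def])
  show "\<Sigma> \<subseteq> Pow X" by (auto simp: \<Sigma>_def represents_def)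
  show "positive (sets N) (\<lambda>E. \<tau> (rep E))"
    by (simp add: positive_def rep_eqI[OF represents_empty])
  show "countably_additive (sets N) (\<lambda>E. \<tau> (rep E))"
    unfolding countably_additive_def sets_N
  proof (intro allI impI)
    fix A :: "nat \<Rightarrow> _" assume A: "range A \<subseteq> \<Sigma>" "disjoint_family A"
    then have "represents (rep (A n)) (A n)" for n using represents_rep by blast
    then obtain s where "represents s (\<Union>n. A n)" "\<tau> s = (\<Sum>n. \<tau> (rep (A n)))"
      using represents_UN[of "\<lambda>n. rep (A n)" A] A(2) by metis
    then show "(\<Sum>i. \<tau> (rep (A i))) = \<tau> (rep (\<Union>i. A i))" by (simp add: rep_eqI)
  qed
qed (rule assms)

lemma represents_emeasure: "represents q E \<Longrightarrow> E \<in> sets N \<and> emeasure N E = \<tau> q"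
  using emeasure_N[of E] rep_eqI[of q E] by (auto simp: sets_N \<Sigma>_def)

text \<open>The direction from null sets uses faithfulness: trace zero forces the representing
  projection to vanish.\<close>

lemma negligible_set_iff_null: "negligible_set E \<longleftrightarrow> E \<in> null_sets N"
proof
  assume "negligible_set E"
  then have "represents 0 E" by (simp add: represents_def negligible_set_def)
  then show "E \<in> null_sets N" using represents_emeasure[of 0 E] by auto
next
  assume E: "E \<in> null_sets N"
  then have "represents (rep E) E" using represents_rep sets_N by auto
  moreover have "rep E = 0"
    using null_setsD1[OF E] emeasure_N[OF null_setsD2[OF E]] calculation by (intro trace_eq_0D) (auto simp: represents_def)
  ultimately show "negligible_set E" by (simp add: represents_def)
qed


lemma sets_N_subset: "E \<in> sets N \<Longrightarrow> E \<subseteq> X"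
  using sets.sets_into_space[of E N] by simp

lemma U_FF_sets: "p \<in> FF \<Longrightarrow> U p \<in> sets N" "p \<in> FF \<Longrightarrow> emeasure N (U p) = \<tau> p"
  using represents_emeasure[OF represents_U[OF FF(1)], of p] U_FF_subset[of p] by (auto simp: Int_absorb2)

lemma represents_Int_U:
  assumes "represents q E" "proj p" shows "represents (q * p) (E \<inter> U p)"
  using assms U_mult[of q p] unfolding represents_def
  by (auto elim!: negligible_set_subset)

lemma null_subset_sets: "B \<in> null_sets N \<Longrightarrow> A \<subseteq> B \<Longrightarrow> A \<in> sets N"
  by (meson negligible_set_iff_null negligible_set_subset null_setsD2)

section \<open>Measurability of open sets and of evaluations\<close>

lemma character_scaleR_diff_mult:
  "character \<omega> \<Longrightarrow> \<omega> r = 1 \<Longrightarrow> \<omega> (c *\<^sub>R r - y * r) = of_real c - \<omega> (y::'a)"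
  by (simp add: characterD)

text \<open>Let \<open>a\<close> be the squared modulus of \<open>x - \<omega> x\<close>. Off the
  spectral projection of \<open>a\<close> at a level \<open>t > 0\<close> the values of
  \<open>a\<close> are at most \<open>t\<close>, and \<open>\<omega>\<close> itself lies there
  because \<open>\<omega> a = 0\<close>. Hence the sets \<open>U q\<close> form a base of the
  topology on \<open>X\<close>.\<close>

lemma character_neighbourhood:
  assumes \<omega>: "\<omega> \<in> X" and "0 < \<epsilon>"
  obtains q where "proj q" "\<omega> \<in> U q" "\<And>\<psi>. \<psi> \<in> U q \<inter> X \<Longrightarrow> cmod (\<psi> x - \<omega> x) < \<epsilon>"
proof -
  define y where "y = x - \<omega> x *\<^sub>C e"
  define a where "a = star y * y"
  have a: "a \<in> positive_cone" by (auto simp: a_def positive_cone_def)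
  have \<psi>a: "\<psi> a = of_real ((cmod (\<psi> x - \<omega> x))\<^sup>2)" if "\<psi> \<in> X" for \<psi>
  proof -
    have "\<psi> a = (\<psi> x - \<omega> x) * cnj (\<psi> x - \<omega> x)"
      using X_character[OF that] X_unit[OF that] by (simp add: a_def y_def characterD mult.commute)
    then show ?thesis by (simp only: complex_norm_square)
  qed
  \<comment> \<open>Half of \<open>\<epsilon>\<close>, because the spectral projection gives only a
    weak inequality.\<close>
  define t where "t = (\<epsilon> / 2)\<^sup>2"
  have t: "t > 0" using assms(2) by (simp add: t_def)
  obtain q where q: "proj q" "t *\<^sub>R q \<sqsubseteq> a * q" "a * (e - q) \<sqsubseteq> t *\<^sub>R (e - q)"
    using spectral_projection positive_selfadjoint[OF a] by blast
  show ?thesis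
  proof
    show "proj (e - q)" using q by auto
    have "nonneg_complex (\<omega> (a * q - t *\<^sub>R q))"
      using q(2) by (intro character_positive X_character \<omega>) (simp add: cstar_le_def)
    then have "\<omega> q \<noteq> 1"
      using t by (auto simp: characterD X_character[OF \<omega>] \<psi>a[OF \<omega>] nonneg_complex_def)
    then show "\<omega> \<in> U (e - q)" using X_compl[OF \<omega> q(1)] by (auto simp: U_def)
    fix \<psi> assume \<psi>: "\<psi> \<in> U (e - q) \<inter> X"
    then have "nonneg_complex (\<psi> (t *\<^sub>R (e - q) - a * (e - q)))"
      using q(3) by (intro character_positive X_character) (simp_all add: cstar_le_def)
    moreover have "\<psi> (t *\<^sub>R (e - q) - a * (e - q)) = of_real t - \<psi> a"
      using \<psi> by (intro character_scaleR_diff_mult) (auto simp: U_def)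
    ultimately have "(cmod (\<psi> x - \<omega> x))\<^sup>2 \<le> (\<epsilon> / 2)\<^sup>2"
      using \<psi>a[of \<psi>] \<psi> by (simp add: nonneg_complex_def t_def)
    then have "cmod (\<psi> x - \<omega> x) \<le> \<epsilon> / 2" using assms(2) by (auto intro: power2_le_imp_le)
    then show "cmod (\<psi> x - \<omega> x) < \<epsilon>" using assms(2) by simp
  qed
qed

lemma U_basis:
  assumes "open W" "\<omega> \<in> X" "\<omega> \<in> W"
  obtains q where "proj q" "\<omega> \<in> U q" "U q \<inter> X \<subseteq> W"
proof -
  have "openin (product_topology (\<lambda>_. euclidean) UNIV) W" using assms(1) by (simp add: open_fun_def)
  then obtain V where V: "\<omega> \<in> PiE UNIV V" "\<And>i. open (V i)" "finite {i. V i \<noteq> UNIV}" "PiE UNIV V \<subseteq> W"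
    using product_topology_open_contains_basis[of "\<lambda>_. euclidean" UNIV W \<omega>] assms(3) by auto
  have "\<exists>q. proj q \<and> \<omega> \<in> U q \<and> (\<forall>\<psi>\<in>U q \<inter> X. \<forall>i\<in>J. \<psi> i \<in> V i)" if "finite J" for J
    using that
  proof (induction J)
    case empty
    then show ?case using assms(2) by (intro exI[of _ e]) (auto simp: U_def X_character X_unit)
  next
    case (insert i J)
    then obtain q where q: "proj q" "\<omega> \<in> U q" "\<forall>\<psi>\<in>U q \<inter> X. \<forall>i\<in>J. \<psi> i \<in> V i" by blast
    have "\<omega> i \<in> V i" using V(1) by auto
    then obtain \<epsilon> where \<epsilon>: "\<epsilon> > 0" "\<And>z. dist z (\<omega> i) < \<epsilon> \<Longrightarrow> z \<in> V i"
      using V(2)[of i] unfolding open_dist by blast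
    obtain r where r: "proj r" "\<omega> \<in> U r" "\<And>\<psi>. \<psi> \<in> U r \<inter> X \<Longrightarrow> cmod (\<psi> i - \<omega> i) < \<epsilon>"
      using character_neighbourhood[OF assms(2) \<epsilon>(1)] by blast
    show ?case
      using q r U_mult[OF q(1) r(1)] \<epsilon>(2) by (intro exI[of _ "q * r"]) (auto simp: dist_norm)
  qed
  from this[OF V(3)] obtain q where q: "proj q" "\<omega> \<in> U q" "\<forall>\<psi>\<in>U q \<inter> X. \<forall>i\<in>{i. V i \<noteq> UNIV}. \<psi> i \<in> V i"
    by blast
  have "U q \<inter> X \<subseteq> PiE UNIV V" using q(3) by (auto simp: PiE_def)
  with q V(4) show ?thesis by (intro that) auto
qed

text \<open>An open set is a union of basic sets \<open>U q\<close>, possibly uncountable. The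
  projections with \<open>U q \<inter> X\<close> inside \<open>W\<close> are directed; for their
  supremum \<open>s\<close>, normality shows that \<open>U s\<close> exceeds \<open>W\<close> on
  each piece by a set of arbitrarily small trace.\<close>

lemma open_sets_N:
  assumes "open W" shows "X \<inter> W \<in> sets N"
proof -
  define A where "A = {q. proj q \<and> U q \<inter> X \<subseteq> W}"
  have dir: "directed A"
    unfolding upward_directed_def
  proof (intro conjI ballI)
    have "0 \<in> A" by (simp add: A_def)
    then show "A \<noteq> {}" by blast
    fix p q assume pq: "p \<in> A" "q \<in> A"
    then have pr: "proj p" "proj q" by (auto simp: A_def)
    have orth: "p * (q * (e - p)) = 0" using pr by (simp add: algebra_simps comm[of q p] projD)
    have prj: "proj (p + q * (e - p))" using pr orth by (intro proj_add proj_mult proj_compl) auto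
    have "U (p + q * (e - p)) \<inter> X \<subseteq> U p \<union> U q"
    proof
      fix \<omega> assume "\<omega> \<in> U (p + q * (e - p)) \<inter> X"
      then show "\<omega> \<in> U p \<union> U q"
        using character_proj_cases[OF X_character pr(1), of \<omega>] character_proj_cases[OF X_character pr(2), of \<omega>]
        by (auto simp: U_def characterD)
    qed
    then have "p + q * (e - p) \<in> A" using prj pq by (auto simp: A_def)
    moreover have "p \<sqsubseteq> p + q * (e - p)" "q \<sqsubseteq> p + q * (e - p)"
      using pr prj orth by (simp_all add: proj_le_iff algebra_simps projD comm[of q p] lcomm[of q p])
    ultimately show "\<exists>z\<in>A. p \<sqsubseteq> z \<and> q \<sqsubseteq> z" by blast
  qed
  have prA: "\<And>a. a \<in> A \<Longrightarrow> proj a" by (simp add: A_def)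
  obtain s where s: "proj s" "is_sup A s"
    using directed_supremum_proj[OF dir] prA by blast
  have ub: "a * s = a" if "a \<in> A" for a
    using s prA[OF that] that by (auto simp: is_supremum_in_def proj_le_iff)
  have "X \<inter> W \<subseteq> U s"
  proof
    fix \<omega> assume \<omega>: "\<omega> \<in> X \<inter> W"
    then obtain q where q: "proj q" "\<omega> \<in> U q" "U q \<inter> X \<subseteq> W" using U_basis[OF assms, of \<omega>] by blast
    then have "q \<in> A" by (simp add: A_def)
    then show "\<omega> \<in> U s" using U_mono[OF ub] q by blast
  qed
  moreover have "negligible_set (U s \<inter> X - X \<inter> W)"
    unfolding negligible_set_def coverable_def
  proof (intro conjI ballI allI impI)
    fix p and \<epsilon> :: ennreal assume p: "p \<in> FF" and \<epsilon>: "0 < \<epsilon>"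
    obtain a where a: "a \<in> A" "\<tau> ((s - a) * p) < \<epsilon>"
      using trace_supremum_approx[OF dir prA s(2,1) FF(1,3)[OF p] \<epsilon>] by blast
    have pr: "proj (s - a)" using s prA[OF a(1)] ub[OF a(1)] by (intro proj_diff) (auto simp: comm[of s a])
    have "(U s \<inter> X - X \<inter> W) \<inter> U p \<subseteq> U ((s - a) * p)"
    proof
      fix \<omega> assume \<omega>: "\<omega> \<in> (U s \<inter> X - X \<inter> W) \<inter> U p"
      then have "\<omega> \<notin> U a" using a(1) by (auto simp: A_def)
      then have "\<omega> a = 0" using \<omega> character_proj_cases[OF X_character prA[OF a(1)], of \<omega>]
        by (auto simp: U_def)
      then show "\<omega> \<in> U ((s - a) * p)" using \<omega> by (auto simp: U_def characterD)
    qed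
    then show "\<exists>q. proj q \<and> (U s \<inter> X - X \<inter> W) \<inter> U p \<subseteq> U q \<and> \<tau> q < \<epsilon>"
      using a(2) pr FF(1)[OF p] by blast
  qed auto
  ultimately have "represents s (X \<inter> W)"
    using s by (auto simp: represents_def Diff_eq_empty_iff[THEN iffD2])
  then show ?thesis using represents_emeasure by blast
qed

lemma evaluation_measurable: "(\<lambda>\<omega>. \<omega> x) \<in> borel_measurable N"
proof (rule borel_measurableI)
  fix S :: "complex set" assume "open S"
  then have "open ((\<lambda>\<omega>::'a \<Rightarrow> complex. \<omega> x) -` S)"
    by (intro open_vimage continuous_on_product_coordinates)
  from open_sets_N[OF this] show "(\<lambda>\<omega>. \<omega> x) -` S \<inter> space N \<in> sets N"
    by (simp add: Int_commute)
qed

section \<open>From almost everywhere statements back to the algebra\<close>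

lemma AE_imp_proj_eq_0:
  assumes "proj r" "AE \<omega> in N. \<omega> \<notin> U r" shows "r = 0"
proof (rule negligible_U_imp_0[OF assms(1)])
  obtain B where "B \<in> null_sets N" "{\<omega> \<in> space N. \<not> (\<omega> \<notin> U r)} \<subseteq> B"
    using assms(2) by (auto elim!: AE_E simp: null_sets_def)
  then show "negligible_set (U r \<inter> X)"
    by (auto simp: negligible_set_iff_null[symmetric] elim!: negligible_set_subset)
qed

text \<open>Cut \<open>y\<close> spectrally at \<open>- \<delta>\<close>. On
  \<open>U (e - q)\<close> the values of \<open>y\<close> are at most \<open>- \<delta>\<close>, so
  this set is null and \<open>q = e\<close>, that is, \<open>y + \<delta> *\<^sub>R e\<close> is
  positive; the cone is closed, so \<open>\<delta>\<close> can tend to 0.\<close>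

lemma positive_if_AE:
  assumes "star y = y" "AE \<omega> in N. 0 \<le> Re (\<omega> y)" shows "y \<in> positive_cone"
proof -
  have shifted: "y + \<delta> *\<^sub>R e \<in> positive_cone" if \<delta>: "\<delta> > 0" for \<delta>
  proof -
    obtain q where q: "proj q" "(- \<delta>) *\<^sub>R q \<sqsubseteq> y * q" "y * (e - q) \<sqsubseteq> (- \<delta>) *\<^sub>R (e - q)"
      using spectral_projection[OF assms(1)] by blast
    have "AE \<omega> in N. \<omega> \<notin> U (e - q)"
      using assms(2) AE_space
    proof eventually_elim
      fix \<omega> assume *: "0 \<le> Re (\<omega> y)" "\<omega> \<in> space N"
      show "\<omega> \<notin> U (e - q)"
      proof
        assume u: "\<omega> \<in> U (e - q)"
        then have c: "character \<omega>" by (rule U_character)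
        have "nonneg_complex (\<omega> ((- \<delta>) *\<^sub>R (e - q) - y * (e - q)))"
          using q(3) by (intro character_positive[OF c]) (simp add: cstar_le_def)
        moreover have "\<omega> ((- \<delta>) *\<^sub>R (e - q) - y * (e - q)) = of_real (- \<delta>) - \<omega> y"
          using u by (intro character_scaleR_diff_mult) (auto simp: U_def)
        ultimately show False using * \<delta> by (simp add: nonneg_complex_def)
      qed
    qed
    then have "e - q = 0" using q by (intro AE_imp_proj_eq_0) auto
    then have "q = e" by simp
    then show ?thesis using q(2) by (simp add: cstar_le_def)
  qed
  have lim: "(\<lambda>n. y + inverse (real (Suc n)) *\<^sub>R e) \<longlonglongrightarrow> y + 0 *\<^sub>R e"
    by (intro tendsto_intros LIMSEQ_inverse_real_of_nat)
  have "y + 0 *\<^sub>R e \<in> positive_cone"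
    by (rule closed_sequentially[OF closed_positive_cone _ lim]) (rule shifted, simp)
  then show ?thesis by simp
qed

text \<open>Positivity of \<open>C^2 e - star x * x\<close> can be checked at almost every
  character, and the C*-identity converts it into a norm bound. The case \<open>C = 0\<close> is
  injectivity of the Gelfand map.\<close>

lemma norm_le_if_AE:
  assumes "AE \<omega> in N. cmod (\<omega> x) \<le> C" "0 \<le> C" shows "norm x \<le> C"
proof -
  have "C\<^sup>2 *\<^sub>R e - star x * x \<in> positive_cone"
  proof (rule positive_if_AE)
    show "star (C\<^sup>2 *\<^sub>R e - star x * x) = C\<^sup>2 *\<^sub>R e - star x * x" by (simp add: star_simps)
    show "AE \<omega> in N. 0 \<le> Re (\<omega> (C\<^sup>2 *\<^sub>R e - star x * x))"
      using assms(1) AE_space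
    proof eventually_elim
      fix \<omega> assume *: "cmod (\<omega> x) \<le> C" "\<omega> \<in> space N"
      then have c: "character \<omega>" "\<omega> e = 1" by (auto simp: X_character X_unit)
      have "Re (\<omega> (C\<^sup>2 *\<^sub>R e - star x * x)) = C\<^sup>2 - ((Re (\<omega> x))\<^sup>2 + (Im (\<omega> x))\<^sup>2)"
        using c by (simp add: characterD power2_eq_square)
      also have "\<dots> = C\<^sup>2 - (cmod (\<omega> x))\<^sup>2" by (simp add: cmod_power2)
      finally have "Re (\<omega> (C\<^sup>2 *\<^sub>R e - star x * x)) = C\<^sup>2 - (cmod (\<omega> x))\<^sup>2" .
      then show "0 \<le> Re (\<omega> (C\<^sup>2 *\<^sub>R e - star x * x))"
        using * assms(2) by (simp add: power_mono)
    qed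
  qed
  then have "norm (star x * x) \<le> C\<^sup>2"
    by (intro positive_norm_le) (auto simp: cstar_le_def positive_cone_def)
  then show ?thesis using assms(2) by (simp add: cstar_identity power2_le_iff_abs_le)
qed

lemma eq_0_if_AE: "AE \<omega> in N. \<omega> x = 0 \<Longrightarrow> x = 0"
  using norm_le_if_AE[of x 0] by simp

lemma AE_rep: "E \<in> sets N \<Longrightarrow> AE \<omega> in N. \<omega> (rep E) = indicator E \<omega>"
proof -
  assume E: "E \<in> sets N"
  define q where "q = rep E"
  have r: "represents q E" using E represents_rep by (simp add: sets_N q_def)
  then have "(E - U q) \<union> (U q \<inter> X - E) \<in> null_sets N"
    by (simp add: represents_def negligible_set_iff_null)
  from AE_not_in[OF this] show "AE \<omega> in N. \<omega> (rep E) = indicator E \<omega>"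
    using AE_space
  proof eventually_elim
    fix \<omega> assume *: "\<omega> \<notin> (E - U q) \<union> (U q \<inter> X - E)" "\<omega> \<in> space N"
    have c: "character \<omega>" using * by (simp add: X_character)
    have "proj q" using r by (simp add: represents_def)
    then have "\<omega> q = 0 \<or> \<omega> q = 1" by (rule character_proj_cases[OF c])
    moreover have "\<omega> \<in> E \<longleftrightarrow> \<omega> \<in> U q" using * by auto
    then have "\<omega> \<in> E \<longleftrightarrow> \<omega> q = 1" using c by (simp add: U_def)
    ultimately show "\<omega> (rep E) = indicator E \<omega>"
      unfolding q_def[symmetric] indicator_def by auto
  qed
qed

text \<open>For a function with finitely many values the preimage is the combination of the
  projections representing its level sets. Surjectivity and the trace formula both start from this
  case.\<close>

lemma simple_element:
  fixes g :: "('a \<Rightarrow> complex) \<Rightarrow> real"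
  assumes g: "g \<in> borel_measurable N" and V: "finite V" "g ` X \<subseteq> V"
  obtains z where "star z = z" "AE \<omega> in N. \<omega> z = of_real (g \<omega>)"
    "V \<subseteq> {0..} \<Longrightarrow> z \<in> positive_cone \<and> \<tau> z = (\<integral>\<^sup>+ \<omega>. ennreal (g \<omega>) \<partial>N)"
proof -
  define E where "E v = {\<omega> \<in> space N. g \<omega> = v}" for v
  have E: "E v \<in> sets N" for v unfolding E_def using g by measurable
  have pr: "proj (rep (E v))" for v using represents_rep[of "E v"] E by (auto simp: sets_N represents_def)
  define z where "z = (\<Sum>v\<in>V. v *\<^sub>R rep (E v))"
  have gsum: "(\<Sum>v\<in>V. v * indicator (E v) \<omega>) = g \<omega>" if "\<omega> \<in> X" for \<omega>
  proof -
    have "(\<Sum>v\<in>V. v * indicator (E v) \<omega>) = (\<Sum>v\<in>V. if v = g \<omega> then v else 0)"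
      using that by (intro sum.cong) (auto simp: E_def)
    also have "\<dots> = g \<omega>" using V that by (simp add: image_subset_iff)
    finally show ?thesis .
  qed
  show ?thesis
  proof
    show "star z = z"
      unfolding z_def using V(1)
      by (induction V) (auto simp: star_simps projD pr)
    have "AE \<omega> in N. \<forall>v\<in>V. \<omega> (rep (E v)) = indicator (E v) \<omega>"
      using V(1) AE_rep E by (intro AE_finite_allI) auto
    then show "AE \<omega> in N. \<omega> z = of_real (g \<omega>)"
      using AE_space
    proof eventually_elim
      fix \<omega> assume *: "\<forall>v\<in>V. \<omega> (rep (E v)) = indicator (E v) \<omega>" "\<omega> \<in> space N"
      then have c: "character \<omega>" by (auto simp: X_character)
      have "\<omega> z = (\<Sum>v\<in>V. of_real v * indicator (E v) \<omega>)"
        using * by (simp add: z_def character_sum[OF c] characterD[OF c])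
      also have "\<dots> = of_real (\<Sum>v\<in>V. v * indicator (E v) \<omega>)"
        by (auto simp: indicator_def intro!: sum.cong)
      also have "(\<Sum>v\<in>V. v * indicator (E v) \<omega>) = g \<omega>" using * by (intro gsum) simp
      finally show "\<omega> z = of_real (g \<omega>)" .
    qed
    assume nn: "V \<subseteq> {0..}"
    have zp: "z \<in> positive_cone" unfolding z_def using nn pr by (intro positive_sum positive_scaleR) auto
    have "\<tau> z = (\<Sum>v\<in>V. ennreal v * emeasure N (E v))"
      unfolding z_def using nn pr
      by (subst trace_sum) (auto simp: trace_scaleR emeasure_N E subset_iff intro!: positive_scaleR sum.cong)
    also have "\<dots> = (\<integral>\<^sup>+ \<omega>. (\<Sum>v\<in>V. ennreal v * indicator (E v) \<omega>) \<partial>N)"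
      using E by (subst nn_integral_sum) (auto simp: nn_integral_cmult_indicator)
    also have "\<dots> = (\<integral>\<^sup>+ \<omega>. ennreal (g \<omega>) \<partial>N)"
    proof (rule nn_integral_cong)
      fix \<omega> assume "\<omega> \<in> space N"
      then have "ennreal (g \<omega>) = ennreal (\<Sum>v\<in>V. v * indicator (E v) \<omega>)" using gsum by simp
      also have "\<dots> = (\<Sum>v\<in>V. ennreal (v * indicator (E v) \<omega>))"
        using nn by (intro sum_ennreal[symmetric]) auto
      also have "\<dots> = (\<Sum>v\<in>V. ennreal v * indicator (E v) \<omega>)"
        by (intro sum.cong) (auto split: split_indicator)
      finally show "(\<Sum>v\<in>V. ennreal v * indicator (E v) \<omega>) = ennreal (g \<omega>)" by simp
    qed
    finally show "z \<in> positive_cone \<and> \<tau> z = (\<integral>\<^sup>+ \<omega>. ennreal (g \<omega>) \<partial>N)" using zp by simp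
  qed
qed

end

section \<open>Rounding down to a dyadic grid\<close>

definition dyadic :: "nat \<Rightarrow> real \<Rightarrow> real" where
  "dyadic n t = of_int \<lfloor>2 ^ n * t\<rfloor> / 2 ^ n"

lemma dyadic_le: "dyadic n t \<le> t" and dyadic_ge: "t - 1 / 2 ^ n \<le> dyadic n t"
proof -
  have *: "of_int \<lfloor>2 ^ n * t\<rfloor> \<le> 2 ^ n * t" "2 ^ n * t - 1 \<le> of_int \<lfloor>2 ^ n * t\<rfloor>" by linarith+
  from * show "dyadic n t \<le> t" by (simp add: dyadic_def divide_le_eq mult.commute)
  from *(2) have "(2 ^ n * t - 1) / 2 ^ n \<le> dyadic n t" unfolding dyadic_def by (intro divide_right_mono) auto
  then show "t - 1 / 2 ^ n \<le> dyadic n t" by (simp add: diff_divide_distrib)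
qed

text \<open>The grid of mesh \<open>1 / 2 ^ Suc n\<close> contains that of mesh
  \<open>1 / 2 ^ n\<close>; this nesting is what makes the lower approximations increase.\<close>

lemma dyadic_mono: "dyadic n t \<le> dyadic (Suc n) t"
proof -
  have "2 * \<lfloor>2 ^ n * t\<rfloor> \<le> \<lfloor>2 ^ Suc n * t\<rfloor>" by (simp add: le_floor_iff)
  then have "2 * real_of_int \<lfloor>2 ^ n * t\<rfloor> \<le> of_int \<lfloor>2 ^ Suc n * t\<rfloor>" by linarith
  then show ?thesis by (simp add: dyadic_def field_simps)
qed

lemma dyadic_nonneg: "0 \<le> t \<Longrightarrow> 0 \<le> dyadic n t"
  by (simp add: dyadic_def)

lemma dyadic_tendsto: "(\<lambda>n. dyadic n t) \<longlonglongrightarrow> t"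
proof (rule tendsto_sandwich)
  have "(\<lambda>n. t - (1 / 2) ^ n) \<longlonglongrightarrow> t - 0" by (intro tendsto_intros LIMSEQ_power_zero) auto
  then show "(\<lambda>n. t - 1 / 2 ^ n) \<longlonglongrightarrow> t" by (simp add: power_one_over)
qed (use dyadic_le dyadic_ge in auto)

lemma dyadic_finite_range: "finite (dyadic n ` {a..b})"
proof -
  have "dyadic n ` {a..b} \<subseteq> (\<lambda>k. of_int k / 2 ^ n) ` {\<lfloor>2 ^ n * a\<rfloor>..\<lfloor>2 ^ n * b\<rfloor>}"
    by (auto simp: dyadic_def intro!: imageI floor_mono)
  then show ?thesis by (rule finite_subset) auto
qed

lemma dyadic_measurable [measurable]: "dyadic n \<in> borel_measurable borel"
  unfolding dyadic_def[abs_def] by measurable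

section \<open>The isomorphism with $L^\infty$\<close>

lemma equiv_ae_rel: "equiv (ess_bounded M) (ae_rel M)"
proof (rule equivI)
  show "ae_rel M \<subseteq> ess_bounded M \<times> ess_bounded M" by (auto simp: ae_rel_def)
  show "refl_on (ess_bounded M) (ae_rel M)" by (auto simp: refl_on_def ae_rel_def)
  show "sym (ae_rel M)" by (auto simp: sym_def ae_rel_def)
  show "trans (ae_rel M)"
  proof (rule transI)
    fix f g h assume "(f, g) \<in> ae_rel M" "(g, h) \<in> ae_rel M"
    then have "AE w in M. f w = g w" "AE w in M. g w = h w" "f \<in> ess_bounded M" "h \<in> ess_bounded M"
      by (auto simp: ae_rel_def)
    then show "(f, h) \<in> ae_rel M" by (auto simp: ae_rel_def)
  qed
qed

lemma ess_bounded_add: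
  assumes "f \<in> ess_bounded M" "g \<in> ess_bounded M" shows "(\<lambda>w. f w + g w) \<in> ess_bounded M"
proof -
  obtain C D where "AE w in M. cmod (f w) \<le> C" "AE w in M. cmod (g w) \<le> D"
    using assms by (auto simp: ess_bounded_def)
  then have "AE w in M. cmod (f w + g w) \<le> C + D"
    by eventually_elim (rule order_trans[OF norm_triangle_ineq add_mono])
  then show ?thesis using assms by (auto simp: ess_bounded_def)
qed

lemma ess_bounded_mult:
  assumes "f \<in> ess_bounded M" "g \<in> ess_bounded M" shows "(\<lambda>w. f w * g w) \<in> ess_bounded M"
proof -
  obtain C D where "AE w in M. cmod (f w) \<le> C" "AE w in M. cmod (g w) \<le> D"
    using assms by (auto simp: ess_bounded_def)
  then have "AE w in M. cmod (f w * g w) \<le> C * D"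
    by eventually_elim (auto simp: norm_mult intro!: mult_mono intro: order_trans[OF norm_ge_zero])
  then show ?thesis using assms by (auto simp: ess_bounded_def)
qed

lemma ess_bounded_const: "(\<lambda>w. c) \<in> ess_bounded M"
  by (auto simp: ess_bounded_def intro!: exI[of _ "cmod c"])

lemma ess_bounded_cnj: "f \<in> ess_bounded M \<Longrightarrow> (\<lambda>w. cnj (f w)) \<in> ess_bounded M"
  by (auto simp: ess_bounded_def intro: borel_measurable_continuous_on[OF continuous_on_cnj[OF continuous_on_id]])

definition ae_class :: "'x measure \<Rightarrow> ('x \<Rightarrow> complex) \<Rightarrow> ('x \<Rightarrow> complex) set" where
  "ae_class M f = ae_rel M `` {f}"

lemma ae_class_eq_iff:
  assumes "f \<in> ess_bounded M" "g \<in> ess_bounded M"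
  shows "ae_class M f = ae_class M g \<longleftrightarrow> (AE w in M. f w = g w)"
  using eq_equiv_class_iff[OF equiv_ae_rel assms] assms by (simp add: ae_class_def ae_rel_def)

lemma ae_class_in_Linf: "f \<in> ess_bounded M \<Longrightarrow> ae_class M f \<in> Linf M"
  by (auto simp: ae_class_def Linf_def quotient_def)

lemma Linf_ae_class: "F \<in> Linf M \<Longrightarrow> \<exists>f\<in>ess_bounded M. F = ae_class M f"
  by (auto simp: ae_class_def Linf_def quotient_def)

lemma mem_ae_class: "f \<in> ess_bounded M \<Longrightarrow> f' \<in> ae_class M f \<longleftrightarrow> f' \<in> ess_bounded M \<and> (AE w in M. f w = f' w)"
  by (auto simp: ae_class_def ae_rel_def)

text \<open>Independence of representatives makes all members of the union equal, so the lifted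
  operation collapses to a single class.\<close>

lemma UN_ae_class_binary:
  assumes f: "f \<in> ess_bounded M" and g: "g \<in> ess_bounded M"
    and op: "\<And>f g. f \<in> ess_bounded M \<Longrightarrow> g \<in> ess_bounded M \<Longrightarrow> (\<lambda>w. op (f w) (g w)) \<in> ess_bounded M"
  shows "(\<Union>f'\<in>ae_class M f. \<Union>g'\<in>ae_class M g. ae_rel M `` {\<lambda>w. op (f' w) (g' w)}) =
    ae_class M (\<lambda>w. op (f w) (g w))"
proof -
  have "ae_rel M `` {\<lambda>w. op (f' w) (g' w)} = ae_class M (\<lambda>w. op (f w) (g w))"
    if "f' \<in> ae_class M f" "g' \<in> ae_class M g" for f' g'
  proof -
    have *: "f' \<in> ess_bounded M" "g' \<in> ess_bounded M" "AE w in M. f w = f' w" "AE w in M. g w = g' w"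
      using that f g by (auto simp: mem_ae_class)
    from *(3,4) have "AE w in M. op (f' w) (g' w) = op (f w) (g w)" by eventually_elim simp
    then have "ae_class M (\<lambda>w. op (f' w) (g' w)) = ae_class M (\<lambda>w. op (f w) (g w))"
      using * f g op by (subst ae_class_eq_iff) auto
    then show ?thesis by (simp add: ae_class_def)
  qed
  moreover have "f \<in> ae_class M f" "g \<in> ae_class M g" using f g by (auto simp: mem_ae_class)
  ultimately show ?thesis by blast
qed

lemma
  assumes "f \<in> ess_bounded M" "g \<in> ess_bounded M"
  shows Linf_add_ae_class: "Linf_add M (ae_class M f) (ae_class M g) = ae_class M (\<lambda>w. f w + g w)"
    and Linf_mult_ae_class: "Linf_mult M (ae_class M f) (ae_class M g) = ae_class M (\<lambda>w. f w * g w)"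
  unfolding Linf_add_def Linf_mult_def
  by (rule UN_ae_class_binary[OF assms]; rule ess_bounded_add ess_bounded_mult; assumption)+

lemma
  assumes f: "f \<in> ess_bounded M"
  shows Linf_scale_ae_class: "Linf_scale M c (ae_class M f) = ae_class M (\<lambda>w. c * f w)"
    and Linf_star_ae_class: "Linf_star M (ae_class M f) = ae_class M (\<lambda>w. cnj (f w))"
proof -
  have "f \<in> ae_class M f" using f by (simp add: mem_ae_class)
  then have ne: "ae_class M f \<noteq> {}" by blast
  \<comment> \<open>A unary operation is treated as a binary one that ignores its second argument;
    the union over that argument is harmless because the class is nonempty.\<close>
  have "(\<Union>f'\<in>ae_class M f. ae_rel M `` {\<lambda>w. c * f' w}) =
      (\<Union>f'\<in>ae_class M f. \<Union>g'\<in>ae_class M f. ae_rel M `` {\<lambda>w. c * f' w})" using ne by blast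
  also have "\<dots> = ae_class M (\<lambda>w. c * f w)"
    by (rule UN_ae_class_binary[OF f f, of "\<lambda>x y. c * x"]) (intro ess_bounded_mult ess_bounded_const)
  finally show "Linf_scale M c (ae_class M f) = ae_class M (\<lambda>w. c * f w)" by (simp add: Linf_scale_def)
  have "(\<Union>f'\<in>ae_class M f. ae_rel M `` {\<lambda>w. cnj (f' w)}) =
      (\<Union>f'\<in>ae_class M f. \<Union>g'\<in>ae_class M f. ae_rel M `` {\<lambda>w. cnj (f' w)})" using ne by blast
  also have "\<dots> = ae_class M (\<lambda>w. cnj (f w))"
    by (rule UN_ae_class_binary[OF f f, of "\<lambda>x y. cnj x"]) (rule ess_bounded_cnj)
  finally show "Linf_star M (ae_class M f) = ae_class M (\<lambda>w. cnj (f w))" by (simp add: Linf_star_def)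
qed

text \<open>An injective multiplicative map pulls commutativity back from the pointwise product. The
  properties of the measure space do not enter, so one lemma serves all implications back to
  (1).\<close>

lemma star_iso_Linf_commutative:
  fixes I :: "'a::cstar_algebra \<Rightarrow> ('x \<Rightarrow> complex) set" and x y :: 'a
  assumes "star_iso_Linf I M" shows "x * y = y * x"
proof -
  have I: "inj I" "\<And>x. I x \<in> Linf M" "\<And>x y. I (x * y) = Linf_mult M (I x) (I y)"
    using assms by (auto simp: star_iso_Linf_def bij_betw_def)
  obtain f g where fg: "f \<in> ess_bounded M" "g \<in> ess_bounded M" "I x = ae_class M f" "I y = ae_class M g"
    using Linf_ae_class[OF I(2)] by metis
  have "I (x * y) = I (y * x)" using fg by (simp add: I(3) Linf_mult_ae_class mult.commute)
  with I(1) show ?thesis by (rule injD)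
qed

section \<open>The Gelfand transform and the integral formula\<close>

context traced_abelian_wstar
begin

lemma evaluation_ess_bounded: "(\<lambda>\<omega>. \<omega> x) \<in> ess_bounded N"
  unfolding ess_bounded_def
  using evaluation_measurable character_norm_le[OF X_character]
  by (auto intro!: exI[of _ "norm x"] AE_I2)

text \<open>The elements attached to the dyadic roundings are uniformly close almost everywhere, so
  by \<open>norm_le_if_AE\<close> they form a norm Cauchy sequence. Characters are contractive, so
  the limit has the right value at almost every point.\<close>

lemma real_representative:
  fixes g :: "('a \<Rightarrow> complex) \<Rightarrow> real"
  assumes g: "g \<in> borel_measurable N" and C: "\<And>\<omega>. \<bar>g \<omega>\<bar> \<le> C"
  shows "\<exists>x. AE \<omega> in N. \<omega> x = of_real (g \<omega>)"
proof -
  have "\<exists>z. AE \<omega> in N. \<omega> z = of_real (dyadic n (g \<omega>))" for n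
  proof -
    have m: "(\<lambda>\<omega>. dyadic n (g \<omega>)) \<in> borel_measurable N" using g by measurable
    have r: "(\<lambda>\<omega>. dyadic n (g \<omega>)) ` X \<subseteq> dyadic n ` {- C..C}" using C by (force simp: abs_le_iff)
    show ?thesis
    proof (rule simple_element[OF m dyadic_finite_range r])
      fix z assume "AE \<omega> in N. \<omega> z = of_real (dyadic n (g \<omega>))"
      then show ?thesis by blast
    qed
  qed
  then obtain z where z: "\<And>n. AE \<omega> in N. \<omega> (z n) = of_real (dyadic n (g \<omega>))" by metis
  have dist: "norm (z m - z n) \<le> 1 / 2 ^ k" if "k \<le> m" "k \<le> n" for k m n
  proof (rule norm_le_if_AE)
    show "AE \<omega> in N. cmod (\<omega> (z m - z n)) \<le> 1 / 2 ^ k"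
      using z[of m] z[of n] AE_space
    proof eventually_elim
      fix \<omega> assume *: "\<omega> (z m) = of_real (dyadic m (g \<omega>))" "\<omega> (z n) = of_real (dyadic n (g \<omega>))" "\<omega> \<in> space N"
      then have "\<omega> (z m - z n) = of_real (dyadic m (g \<omega>) - dyadic n (g \<omega>))"
        by (simp add: characterD X_character)
      moreover have "1 / 2 ^ m \<le> (1 / 2 ^ k :: real)" "1 / 2 ^ n \<le> (1 / 2 ^ k :: real)"
        using that by (auto intro!: divide_left_mono power_increasing)
      then have "\<bar>dyadic m (g \<omega>) - dyadic n (g \<omega>)\<bar> \<le> 1 / 2 ^ k"
        using dyadic_le[of m "g \<omega>"] dyadic_le[of n "g \<omega>"] dyadic_ge[of "g \<omega>" m] dyadic_ge[of "g \<omega>" n] by linarith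
      ultimately show "cmod (\<omega> (z m - z n)) \<le> 1 / 2 ^ k" by (simp only: norm_of_real)
    qed
  qed simp
  have "Cauchy z"
  proof (rule metric_CauchyI)
    fix \<epsilon> :: real assume "0 < \<epsilon>"
    then obtain k where "(1 / 2) ^ k < \<epsilon>" using real_arch_pow_inv[of \<epsilon> "1 / 2"] by auto
    then have "1 / 2 ^ k < \<epsilon>" by (simp add: power_one_over)
    then show "\<exists>M. \<forall>m\<ge>M. \<forall>n\<ge>M. dist (z m) (z n) < \<epsilon>"
      using dist[of k] by (intro exI[of _ k]) (auto simp: dist_norm intro: order_le_less_trans)
  qed
  then obtain x where x: "z \<longlonglongrightarrow> x" using Cauchy_convergent_iff convergent_def by blast
  have "AE \<omega> in N. \<forall>n. \<omega> (z n) = of_real (dyadic n (g \<omega>))" using z by (simp add: AE_all_countable)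
  then have "AE \<omega> in N. \<omega> x = of_real (g \<omega>)"
    using AE_space
  proof eventually_elim
    fix \<omega> assume *: "\<forall>n. \<omega> (z n) = of_real (dyadic n (g \<omega>))" "\<omega> \<in> space N"
    then have c: "character \<omega>" by (simp add: X_character)
    have "(\<lambda>n. \<omega> (z n) - \<omega> x) \<longlonglongrightarrow> 0"
    proof (rule Lim_null_comparison)
      show "\<forall>\<^sub>F n in sequentially. norm (\<omega> (z n) - \<omega> x) \<le> norm (z n - x)"
        using character_norm_le[OF c, of "z _ - x"] by (simp add: characterD[OF c])
      show "(\<lambda>n. norm (z n - x)) \<longlonglongrightarrow> 0"
        using x by (simp add: tendsto_norm_zero_iff LIM_zero_iff)
    qed
    then have "(\<lambda>n. \<omega> (z n)) \<longlonglongrightarrow> \<omega> x" by (simp add: LIM_zero_iff)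
    moreover have "(\<lambda>n. \<omega> (z n)) \<longlonglongrightarrow> of_real (g \<omega>)"
      unfolding *(1)[rule_format] by (intro tendsto_of_real dyadic_tendsto)
    ultimately show "\<omega> x = of_real (g \<omega>)" by (rule LIMSEQ_unique)
  qed
  then show ?thesis by blast
qed

lemma ess_bounded_representative:
  assumes "f \<in> ess_bounded N"
  shows "\<exists>x. AE \<omega> in N. \<omega> x = f \<omega>"
proof -
  obtain C where C: "AE \<omega> in N. cmod (f \<omega>) \<le> C" and f: "f \<in> borel_measurable N"
    using assms by (auto simp: ess_bounded_def)
  \<comment> \<open>Truncation turns the almost everywhere bound into an everywhere bound, as
    \<open>real_representative\<close> asks.\<close>
  define g where "g \<omega> = (if cmod (f \<omega>) \<le> C then f \<omega> else 0)" for \<omega>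
  have gm: "g \<in> borel_measurable N" unfolding g_def using f by measurable
  have gC: "cmod (g \<omega>) \<le> \<bar>C\<bar>" for \<omega> by (auto simp: g_def)
  have re: "\<bar>Re (g \<omega>)\<bar> \<le> \<bar>C\<bar>" and im: "\<bar>Im (g \<omega>)\<bar> \<le> \<bar>C\<bar>" for \<omega>
    using gC[of \<omega>] abs_Re_le_cmod[of "g \<omega>"] abs_Im_le_cmod[of "g \<omega>"] by linarith+
  obtain x where x: "AE \<omega> in N. \<omega> x = of_real (Re (g \<omega>))"
    using real_representative[of "\<lambda>\<omega>. Re (g \<omega>)", OF _ re] gm by auto
  obtain y where y: "AE \<omega> in N. \<omega> y = of_real (Im (g \<omega>))"
    using real_representative[of "\<lambda>\<omega>. Im (g \<omega>)", OF _ im] gm by auto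
  have "AE \<omega> in N. \<omega> (x + \<i> *\<^sub>C y) = f \<omega>"
    using x y C AE_space
  proof eventually_elim
    case (elim \<omega>)
    then have "\<omega> (x + \<i> *\<^sub>C y) = g \<omega>"
      by (simp add: characterD[OF X_character] complex_eq_iff)
    then show ?case using elim by (simp add: g_def)
  qed
  then show ?thesis by blast
qed

definition gelfand :: "'a \<Rightarrow> (('a \<Rightarrow> complex) \<Rightarrow> complex) set" where
  "gelfand x = ae_class N (\<lambda>\<omega>. \<omega> x)"

lemma star_iso_gelfand: "star_iso_Linf gelfand N"
proof -
  \<comment> \<open>The pointwise algebraic identities hold only on \<open>X\<close>; a point
    outside it need not be a character. Changing a function off the space does not change its
    class.\<close>
  have eq: "ae_class N f = ae_class N g"
    if f: "f \<in> ess_bounded N" and fg: "\<And>\<omega>. \<omega> \<in> X \<Longrightarrow> f \<omega> = g \<omega>" for f g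
  proof -
    obtain C where "AE w in N. cmod (f w) \<le> C" using f by (auto simp: ess_bounded_def)
    then have "AE w in N. cmod (g w) \<le> C" using AE_space by eventually_elim (simp add: fg)
    moreover have "g \<in> borel_measurable N"
      using f fg measurable_cong[of N f g borel] by (auto simp: ess_bounded_def)
    ultimately have "g \<in> ess_bounded N" by (auto simp: ess_bounded_def)
    then show ?thesis using f fg by (subst ae_class_eq_iff) (auto intro!: AE_I2)
  qed
  note eb = evaluation_ess_bounded
  show ?thesis
    unfolding star_iso_Linf_def
  proof (intro conjI allI)
    show "bij_betw gelfand UNIV (Linf N)"
      unfolding bij_betw_def
    proof (intro conjI injI subset_antisym subsetI)
      fix x y assume "gelfand x = gelfand y"
      then have "AE \<omega> in N. \<omega> x = \<omega> y" by (simp add: gelfand_def ae_class_eq_iff eb)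
      then have "AE \<omega> in N. \<omega> (x - y) = 0"
        using AE_space by eventually_elim (simp add: characterD[OF X_character])
      then show "x = y" using eq_0_if_AE[of "x - y"] by simp
    next
      fix F assume "F \<in> range gelfand"
      then show "F \<in> Linf N" by (auto simp: gelfand_def intro: ae_class_in_Linf eb)
    next
      fix F assume "F \<in> Linf N"
      then obtain f where f: "f \<in> ess_bounded N" "F = ae_class N f" using Linf_ae_class by blast
      obtain x where "AE \<omega> in N. \<omega> x = f \<omega>" using ess_bounded_representative f(1) by blast
      then have "gelfand x = F" using f by (simp add: gelfand_def ae_class_eq_iff eb)
      then show "F \<in> range gelfand" by blast
    qed
    show "gelfand (x + y) = Linf_add N (gelfand x) (gelfand y)" for x y
      unfolding gelfand_def Linf_add_ae_class[OF eb eb]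
      by (rule eq[OF eb]) (simp add: characterD X_character)
    show "gelfand (x * y) = Linf_mult N (gelfand x) (gelfand y)" for x y
      unfolding gelfand_def Linf_mult_ae_class[OF eb eb]
      by (rule eq[OF eb]) (simp add: characterD X_character)
    show "gelfand (c *\<^sub>C x) = Linf_scale N c (gelfand x)" for c x
      unfolding gelfand_def Linf_scale_ae_class[OF eb]
      by (rule eq[OF eb]) (simp add: characterD X_character)
    show "gelfand (star x) = Linf_star N (gelfand x)" for x
      unfolding gelfand_def Linf_star_ae_class[OF eb]
      by (rule eq[OF eb]) (simp add: characterD X_character)
  qed
qed

text \<open>The dyadic lower approximations of a positive element increase to it, so normality of the
  trace meets monotone convergence.\<close>

lemma trace_eq_integral:
  assumes x: "x \<in> positive_cone"
  shows "\<tau> x = (\<integral>\<^sup>+ \<omega>. ennreal (Re (\<omega> x)) \<partial>N)"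
proof -
  define g where "g \<omega> = Re (\<omega> x)" for \<omega> :: "'a \<Rightarrow> complex"
  have gm: "g \<in> borel_measurable N" unfolding g_def using evaluation_measurable by measurable
  have g: "\<omega> x = of_real (g \<omega>)" "0 \<le> g \<omega>" "g \<omega> \<le> norm x" if "\<omega> \<in> X" for \<omega>
    using character_positive[OF X_character[OF that] x] complex_Re_le_cmod[of "\<omega> x"]
      character_norm_le[OF X_character[OF that], of x]
    by (auto simp: g_def nonneg_complex_def complex_eq_iff)
  have "\<exists>z. star z = z \<and> (AE \<omega> in N. \<omega> z = of_real (dyadic n (g \<omega>))) \<and>
      z \<in> positive_cone \<and> \<tau> z = (\<integral>\<^sup>+ \<omega>. ennreal (dyadic n (g \<omega>)) \<partial>N)" for n
  proof -
    have m: "(\<lambda>\<omega>. dyadic n (g \<omega>)) \<in> borel_measurable N" using gm by measurable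
    have r: "(\<lambda>\<omega>. dyadic n (g \<omega>)) ` X \<subseteq> dyadic n ` {0..norm x}" using g by force
    show ?thesis
    proof (rule simple_element[OF m dyadic_finite_range r])
      fix z assume z: "star z = z" "AE \<omega> in N. \<omega> z = of_real (dyadic n (g \<omega>))"
        and nn: "dyadic n ` {0..norm x} \<subseteq> {0..} \<Longrightarrow>
          z \<in> positive_cone \<and> \<tau> z = (\<integral>\<^sup>+ \<omega>. ennreal (dyadic n (g \<omega>)) \<partial>N)"
      have "dyadic n ` {0..norm x} \<subseteq> {0..}" by (auto simp: dyadic_nonneg)
      with z nn show ?thesis by blast
    qed
  qed
  then have "\<exists>z. \<forall>n. star (z n) = z n \<and> (AE \<omega> in N. \<omega> (z n) = of_real (dyadic n (g \<omega>))) \<and>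
      z n \<in> positive_cone \<and> \<tau> (z n) = (\<integral>\<^sup>+ \<omega>. ennreal (dyadic n (g \<omega>)) \<partial>N)" by (intro choice allI)
  then obtain z where zz: "\<forall>n. star (z n) = z n \<and> (AE \<omega> in N. \<omega> (z n) = of_real (dyadic n (g \<omega>))) \<and>
      z n \<in> positive_cone \<and> \<tau> (z n) = (\<integral>\<^sup>+ \<omega>. ennreal (dyadic n (g \<omega>)) \<partial>N)" by (elim exE)
  have z: "star (z n) = z n" "AE \<omega> in N. \<omega> (z n) = of_real (dyadic n (g \<omega>))"
    "z n \<in> positive_cone" "\<tau> (z n) = (\<integral>\<^sup>+ \<omega>. ennreal (dyadic n (g \<omega>)) \<partial>N)" for n
    using zz by auto
  have step: "z n \<sqsubseteq> z (Suc n)" for n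
    unfolding cstar_le_def
  proof (rule positive_if_AE)
    show "AE \<omega> in N. 0 \<le> Re (\<omega> (z (Suc n) - z n))"
      using z(2)[of n] z(2)[of "Suc n"] AE_space
      by eventually_elim (simp add: characterD[OF X_character] dyadic_mono)
  qed (simp add: star_simps z)
  have mono: "z m \<sqsubseteq> z n" if "m \<le> n" for m n
    using that
  proof (induction rule: dec_induct)
    case (step k)
    with \<open>\<And>n. z n \<sqsubseteq> z (Suc n)\<close> show ?case by (blast intro: cstar_le_trans)
  qed simp
  have "directed (range z)"
    unfolding upward_directed_def
  proof (intro conjI ballI)
    fix a b assume "a \<in> range z" "b \<in> range z"
    then obtain m n where "a = z m" "b = z n" by auto
    then show "\<exists>c\<in>range z. a \<sqsubseteq> c \<and> b \<sqsubseteq> c"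
      by (intro bexI[of _ "z (max m n)"]) (auto intro: mono)
  qed auto
  moreover have "is_sup (range z) x"
    unfolding is_supremum_in_def
  proof (intro conjI ballI impI)
    show "x \<in> selfadjoint_part" using x by (simp add: selfadjoint_part_def positive_selfadjoint)
    fix a assume "a \<in> range z"
    then obtain n where a: "a = z n" by auto
    show "a \<sqsubseteq> x" unfolding cstar_le_def
    proof (rule positive_if_AE)
      show "AE \<omega> in N. 0 \<le> Re (\<omega> (x - a))"
        using z(2)[of n] AE_space
        by eventually_elim (simp add: characterD[OF X_character] a dyadic_le flip: g_def)
    qed (simp add: star_simps z a positive_selfadjoint x)
  next
    \<comment> \<open>The order is tested at almost every character: there an upper bound dominates
      all dyadic values of \<open>g \<omega>\<close> and hence their limit. The countably many
      exceptional null sets are discarded together.\<close>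
    fix u assume u: "u \<in> selfadjoint_part" "\<forall>a\<in>range z. a \<sqsubseteq> u"
    show "x \<sqsubseteq> u" unfolding cstar_le_def
    proof (rule positive_if_AE)
      have "AE \<omega> in N. \<forall>n. \<omega> (z n) = of_real (dyadic n (g \<omega>))" using z(2) by (simp add: AE_all_countable)
      then show "AE \<omega> in N. 0 \<le> Re (\<omega> (u - x))"
        using AE_space
      proof eventually_elim
        fix \<omega> assume *: "\<forall>n. \<omega> (z n) = of_real (dyadic n (g \<omega>))" "\<omega> \<in> space N"
        then have c: "character \<omega>" by (simp add: X_character)
        have "dyadic n (g \<omega>) \<le> Re (\<omega> u)" for n
        proof -
          have "u - z n \<in> positive_cone" using u(2) by (simp add: cstar_le_def)
          then show ?thesis using character_positive[OF c, of "u - z n"] *(1)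
            by (simp add: nonneg_complex_def characterD[OF c])
        qed
        then have "g \<omega> \<le> Re (\<omega> u)" by (intro LIMSEQ_le_const2[OF dyadic_tendsto]) blast
        then show "0 \<le> Re (\<omega> (u - x))" by (simp add: characterD[OF c] g_def)
      qed
    qed (use u x in \<open>simp add: star_simps selfadjoint_part_def positive_selfadjoint\<close>)
  qed
  ultimately have "\<tau> x = (SUP a\<in>range z. \<tau> a)" using z(3) by (intro trace_normal) auto
  also have "\<dots> = (SUP n. \<integral>\<^sup>+ \<omega>. ennreal (dyadic n (g \<omega>)) \<partial>N)" by (simp add: image_image z(4))
  also have "\<dots> = (\<integral>\<^sup>+ \<omega>. (SUP n. ennreal (dyadic n (g \<omega>))) \<partial>N)"
    using gm by (intro nn_integral_monotone_convergence_SUP[symmetric])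
      (auto simp: incseq_Suc_iff le_fun_def intro!: ennreal_leI dyadic_mono)
  also have "\<dots> = (\<integral>\<^sup>+ \<omega>. ennreal (g \<omega>) \<partial>N)"
  proof (rule nn_integral_cong)
    fix \<omega>
    have "(\<lambda>n. ennreal (dyadic n (g \<omega>))) \<longlonglongrightarrow> (SUP n. ennreal (dyadic n (g \<omega>)))"
      by (intro LIMSEQ_SUP incseq_SucI ennreal_leI dyadic_mono)
    moreover have "(\<lambda>n. ennreal (dyadic n (g \<omega>))) \<longlonglongrightarrow> ennreal (g \<omega>)"
      by (intro tendsto_ennrealI dyadic_tendsto)
    ultimately show "(SUP n. ennreal (dyadic n (g \<omega>))) = ennreal (g \<omega>)" by (rule LIMSEQ_unique)
  qed
  finally show ?thesis by (simp add: g_def)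
qed

lemma trace_is_integral_gelfand: "trace_is_integral \<tau> gelfand N"
  unfolding trace_is_integral_def
proof (intro ballI)
  fix x f assume x: "x \<in> positive_cone" and "f \<in> gelfand x"
  then have "AE \<omega> in N. \<omega> x = f \<omega>"
    by (simp add: gelfand_def mem_ae_class evaluation_ess_bounded)
  then have "(\<integral>\<^sup>+ \<omega>. ennreal (Re (f \<omega>)) \<partial>N) = (\<integral>\<^sup>+ \<omega>. ennreal (Re (\<omega> x)) \<partial>N)"
    by (intro nn_integral_cong_AE) auto
  then show "\<tau> x = (\<integral>\<^sup>+ \<omega>. ennreal (Re (f \<omega>)) \<partial>N)" using trace_eq_integral[OF x] by simp
qed

end

section \<open>Decomposability and the Radon property\<close>

context traced_abelian_wstar
begin

text \<open>The local projections \<open>q p\<close> have to be glued, and there may be uncountably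
  many. Their join is obtained as \<open>s = e - n\<close> with \<open>n\<close> their annihilator:
  \<open>p - q p\<close> kills every \<open>q r\<close>, so it lies below \<open>n\<close>, which
  gives \<open>p * s = q p\<close>.\<close>

lemma sets_N_locally:
  assumes "E \<subseteq> X" and E: "\<And>p. p \<in> FF \<Longrightarrow> E \<inter> U p \<in> sets N"
  shows "E \<in> sets N"
proof -
  define q where "q p = rep (E \<inter> U p)" for p
  have q: "represents (q p) (E \<inter> U p)" if "p \<in> FF" for p
    using represents_rep[of "E \<inter> U p"] E[OF that] by (simp add: q_def sets_N)
  have pq: "proj (q p)" if "p \<in> FF" for p using q[OF that] by (simp add: represents_def)
  have qp: "q p * p = q p" if "p \<in> FF" for p
  proof (rule represents_unique)
    show "represents (q p * p) (E \<inter> U p)"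
      using represents_Int_U[OF q[OF that] FF(1)[OF that]] by (simp add: Int_assoc)
  qed (rule q[OF that])
  define n where "n = annihilator (q ` FF)"
  have n: "proj n" and nq: "\<And>p. p \<in> FF \<Longrightarrow> n * q p = 0"
    using annihilator(1)[of "q ` FF"] annihilator(2)[of _ "q ` FF"] by (auto simp: n_def)
  define s where "s = e - n"
  have s: "proj s" using n by (auto simp: s_def)
  have ps: "p * s = q p" if p: "p \<in> FF" for p
  proof -
    have "(p - q p) * n = p - q p"
      unfolding n_def
    proof (rule annihilator(3))
      show "p - q p \<in> positive_cone"
        by (rule proj_positive, rule proj_diff) (use FF(1) pq qp p comm[of p "q p"] in auto)
      fix b assume "b \<in> q ` FF"
      then obtain r where r: "r \<in> FF" "b = q r" by auto
      show "(p - q p) * b = 0"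
      proof (cases "r = p")
        case True
        then show ?thesis using r pq qp p comm[of p "q p"] by (simp add: left_diff_distrib projD)
      next
        case False
        have "p * q r = (p * r) * q r" using qp[OF r(1)] comm[of r "q r"] by (simp add: mult.assoc)
        then have pr: "p * q r = 0" using FF(4)[OF p r(1)] False by simp
        have "q p * q r = q p * (p * q r)" using qp[OF p] by (simp flip: mult.assoc)
        then show ?thesis using pr r by (simp add: left_diff_distrib)
      qed
    qed
    moreover have "(p - q p) * n = p * n" using nq[OF p] comm[of n "q p"] by (simp add: left_diff_distrib)
    ultimately show ?thesis by (simp add: s_def right_diff_distrib)
  qed
  have "negligible_set ((E - U s) \<union> (U s \<inter> X - E))"
    unfolding negligible_set_def
  proof (intro conjI ballI)
    fix p assume p: "p \<in> FF"
    have "coverable (((E \<inter> U p - U (q p)) \<union> (U (q p) \<inter> X - E \<inter> U p)) \<inter> U p)"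
      using q[OF p] p by (simp add: represents_def negligible_set_def)
    moreover have "U (q p) = U p \<inter> U s" using U_mult[OF FF(1)[OF p] s] ps[OF p] by simp
    ultimately show "coverable (((E - U s) \<union> (U s \<inter> X - E)) \<inter> U p)"
      by (elim coverable_subset) auto
  qed (use assms in auto)
  then have "represents s E" using s assms(1) by (simp add: represents_def)
  then show ?thesis using represents_emeasure by blast
qed

lemma FF_disjoint: "p \<in> FF \<Longrightarrow> q \<in> FF \<Longrightarrow> p \<noteq> q \<Longrightarrow> U p \<inter> U q = {}"
  using U_mult[OF FF(1) FF(1), of p q] FF(4)[of p q] by simp

lemma proj_sum_FF:
  assumes "finite F" "F \<subseteq> FF"
  shows "proj (\<Sum>F)" "U (\<Sum>F) = (\<Union>p\<in>F. U p)" "\<And>q. q \<in> FF \<Longrightarrow> q \<notin> F \<Longrightarrow> q * \<Sum>F = 0"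
proof -
  have "proj (\<Sum>F) \<and> U (\<Sum>F) = (\<Union>p\<in>F. U p) \<and> (\<forall>q\<in>FF - F. q * \<Sum>F = 0)"
    using assms
  proof (induction F)
    case (insert p F)
    then have IH: "proj (\<Sum>F)" "U (\<Sum>F) = (\<Union>p\<in>F. U p)" "\<forall>q\<in>FF - F. q * \<Sum>F = 0" and p: "p \<in> FF" "p \<notin> F"
      by auto
    have pF: "p * \<Sum>F = 0" using IH p by blast
    have "proj (p + \<Sum>F)" using IH FF(1) p pF by (intro proj_add) auto
    moreover have "U (p + \<Sum>F) = U p \<union> U (\<Sum>F)"
    proof -
      have "\<omega> p * \<omega> (\<Sum>F) = 0" if "character \<omega>" for \<omega>
        using arg_cong[OF pF, of \<omega>] that by (simp add: characterD)
      then show ?thesis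
        using character_proj_cases[OF _ FF(1)[OF p(1)]] character_proj_cases[OF _ IH(1)]
        by (fastforce simp: U_def characterD(1))
    qed
    moreover have "q * (p + \<Sum>F) = 0" if "q \<in> FF - insert p F" for q
      using that IH(3) FF(4)[of q p] p by (auto simp: distrib_left)
    ultimately show ?case using insert IH by auto
  qed auto
  then show "proj (\<Sum>F)" "U (\<Sum>F) = (\<Union>p\<in>F. U p)" "\<And>q. q \<in> FF \<Longrightarrow> q \<notin> F \<Longrightarrow> q * \<Sum>F = 0" by auto
qed

text \<open>Every point of \<open>X\<close> has the value 1 at some member of \<open>FF\<close>, so
  an upper bound of all \<open>q * p\<close> dominates \<open>q\<close> at every point of
  \<open>X\<close>, and \<open>positive_if_AE\<close> lifts this to the algebra. Normality then sums
  the trace over the whole family.\<close>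

lemma trace_proj_SUP:
  assumes q: "proj q"
  shows "\<tau> q = (SUP F\<in>{F. finite F \<and> F \<subseteq> FF}. \<tau> (q * \<Sum>F))"
proof -
  let ?\<F> = "{F. finite F \<and> F \<subseteq> FF}"
  let ?A = "(\<lambda>F. q * \<Sum>F) ` ?\<F>"
  have pr: "proj (q * \<Sum>F)" if "F \<in> ?\<F>" for F using proj_sum_FF(1) that q by auto
  have mono: "q * \<Sum>F \<sqsubseteq> q * \<Sum>G" if "F \<subseteq> G" "G \<in> ?\<F>" for F G
  proof -
    have "\<Sum>G - \<Sum>F = \<Sum>(G - F)" using that by (subst sum_diff) auto
    moreover have "\<Sum>(G - F) \<in> positive_cone" using that proj_sum_FF(1)[of "G - F"] by auto
    ultimately show ?thesis using q by (simp add: cstar_le_def positive_mult flip: right_diff_distrib)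
  qed
  have "\<tau> q = (SUP a\<in>?A. \<tau> a)"
  proof (rule trace_normal)
    show "?A \<subseteq> positive_cone" using pr by auto
    show "directed ?A"
      unfolding upward_directed_def
    proof (intro conjI ballI)
      fix x y assume "x \<in> ?A" "y \<in> ?A"
      then obtain F G where FG: "F \<in> ?\<F>" "G \<in> ?\<F>" "x = q * \<Sum>F" "y = q * \<Sum>G" by auto
      then show "\<exists>z\<in>?A. x \<sqsubseteq> z \<and> y \<sqsubseteq> z"
        using mono[of F "F \<union> G"] mono[of G "F \<union> G"] by (intro bexI[of _ "q * \<Sum>(F \<union> G)"]) auto
    qed auto
    show "is_sup ?A q"
      unfolding is_supremum_in_def
    proof (intro conjI ballI impI)
      show "q \<in> selfadjoint_part" using q by (simp add: selfadjoint_part_def projD)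
      fix a assume "a \<in> ?A"
      then obtain F where F: "F \<in> ?\<F>" "a = q * \<Sum>F" by auto
      then show "a \<sqsubseteq> q" using q pr proj_sum_FF(1)[of F] by (simp add: proj_le_iff ac projD)
    next
      fix u assume u: "u \<in> selfadjoint_part" "\<forall>a\<in>?A. a \<sqsubseteq> u"
      show "q \<sqsubseteq> u" unfolding cstar_le_def
      proof (rule positive_if_AE)
        show "star (u - q) = u - q" using u(1) q by (simp add: selfadjoint_part_def star_simps projD)
        show "AE \<omega> in N. 0 \<le> Re (\<omega> (u - q))"
        proof (rule AE_I2)
          fix \<omega> assume "\<omega> \<in> space N"
          then obtain p where p: "p \<in> FF" "\<omega> \<in> U p" by (auto simp: X_def)
          then have c: "character \<omega>" "\<omega> p = 1" by (auto simp: U_def)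
          have "q * p \<in> ?A" using p(1) by (intro image_eqI[of _ _ "{p}"]) auto
          then have "nonneg_complex (\<omega> (u - q * p))"
            using u(2) by (intro character_positive[OF c(1)]) (auto simp: cstar_le_def)
          then show "0 \<le> Re (\<omega> (u - q))" using c by (simp add: nonneg_complex_def characterD)
        qed
      qed
    qed
  qed
  then show ?thesis by (simp add: image_image)
qed

lemma emeasure_Int_U:
  assumes "E \<in> sets N" "p \<in> FF" shows "emeasure N (E \<inter> U p) = \<tau> (rep E * p)"
  using represents_emeasure[OF represents_Int_U[OF represents_rep FF(1)]] assms by (simp add: sets_N)

lemma proj_rep: "E \<in> sets N \<Longrightarrow> proj (rep E)"
  using represents_rep[of E] by (simp add: sets_N represents_def)

text \<open>The pieces are the sets \<open>U p\<close> with \<open>p\<close> in \<open>FF\<close>.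
  The infinite sum is the supremum of its finite partial sums, so additivity over uncountably many
  pieces is exactly \<open>trace_proj_SUP\<close>.\<close>

lemma decomposable_N: "decomposable N"
  unfolding decomposable_def
proof (intro exI conjI ballI)
  show "partition_on (space N) (U ` FF)"
  proof (rule partition_onI)
    show "\<Union> (U ` FF) = space N" by (simp add: X_def)
    show "disjnt S T" if "S \<in> U ` FF" "T \<in> U ` FF" "S \<noteq> T" for S T
      using that FF_disjoint by (auto simp: disjnt_def)
    show "{} \<notin> U ` FF"
    proof
      assume "{} \<in> U ` FF"
      then obtain p where "p \<in> FF" "U p = {}" by auto
      then show False using U_nonempty FF(1,2) by blast
    qed
  qed
  show "S \<in> sets N" "emeasure N S < \<infinity>" if "S \<in> U ` FF" for S
    using that U_FF_sets FF(3) by auto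
  show "sets N = {E. E \<subseteq> space N \<and> (\<forall>S\<in>U ` FF. E \<inter> S \<in> sets N)}"
  proof (intro set_eqI iffI CollectI conjI ballI)
    show "E \<subseteq> space N" if "E \<in> sets N" for E using sets_N_subset[OF that] by simp
    show "E \<inter> S \<in> sets N" if "E \<in> sets N" "S \<in> U ` FF" for E S
      using that U_FF_sets(1) by auto
    show "E \<in> sets N" if "E \<in> {E. E \<subseteq> space N \<and> (\<forall>S\<in>U ` FF. E \<inter> S \<in> sets N)}" for E
      by (rule sets_N_locally) (use that in auto)
  qed
  fix E assume E: "E \<in> sets N"
  have "inj_on U FF" using FF_disjoint U_nonempty FF(1,2) by (force intro: inj_onI)
  then have "(\<Sum>\<^sub>\<infinity>S\<in>U ` FF. emeasure N (E \<inter> S)) = (\<Sum>\<^sub>\<infinity>p\<in>FF. \<tau> (rep E * p))"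
    using E by (subst infsum_reindex) (auto simp: o_def emeasure_Int_U intro!: infsum_cong)
  also have "\<dots> = (SUP F\<in>{F. finite F \<and> F \<subseteq> FF}. \<Sum>p\<in>F. \<tau> (rep E * p))"
    by (rule nonneg_infsum_complete) simp
  also have "\<dots> = (SUP F\<in>{F. finite F \<and> F \<subseteq> FF}. \<tau> (rep E * \<Sum>F))"
  proof (rule SUP_cong[OF refl])
    fix F assume "F \<in> {F. finite F \<and> F \<subseteq> FF}"
    then show "(\<Sum>p\<in>F. \<tau> (rep E * p)) = \<tau> (rep E * \<Sum>F)"
      unfolding sum_distrib_left using proj_rep[OF E] FF(1) by (intro trace_sum[symmetric]) auto
  qed
  also have "\<dots> = emeasure N E"
    using trace_proj_SUP[OF proj_rep[OF E]] E by (simp add: emeasure_N)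
  finally show "emeasure N E = (\<Sum>\<^sub>\<infinity>S\<in>U ` FF. emeasure N (E \<inter> S))" by simp
qed

text \<open>By maximality of \<open>FF\<close>, a set of infinite measure meets some
  \<open>U p\<close> in positive measure. Suprema of projections exist in the algebra and are
  transported by the Gelfand isomorphism, under which \<open>Linf_proj_le\<close> becomes the order
  of projections.\<close>

lemma localizable_N: "localizable N"
  unfolding localizable_def semifinite_measure_def
proof (intro conjI ballI impI allI)
  fix E assume E: "E \<in> sets N" "emeasure N E = \<infinity>"
  then have "rep E \<noteq> 0" by (auto simp: emeasure_N)
  then obtain p where p: "p \<in> FF" "p * rep E \<noteq> 0" using FF(5)[OF proj_rep[OF E(1)]] by blast
  then have p': "rep E * p \<noteq> 0" using comm[of p "rep E"] by simp
  have pr: "proj (rep E * p)" using proj_rep[OF E(1)] FF(1)[OF p(1)] by auto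
  have "\<tau> (rep E * p) \<le> \<tau> p"
    using FF(1)[OF p(1)] pr by (intro trace_proj_mono) (simp_all add: mult.assoc projD)
  then have "\<tau> (rep E * p) < \<infinity>" using FF(3)[OF p(1)] by (rule order_le_less_trans)
  moreover have "0 < \<tau> (rep E * p)" using trace_eq_0D pr p' by (auto simp: zero_less_iff_neq_zero)
  ultimately show "\<exists>F\<in>sets N. F \<subseteq> E \<and> 0 < emeasure N F \<and> emeasure N F < \<infinity>"
    using emeasure_Int_U[OF E(1) p(1)] E(1) U_FF_sets(1)[OF p(1)] by (intro bexI[of _ "E \<inter> U p"]) auto
next
  fix \<P> assume \<P>: "\<P> \<subseteq> Linf_projections N \<and> upward_directed (Linf_proj_le N) \<P>"
  note iso = star_iso_gelfand[unfolded star_iso_Linf_def]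
  have inj: "gelfand x = gelfand y \<longleftrightarrow> x = y" for x y using iso by (auto simp: bij_betw_def dest: injD)
  have surj: "\<exists>x. F = gelfand x" if "F \<in> Linf N" for F
  proof -
    have "F \<in> range gelfand" using iso that by (simp add: bij_betw_def)
    then show ?thesis by blast
  qed
  have mem: "gelfand x \<in> Linf N" for x using iso by (auto simp: bij_betw_def)
  have mult: "Linf_mult N (gelfand x) (gelfand y) = gelfand (x * y)"
    and st: "Linf_star N (gelfand x) = gelfand (star x)" for x y using iso by auto
  have proj_iff: "gelfand x \<in> Linf_projections N \<longleftrightarrow> proj x" for x
    using mem by (auto simp: Linf_projections_def mult st inj proj_def)
  have le_iff: "Linf_proj_le N (gelfand x) (gelfand y) \<longleftrightarrow> x * y = x" for x y
    by (simp add: Linf_proj_le_def mult inj)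
  have in_image: "\<exists>x. F = gelfand x \<and> proj x" if "F \<in> Linf_projections N" for F
    using surj[of F] that proj_iff by (auto simp: Linf_projections_def)
  define A where "A = {x. gelfand x \<in> \<P>}"
  have prA: "proj x" if "x \<in> A" for x using that \<P> proj_iff by (auto simp: A_def)
  have PA: "\<P> = gelfand ` A" using \<P> in_image by (auto simp: A_def)
  have dir: "directed A"
  proof -
    have "A \<noteq> {}" using \<P> PA by (auto simp: upward_directed_def)
    moreover have "\<exists>z\<in>A. x * z = x \<and> y * z = y" if "x \<in> A" "y \<in> A" for x y
      using \<P> that unfolding PA upward_directed_def by (auto simp: le_iff)
    ultimately show ?thesis unfolding upward_directed_def using prA by (metis proj_le_iff)
  qed
  obtain s where s: "proj s" "is_sup A s"
    using directed_supremum_proj[OF dir] prA by blast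
  have "is_supremum_in (Linf_proj_le N) (Linf_projections N) \<P> (gelfand s)"
    unfolding is_supremum_in_def
  proof (intro conjI ballI impI)
    show "gelfand s \<in> Linf_projections N" using s proj_iff by simp
    fix F assume "F \<in> \<P>"
    then obtain a where "a \<in> A" "F = gelfand a" using PA by auto
    then show "Linf_proj_le N F (gelfand s)"
      using s prA by (auto simp: is_supremum_in_def le_iff proj_le_iff)
  next
    fix G assume G: "G \<in> Linf_projections N" "\<forall>F\<in>\<P>. Linf_proj_le N F G"
    then obtain u where u: "G = gelfand u" "proj u" using in_image by blast
    have "a \<sqsubseteq> u" if "a \<in> A" for a
      using G(2) that prA u by (auto simp: PA le_iff proj_le_iff)
    then have "s \<sqsubseteq> u" using s u(2) by (auto simp: is_supremum_in_def selfadjoint_part_def projD)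
    then show "Linf_proj_le N (gelfand s) G" using s u by (simp add: le_iff proj_le_iff)
  qed
  then show "\<exists>S. is_supremum_in (Linf_proj_le N) (Linf_projections N) \<P> S" by blast
qed

section \<open>Inner regularity and the Radon property\<close>

lemma coverable_finite_UN:
  assumes "finite F" "\<And>p. p \<in> F \<Longrightarrow> coverable (E p)"
  shows "coverable (\<Union>p\<in>F. E p)"
proof (cases "F = {}")
  case False
  then obtain f :: "nat \<Rightarrow> _" where f: "range f = F"
    using assms(1) by (metis uncountable_def countable_finite)
  have "coverable (\<Union>n. E (f n))" using assms(2) f by (intro coverable_UN) auto
  then show ?thesis by (simp add: f[symmetric])
qed simp

text \<open>The sets \<open>U c\<close> are themselves compact, so it suffices to fit one into
  \<open>E\<close>. Restricting to finitely many pieces makes the negligible part of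
  \<open>U q\<close> outside \<open>E\<close> coverable by a \<open>U t\<close> of small trace, and
  \<open>c\<close> is \<open>q\<close> cut down to these pieces with \<open>t\<close>
  removed.\<close>

lemma inner_regular_N:
  assumes E: "E \<in> sets N"
  shows "emeasure N E = (SUP C\<in>{C. compact C \<and> C \<subseteq> X \<and> C \<subseteq> E}. emeasure N C)"
proof (rule antisym)
  let ?q = "rep E"
  have q: "proj ?q" "represents ?q E" using proj_rep E represents_rep by (auto simp: sets_N)
  have "\<tau> (?q * \<Sum>F) \<le> (SUP C\<in>{C. compact C \<and> C \<subseteq> X \<and> C \<subseteq> E}. emeasure N C)" (is "_ \<le> ?S")
    if F: "finite F" "F \<subseteq> FF" for F
  proof (rule ennreal_le_epsilon)
    fix \<epsilon> :: real assume \<epsilon>: "0 < \<epsilon>"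
    let ?r = "\<Sum>F"
    have r: "proj ?r" "U ?r = (\<Union>p\<in>F. U p)" using proj_sum_FF[OF F] by auto
    have "coverable ((U ?q \<inter> X - E) \<inter> U p)" if "p \<in> F" for p
    proof -
      have "coverable (((E - U ?q) \<union> (U ?q \<inter> X - E)) \<inter> U p)"
        using q(2) that F by (auto simp: represents_def negligible_set_def)
      then show ?thesis by (rule coverable_subset) auto
    qed
    then have "coverable (\<Union>p\<in>F. (U ?q \<inter> X - E) \<inter> U p)" using F by (intro coverable_finite_UN)
    then obtain t where t: "proj t" "(\<Union>p\<in>F. (U ?q \<inter> X - E) \<inter> U p) \<subseteq> U t" "\<tau> t < ennreal \<epsilon>"
      using coverableD[of _ "ennreal \<epsilon>"] \<epsilon> by force
    define c where "c = ?q * ?r * (e - t)"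
    have c: "proj c" using q r t by (auto simp: c_def)
    have Uc: "U c = U ?q \<inter> U ?r \<inter> U (e - t)"
      using q r t by (simp add: c_def U_mult proj_mult proj_compl)
    have cX: "U c \<subseteq> X" using F by (auto simp: Uc r X_def)
    have cE: "U c \<subseteq> E"
    proof
      fix \<omega> assume \<omega>: "\<omega> \<in> U c"
      then have "\<omega> \<in> X" "\<omega> \<notin> U t" using cX X_compl[OF _ t(1)] by (auto simp: Uc)
      then show "\<omega> \<in> E" using \<omega> t(2) by (auto simp: Uc r)
    qed
    have "\<tau> (?q * ?r) = \<tau> (c + ?q * ?r * t)" by (simp add: c_def right_diff_distrib)
    also have "\<dots> = \<tau> c + \<tau> (?q * ?r * t)" using c q r t by (intro trace_add) auto
    also have "\<dots> \<le> \<tau> c + \<tau> t"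
      using q r t by (intro add_left_mono trace_proj_mono proj_mult) (auto simp: mult.assoc projD)
    also have "\<dots> \<le> ?S + ennreal \<epsilon>"
    proof (rule add_mono)
      have "\<tau> c = emeasure N (U c)"
        using represents_emeasure[OF represents_U[OF c]] cX by (simp add: Int_absorb2)
      also have "\<dots> \<le> ?S" using compact_U cX cE by (intro SUP_upper) auto
      finally show "\<tau> c \<le> ?S" .
    qed (use t in auto)
    finally show "\<tau> (?q * ?r) \<le> ?S + ennreal \<epsilon>" .
  qed
  then show "emeasure N E \<le> (SUP C\<in>{C. compact C \<and> C \<subseteq> X \<and> C \<subseteq> E}. emeasure N C)"
    unfolding emeasure_N[OF E] trace_proj_SUP[OF q(1)] by (intro SUP_least) auto
  show "(SUP C\<in>{C. compact C \<and> C \<subseteq> X \<and> C \<subseteq> E}. emeasure N C) \<le> emeasure N E"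
    using E by (intro SUP_least) (auto intro: emeasure_mono)
qed

lemma radon_N: "radon_measure_space (top_of_set X) N"
  unfolding radon_measure_space_def
proof (intro conjI allI impI ballI)
  show "complete_measure N"
    using null_subset_sets by (auto simp: complete_measure_def)
  show "E \<in> sets N" if "E \<subseteq> space N \<and> (\<forall>F\<in>sets N. emeasure N F < \<infinity> \<longrightarrow> E \<inter> F \<in> sets N)" for E
  proof (rule sets_N_locally)
    show "E \<subseteq> X" using that by simp
    show "E \<inter> U p \<in> sets N" if "p \<in> FF" for p
    proof -
      have "U p \<in> sets N" "emeasure N (U p) < \<infinity>"
        using U_FF_sets[OF that] FF(3)[OF that] by auto
      with \<open>E \<subseteq> space N \<and> _\<close> show ?thesis by blast
    qed
  qed
  show "Hausdorff_space (top_of_set X)"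
    by (intro Hausdorff_space_subtopology)
      (simp add: Hausdorff_space_product_topology flip: euclidean_product_topology)
  show "W \<in> sets N" if "openin (top_of_set X) W" for W
    using that open_sets_N by (auto simp: openin_open)
  show "emeasure N E = (SUP C\<in>{C. compactin (top_of_set X) C \<and> C \<subseteq> E}. emeasure N C)" if "E \<in> sets N" for E
    using inner_regular_N[OF that] by (simp add: compactin_subtopology conj_assoc)
  fix \<omega> assume "\<omega> \<in> topspace (top_of_set X)"
  then obtain p where p: "p \<in> FF" "\<omega> \<in> U p" by (auto simp: X_def)
  \<comment> \<open>The compact set \<open>U p\<close> is also relatively open: its complement in
    \<open>X\<close> is cut out by the closed set \<open>U (e - p)\<close>.\<close>
  have "U p = X \<inter> - U (e - p)" using X_compl[OF _ FF(1)[OF p(1)]] U_FF_subset[OF p(1)] by auto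
  then have "openin (top_of_set X) (U p)" using closed_U[of "e - p"] by (auto simp: openin_open open_Compl)
  then show "\<exists>W. openin (top_of_set X) W \<and> \<omega> \<in> W \<and> emeasure N W < \<infinity>"
    using p U_FF_sets(2) FF(3) by auto
qed simp

end

section \<open>The equivalences and the choice of the isomorphism\<close>

lemma abelian_wstar_Linf:
  fixes D :: "'a::cstar_algebra \<Rightarrow> 'p::complex_banach \<Rightarrow> complex" and \<tau> :: "'a \<Rightarrow> ennreal"
  assumes D: "predual_iso D" and \<tau>: "fns_trace \<tau>" and comm: "\<forall>x y :: 'a. x * y = y * x"
  obtains M :: "('a \<Rightarrow> complex) measure" and T I where "localizable M" "decomposable M"
    "radon_measure_space T M" "star_iso_Linf I M" "trace_is_integral \<tau> I M"
proof -
  interpret abelian_cstar "TYPE('a)" using comm by unfold_locales auto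
  obtain e :: 'a where "\<And>x. e * x = x" using unit_exists[OF D] by blast
  then interpret traced_abelian_wstar "TYPE('a)" e D \<tau>
    using D \<tau> by unfold_locales auto
  show ?thesis
    using localizable_N decomposable_N radon_N star_iso_gelfand trace_is_integral_gelfand by (rule that)
qed

text \<open>A type cannot be quantified inside a formula. The equivalences therefore name the
  carrier type of the constructed space, while the last three conjuncts start from a measure space
  over any type \<open>'x\<close> and return an isomorphism with the trace formula on the
  constructed space.\<close>

theorem theorem7p21:
  fixes D :: "'a::cstar_algebra \<Rightarrow> 'p::complex_banach \<Rightarrow> complex"
    and \<tau> :: "'a \<Rightarrow> ennreal"
  assumes "predual_iso D" and "fns_trace \<tau>"
  shows
    "((\<forall>x y :: 'a. x * y = y * x) \<longleftrightarrow>
        (\<exists>(N :: ('a \<Rightarrow> complex) measure) (I :: 'a \<Rightarrow> _). localizable N \<and> star_iso_Linf I N)) \<and>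
     ((\<forall>x y :: 'a. x * y = y * x) \<longleftrightarrow>
        (\<exists>(N :: ('a \<Rightarrow> complex) measure) (I :: 'a \<Rightarrow> _). decomposable N \<and> star_iso_Linf I N)) \<and>
     ((\<forall>x y :: 'a. x * y = y * x) \<longleftrightarrow>
        (\<exists>T (N :: ('a \<Rightarrow> complex) measure) (I :: 'a \<Rightarrow> _). radon_measure_space T N \<and> star_iso_Linf I N)) \<and>
     ((\<exists>(N :: 'x measure) (I :: 'a \<Rightarrow> _). localizable N \<and> star_iso_Linf I N) \<longrightarrow>
        (\<forall>x y :: 'a. x * y = y * x) \<and>
        (\<exists>(N :: ('a \<Rightarrow> complex) measure) I. localizable N \<and> star_iso_Linf I N \<and> trace_is_integral \<tau> I N)) \<and>
     ((\<exists>(N :: 'x measure) (I :: 'a \<Rightarrow> _). decomposable N \<and> star_iso_Linf I N) \<longrightarrow>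
        (\<forall>x y :: 'a. x * y = y * x) \<and>
        (\<exists>(N :: ('a \<Rightarrow> complex) measure) I. decomposable N \<and> star_iso_Linf I N \<and> trace_is_integral \<tau> I N)) \<and>
     ((\<exists>T (N :: 'x measure) (I :: 'a \<Rightarrow> _). radon_measure_space T N \<and> star_iso_Linf I N) \<longrightarrow>
        (\<forall>x y :: 'a. x * y = y * x) \<and>
        (\<exists>T (N :: ('a \<Rightarrow> complex) measure) I.
           radon_measure_space T N \<and> star_iso_Linf I N \<and> trace_is_integral \<tau> I N))"
proof -
  have conv1: "\<forall>x y :: 'a. x * y = y * x" if "star_iso_Linf I N"
    for N :: "('a \<Rightarrow> complex) measure" and I :: "'a \<Rightarrow> _"
    using star_iso_Linf_commutative[OF that] by blast
  have conv2: "\<forall>x y :: 'a. x * y = y * x" if "star_iso_Linf I N"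
    for N :: "'x measure" and I :: "'a \<Rightarrow> _"
    using star_iso_Linf_commutative[OF that] by blast
  have main: "\<exists>(N :: ('a \<Rightarrow> complex) measure) T (I :: 'a \<Rightarrow> _). localizable N \<and> decomposable N \<and>
      radon_measure_space T N \<and> star_iso_Linf I N \<and> trace_is_integral \<tau> I N"
    if "\<forall>x y :: 'a. x * y = y * x"
    by (rule abelian_wstar_Linf[OF assms that]) blast
  show ?thesis
    by (intro conjI iffI impI) (use conv1 conv2 main in \<open>meson+\<close>)
qed

end
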